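(* Let $T>0$ and assume the following. (1) $\mathcal M$ is a compact, geodesically strongly convex Riemannian manifold of class $C^3$ with $C^1$ boundary $\partial\mathcal M$; $\Gamma\subset\mathcal M$ is a nonempty closed set with $\mathcal M\setminus\Gamma$ open (so that $\partial\mathcal M\subseteq\Gamma$). (2) $P\in\mathrm{Lip}(\mathcal M\setminus\Gamma)$ is non-negative and $f_0\in\mathrm{Lip}(\mathcal M)$. (3) There are $a_0,d_0>0$ such that $\widetilde d(\cdot,\Gamma)$ is $C^1$ on $\mathcal N\setminus\Gamma$, where $\mathcal N=\{x\in\mathcal M:\widetilde d(x,\Gamma)<a_0\}$, and $\|\mathrm{grad}\,\widetilde d(x,\Gamma)\|_x\ge d_0$ for all $x\in\mathcal N\setminus\Gamma$. (4) There is $\delta>0$ such that for all $x\in\mathcal M$, $\mathrm{Cut}(x)\cap\{y\in\mathcal M:d_{\mathcal M}(x,y)\le\delta\}=\emptyset$. (5) There exists $\psi_b\in\mathrm{Lip}(\mathcal M)$ with $\psi_b=f_0$ on $\Gamma$ such that $\psi_b$ (viewed as a time-independent function) is a viscosity sub-solution of the problem $(\mathcal P)$ in $\mathcal M_T$. Then the viscosity solution $f$ of $(\mathcal P)$ satisfies: for all $x\in\mathcal M$, $f(x,\cdot)\in\mathrm{Lip}([0,T[)$ with $$L_{f(x,\cdot)}\le L_{f_0}+\|P\|_{L^\infty(\mathcal M\setminus\Gamma)};$$ and for all $x,y\in\mathcal M$ with $d_{\mathcal M}(x,y)\le\delta$ and all $t\in[0,T]$, $$|f(x,t)-f(y,t)|\le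 K\,d_{\mathcal M}(x,y)\qquad\text{with }K=L_{f_0}+2\|P\|_{L^\infty(\mathcal M\setminus\Gamma)}.$$
   Context: $d_{\mathcal M}$ is the Riemannian distance of $(\mathcal M,g)$, $\|\cdot\|_x$ the norm induced by $g$ on $T_x\mathcal M$, $\mathrm{grad}$ the Riemannian gradient in the space variable. $\mathrm{Lip}(A)$ is the set of real Lipschitz functions on $A$ (for $d_{\mathcal M}$ when $A\subset\mathcal M$); $L_h$ is the Lipschitz constant of $h$; $L^\infty$ norms are supremum norms. "Geodesically strongly convex" means that every two points of $\mathcal M$ are joined by a unique minimizing geodesic, whose interior lies in the interior of $\mathcal M$. $\mathrm{Cut}(x)$ is the set of $y$ such that there is a minimal geodesic from $x$ to $y$ every extension of which beyond $y$ is no longer minimal. $\widetilde d$ is a distance function on $\mathcal M$ approximating $d_{\mathcal M}$, in the sense that $\max_{\mathcal M\times\mathcal M}|\widetilde d-d_{\mathcal M}|\le C_{\mathcal M}\varepsilon^{1+\xi}$ for a constant $C_{\mathcal M}$, some $\xi>0$ and a fixed scale $\varepsilon>0$; $\widetilde d(x,\Gamma)=\inf_{y\in\Gamma}\widetilde d(x,y)$. Problem $(\mathcal P)$: $$\partial_tf(x,t)+\|\mathrm{grad} f(x,t)\|_x=P(x)\ \text{ on }(\mathcal M\setminus\Gamma)\times]0,T[,\qquad f(x,t)=f_0(x)\ \text{ on }\partial\mathcal M_T:=(\Gamma\times]0,T[)\cup(\mathcal M\times\{0\}),$$ with $\mathcal M_T=\mathcal M\times[0,T[$. An usc $f:\mathcal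 M_T\to\mathbb R$ is a viscosity sub-solution in $\mathcal M_T$ if $f\le f_0$ on $\partial\mathcal M_T$ and for every $(x_0,t_0)\in(\mathcal M\setminus\Gamma)\times]0,T[$ and every $\varphi$ of class $C^1$ near $(x_0,t_0)$ such that $f-\varphi$ has a local maximum at $(x_0,t_0)$, $\partial_t\varphi(x_0,t_0)+\|\mathrm{grad}\varphi(x_0,t_0)\|_{x_0}\le P(x_0)$. Super-solutions (lsc) are defined symmetrically (local minimum, reversed inequalities, $f\ge f_0$ on $\partial\mathcal M_T$). A locally bounded $f:\mathcal M_T\to\mathbb R$ is a viscosity solution if its usc envelope $f^*$ is a sub-solution and its lsc envelope $f_*$ is a super-solution. Under the stated hypotheses the viscosity solution exists and is unique; its value at $t=T$ is understood as the limit $t\to T$. *)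

theory Defs
  imports "HOL-Analysis.Analysis"
begin

section \<open>Functions of class \<open>C\<^sup>k\<close>\<close>

text \<open>\<open>Ck_on k S f\<close> is meant for open \<open>S\<close> in a finite-dimensional space, where it suffices to
  control the directional derivatives.\<close>

primrec Ck_on :: "nat \<Rightarrow> 'a::real_normed_vector set \<Rightarrow> ('a \<Rightarrow> 'b::real_normed_vector) \<Rightarrow> bool" where
  "Ck_on 0 S f = continuous_on S f"
| "Ck_on (Suc k) S f =
     ((\<forall>x\<in>S. f differentiable (at x)) \<and> (\<forall>v. Ck_on k S (\<lambda>x. frechet_derivative f (at x) v)))"

text \<open>On a set that need not be open, \<open>C\<^sup>k\<close> means: locally the restriction of a \<open>C\<^sup>k\<close> function
  defined on an open set.\<close>

definition Ck_on_subset ::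
    "nat \<Rightarrow> 'a::real_normed_vector set \<Rightarrow> ('a \<Rightarrow> 'b::real_normed_vector) \<Rightarrow> bool" where
  "Ck_on_subset k S f \<longleftrightarrow>
     (\<forall>p\<in>S. \<exists>W F. open W \<and> p \<in> W \<and> Ck_on k W F \<and> (\<forall>q\<in>W \<inter> S. F q = f q))"

text \<open>Near each of its points, \<open>S\<close> is either a full neighbourhood or one side \<open>{\<rho> \<ge> 0}\<close> of a
  regular \<open>C\<^sup>1\<close> hypersurface.\<close>

definition locally_C1_domain :: "'e::euclidean_space set \<Rightarrow> bool" where
  "locally_C1_domain S \<longleftrightarrow>
     (\<forall>p\<in>S. p \<in> interior S \<or>
        (\<exists>W (\<rho> :: 'e \<Rightarrow> real). open W \<and> p \<in> W \<and> Ck_on 1 W \<rho> \<and> \<rho> p = 0 \<and>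
           (\<exists>v. frechet_derivative \<rho> (at p) v \<noteq> 0) \<and> S \<inter> W = {q\<in>W. \<rho> q \<ge> 0}))"


section \<open>Riemannian manifolds of class \<open>C\<^sup>3\<close> with \<open>C\<^sup>1\<close> boundary\<close>

text \<open>The points of the manifold are the elements of the type \<open>'m\<close>. A chart is a pair of its domain
  and its coordinate map into the Euclidean space \<open>'e\<close>; the map is irrelevant outside the domain.
  A Riemannian metric is given by its coordinate expression in every chart of the atlas:
  \<open>metric R c x u v\<close> is \<open>g\<^sub>x(u, v)\<close> for the tangent vectors at \<open>x\<close> with components \<open>u\<close> and \<open>v\<close> in
  the chart \<open>c\<close>.\<close>

type_synonym ('m, 'e) chart = "'m set \<times> ('m \<Rightarrow> 'e)"

abbreviation chart_dom :: "('m, 'e) chart \<Rightarrow> 'm set" where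
  "chart_dom c \<equiv> fst c"

abbreviation chart_map :: "('m, 'e) chart \<Rightarrow> 'm \<Rightarrow> 'e" where
  "chart_map c \<equiv> snd c"

abbreviation chart_image :: "('m, 'e) chart \<Rightarrow> 'e set" where
  "chart_image c \<equiv> chart_map c ` chart_dom c"

abbreviation chart_inv :: "('m, 'e) chart \<Rightarrow> 'e \<Rightarrow> 'm" where
  "chart_inv c \<equiv> inv_into (chart_dom c) (chart_map c)"

record ('m, 'e) rmanifold =
  charts :: "('m, 'e) chart set"
  metric :: "('m, 'e) chart \<Rightarrow> 'm \<Rightarrow> 'e \<Rightarrow> 'e \<Rightarrow> real"

text \<open>The transition maps are \<open>C\<^sup>3\<close>, while the chart images are only required to be domains with
  \<open>C\<^sup>1\<close> boundary (a half-space model would force the boundary to be \<open>C\<^sup>3\<close> as well).\<close>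

definition C3_atlas_C1_boundary ::
    "('m::{t2_space,second_countable_topology}, 'e::euclidean_space) chart set \<Rightarrow> bool" where
  "C3_atlas_C1_boundary A \<longleftrightarrow>
     (\<Union>c\<in>A. chart_dom c) = UNIV \<and>
     (\<forall>c\<in>A. open (chart_dom c) \<and>
        homeomorphism (chart_dom c) (chart_image c) (chart_map c) (chart_inv c) \<and>
        locally_C1_domain (chart_image c)) \<and>
     (\<forall>c\<in>A. \<forall>c'\<in>A. Ck_on_subset 3 (chart_map c ` (chart_dom c \<inter> chart_dom c'))
        (chart_map c' \<circ> chart_inv c))"

text \<open>On a \<open>C\<^sup>3\<close> manifold the natural (and best possible) regularity of a metric tensor is \<open>C\<^sup>2\<close>.\<close>

definition riemannian_manifold ::
    "('m::{t2_space,second_countable_topology}, 'e::euclidean_space) rmanifold \<Rightarrow> bool" where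
  "riemannian_manifold R \<longleftrightarrow>
     C3_atlas_C1_boundary (charts R) \<and>
     (\<forall>c\<in>charts R. \<forall>x\<in>chart_dom c.
        bilinear (metric R c x) \<and>
        (\<forall>u v. metric R c x u v = metric R c x v u) \<and>
        (\<forall>u. u \<noteq> 0 \<longrightarrow> metric R c x u u > 0)) \<and>
     (\<forall>c\<in>charts R. \<forall>u v. Ck_on_subset 2 (chart_image c) (\<lambda>q. metric R c (chart_inv c q) u v)) \<and>
     (\<forall>c\<in>charts R. \<forall>c'\<in>charts R. \<forall>x\<in>chart_dom c \<inter> chart_dom c'. \<forall>D.
        ((chart_map c' \<circ> chart_inv c) has_derivative D)
           (at (chart_map c x) within chart_map c ` (chart_dom c \<inter> chart_dom c')) \<longrightarrow>
        (\<forall>u v. metric R c x u v = metric R c' x (D u) (D v)))"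

definition mboundary :: "('m, 'e::euclidean_space) rmanifold \<Rightarrow> 'm set" where
  "mboundary R =
     {x. \<exists>c\<in>charts R. x \<in> chart_dom c \<and> chart_map c x \<notin> interior (chart_image c)}"

text \<open>The tangent space at \<open>x\<close> is identified with \<open>'e\<close> by means of an arbitrarily chosen chart
  around \<open>x\<close>.\<close>

definition chart_at :: "('m, 'e) rmanifold \<Rightarrow> 'm \<Rightarrow> ('m, 'e) chart" where
  "chart_at R x = (SOME c. c \<in> charts R \<and> x \<in> chart_dom c)"

definition rnorm :: "('m, 'e) rmanifold \<Rightarrow> 'm \<Rightarrow> 'e \<Rightarrow> real" where
  "rnorm R x v = sqrt (metric R (chart_at R x) x v v)"

definition grad :: "('m, 'e::euclidean_space) rmanifold \<Rightarrow> ('m \<Rightarrow> real) \<Rightarrow> 'm \<Rightarrow> 'e" where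
  "grad R h x =
     (let c = chart_at R x in
      THE v. \<forall>w. metric R c x v w = frechet_derivative (h \<circ> chart_inv c) (at (chart_map c x)) w)"


section \<open>Curves, Riemannian distance, geodesics\<close>

definition coord_velocity ::
    "('m, 'e::euclidean_space) chart \<Rightarrow> real \<Rightarrow> (real \<Rightarrow> 'm) \<Rightarrow> real \<Rightarrow> 'e" where
  "coord_velocity c b \<gamma> t = vector_derivative (chart_map c \<circ> \<gamma>) (at t within {0..b})"

text \<open>\<open>C\<^sup>1\<close> curves on \<open>[0, b]\<close>; the velocity is allowed to vanish.\<close>

definition C1_curve ::
    "('m::topological_space, 'e::euclidean_space) rmanifold \<Rightarrow> real \<Rightarrow> (real \<Rightarrow> 'm) \<Rightarrow> bool" where
  "C1_curve R b \<gamma> \<longleftrightarrow> continuous_on {0..b} \<gamma> \<and>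
     (\<forall>c\<in>charts R.
        (\<forall>t\<in>{0..b}. \<gamma> t \<in> chart_dom c \<longrightarrow>
           (chart_map c \<circ> \<gamma>) differentiable (at t within {0..b})) \<and>
        continuous_on {t\<in>{0..b}. \<gamma> t \<in> chart_dom c} (coord_velocity c b \<gamma>))"

definition curve_length ::
    "('m, 'e::euclidean_space) rmanifold \<Rightarrow> real \<Rightarrow> (real \<Rightarrow> 'm) \<Rightarrow> real" where
  "curve_length R b \<gamma> =
     integral {0..b} (\<lambda>t. rnorm R (\<gamma> t) (coord_velocity (chart_at R (\<gamma> t)) b \<gamma> t))"

definition rdist ::
    "('m::topological_space, 'e::euclidean_space) rmanifold \<Rightarrow> 'm \<Rightarrow> 'm \<Rightarrow> real" where
  "rdist R x y = Inf {curve_length R 1 \<gamma> | \<gamma>. C1_curve R 1 \<gamma> \<and> \<gamma> 0 = x \<and> \<gamma> 1 = y}"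

text \<open>Christoffel symbols of the first kind, \<open>(\<partial>\<^sub>u g(v, w) + \<partial>\<^sub>v g(u, w) - \<partial>\<^sub>w g(u, v)) / 2\<close>, in the
  coordinates of the chart \<open>c\<close>.\<close>

definition christoffel1 ::
    "('m, 'e::euclidean_space) rmanifold \<Rightarrow> ('m, 'e) chart \<Rightarrow> 'm \<Rightarrow> 'e \<Rightarrow> 'e \<Rightarrow> 'e \<Rightarrow> real" where
  "christoffel1 R c x u v w =
     (let dg = (\<lambda>z a b. frechet_derivative (\<lambda>q. metric R c (chart_inv c q) a b)
                  (at (chart_map c x) within chart_image c) z)
      in (dg u v w + dg v u w - dg w u v) / 2)"

text \<open>Affinely parametrized geodesics on \<open>[0, b]\<close>: the geodesic equation
  \<open>\<nabla>\<^bsub>\<gamma>'\<^esub> \<gamma>' = 0\<close> with the index lowered.\<close>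

definition geodesic ::
    "('m::topological_space, 'e::euclidean_space) rmanifold \<Rightarrow> real \<Rightarrow> (real \<Rightarrow> 'm) \<Rightarrow> bool" where
  "geodesic R b \<gamma> \<longleftrightarrow> C1_curve R b \<gamma> \<and>
     (\<forall>c\<in>charts R. \<forall>t\<in>{0..b}. \<gamma> t \<in> chart_dom c \<longrightarrow>
        (let v = coord_velocity c b \<gamma> in
         \<exists>a. (v has_vector_derivative a) (at t within {0..b}) \<and>
             (\<forall>w. metric R c (\<gamma> t) a w + christoffel1 R c (\<gamma> t) (v t) (v t) w = 0)))"

definition minimizing_geodesic ::
    "('m::topological_space, 'e::euclidean_space) rmanifold \<Rightarrow> real \<Rightarrow> (real \<Rightarrow> 'm) \<Rightarrow> bool" where
  "minimizing_geodesic R b \<gamma> \<longleftrightarrow> geodesic R b \<gamma> \<and> curve_length R b \<gamma> = rdist R (\<gamma> 0) (\<gamma> b)"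

text \<open>The points \<open>x\<close> and \<open>y\<close> are taken to be distinct: for \<open>x = y\<close> in the boundary the minimizing
  geodesic is constant and never meets the interior.\<close>

definition geodesically_strongly_convex ::
    "('m::topological_space, 'e::euclidean_space) rmanifold \<Rightarrow> bool" where
  "geodesically_strongly_convex R \<longleftrightarrow>
     (\<forall>x y. x \<noteq> y \<longrightarrow>
        (\<exists>\<gamma>. minimizing_geodesic R 1 \<gamma> \<and> \<gamma> 0 = x \<and> \<gamma> 1 = y \<and>
             (\<forall>t\<in>{0<..<1}. \<gamma> t \<notin> mboundary R) \<and>
             (\<forall>\<eta>. minimizing_geodesic R 1 \<eta> \<and> \<eta> 0 = x \<and> \<eta> 1 = y \<longrightarrow>
                  (\<forall>t\<in>{0..1}. \<eta> t = \<gamma> t))))"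

definition geodesic_extension ::
    "('m::topological_space, 'e::euclidean_space) rmanifold \<Rightarrow>
     (real \<Rightarrow> 'm) \<Rightarrow> real \<Rightarrow> (real \<Rightarrow> 'm) \<Rightarrow> bool" where
  "geodesic_extension R \<gamma> b \<eta> \<longleftrightarrow> b > 1 \<and> geodesic R b \<eta> \<and> (\<forall>t\<in>{0..1}. \<eta> t = \<gamma> t)"

text \<open>The clause that an extension exists only matters at boundary points \<open>y\<close>. A minimal geodesic
  that leaves the manifold at \<open>y\<close> has no extension at all; if the condition on extensions were read
  as vacuously true there, then in a geodesically strongly convex manifold every boundary point
  would be a cut point of every other point.\<close>

definition Cut :: "('m::topological_space, 'e::euclidean_space) rmanifold \<Rightarrow> 'm \<Rightarrow> 'm set" where
  "Cut R x =
     {y. \<exists>\<gamma>. minimizing_geodesic R 1 \<gamma> \<and> \<gamma> 0 = x \<and> \<gamma> 1 = y \<and>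
           (\<exists>b \<eta>. geodesic_extension R \<gamma> b \<eta>) \<and>
           (\<forall>b \<eta>. geodesic_extension R \<gamma> b \<eta> \<longrightarrow> \<not> minimizing_geodesic R b \<eta>)}"


section \<open>Lipschitz functions and supremum norm\<close>

definition Lip :: "('a \<Rightarrow> 'a \<Rightarrow> real) \<Rightarrow> 'a set \<Rightarrow> ('a \<Rightarrow> real) set" where
  "Lip d A = {h. \<exists>L\<ge>0. \<forall>x\<in>A. \<forall>y\<in>A. \<bar>h x - h y\<bar> \<le> L * d x y}"

definition lip_const :: "('a \<Rightarrow> 'a \<Rightarrow> real) \<Rightarrow> 'a set \<Rightarrow> ('a \<Rightarrow> real) \<Rightarrow> real" where
  "lip_const d A h = Inf {L. L \<ge> 0 \<and> (\<forall>x\<in>A. \<forall>y\<in>A. \<bar>h x - h y\<bar> \<le> L * d x y)}"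

text \<open>Inserting \<open>0\<close> makes the norm on the empty set equal to \<open>0\<close>.\<close>

definition sup_norm :: "'a set \<Rightarrow> ('a \<Rightarrow> real) \<Rightarrow> real" where
  "sup_norm A h = Sup (insert 0 ((\<lambda>x. \<bar>h x\<bar>) ` A))"

definition dist_to_set :: "('a \<Rightarrow> 'a \<Rightarrow> real) \<Rightarrow> 'a set \<Rightarrow> 'a \<Rightarrow> real" where
  "dist_to_set d S x = (INF y\<in>S. d x y)"


section \<open>Viscosity solutions of the time-dependent eikonal equation\<close>

text \<open>The neighbourhoods below lie in chart images, so these notions are for interior points of the
  manifold.\<close>

definition C1_near ::
    "('m, 'e::euclidean_space) rmanifold \<Rightarrow> ('m \<Rightarrow> real) \<Rightarrow> 'm \<Rightarrow> bool" where
  "C1_near R h x \<longleftrightarrow>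
     (let c = chart_at R x in
      \<exists>W. open W \<and> chart_map c x \<in> W \<and> W \<subseteq> chart_image c \<and> Ck_on 1 W (h \<circ> chart_inv c))"

definition C1_near_spacetime ::
    "('m, 'e::euclidean_space) rmanifold \<Rightarrow> ('m \<times> real \<Rightarrow> real) \<Rightarrow> 'm \<Rightarrow> real \<Rightarrow> bool" where
  "C1_near_spacetime R \<phi> x t \<longleftrightarrow>
     (let c = chart_at R x in
      \<exists>W. open W \<and> (chart_map c x, t) \<in> W \<and> W \<subseteq> chart_image c \<times> UNIV \<and>
          Ck_on 1 W (\<lambda>(q, s). \<phi> (chart_inv c q, s)))"

definition cylinder :: "real \<Rightarrow> ('m \<times> real) set" where
  "cylinder T = UNIV \<times> {0..<T}"

definition parabolic_boundary :: "'m set \<Rightarrow> real \<Rightarrow> ('m \<times> real) set" where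
  "parabolic_boundary \<Gamma> T = \<Gamma> \<times> {0<..<T} \<union> UNIV \<times> {0}"

definition usc_on :: "'a::topological_space set \<Rightarrow> ('a \<Rightarrow> real) \<Rightarrow> bool" where
  "usc_on S f \<longleftrightarrow> (\<forall>p\<in>S. \<forall>a. f p < a \<longrightarrow> (\<forall>\<^sub>F q in at p within S. f q < a))"

definition lsc_on :: "'a::topological_space set \<Rightarrow> ('a \<Rightarrow> real) \<Rightarrow> bool" where
  "lsc_on S f \<longleftrightarrow> (\<forall>p\<in>S. \<forall>a. a < f p \<longrightarrow> (\<forall>\<^sub>F q in at p within S. a < f q))"

text \<open>The filter is that of all neighbourhoods of \<open>p\<close> in \<open>S\<close>, the point \<open>p\<close> included. For locally
  bounded \<open>f\<close> the upper and lower limits are finite at the points of \<open>S\<close>.\<close>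

definition usc_envelope :: "'a::topological_space set \<Rightarrow> ('a \<Rightarrow> real) \<Rightarrow> 'a \<Rightarrow> real" where
  "usc_envelope S f p = real_of_ereal (Limsup (inf (nhds p) (principal S)) (\<lambda>q. ereal (f q)))"

definition lsc_envelope :: "'a::topological_space set \<Rightarrow> ('a \<Rightarrow> real) \<Rightarrow> 'a \<Rightarrow> real" where
  "lsc_envelope S f p = real_of_ereal (Liminf (inf (nhds p) (principal S)) (\<lambda>q. ereal (f q)))"

definition locally_bounded_on :: "'a::topological_space set \<Rightarrow> ('a \<Rightarrow> real) \<Rightarrow> bool" where
  "locally_bounded_on S f \<longleftrightarrow>
     (\<forall>p\<in>S. \<exists>W B. open W \<and> p \<in> W \<and> (\<forall>q\<in>W \<inter> S. \<bar>f q\<bar> \<le> B))"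

definition viscosity_subsolution ::
    "('m::topological_space, 'e::euclidean_space) rmanifold \<Rightarrow> 'm set \<Rightarrow> ('m \<Rightarrow> real) \<Rightarrow>
     ('m \<Rightarrow> real) \<Rightarrow> real \<Rightarrow> ('m \<times> real \<Rightarrow> real) \<Rightarrow> bool" where
  "viscosity_subsolution R \<Gamma> P f\<^sub>0 T f \<longleftrightarrow>
     usc_on (cylinder T) f \<and>
     (\<forall>(x, t)\<in>parabolic_boundary \<Gamma> T. f (x, t) \<le> f\<^sub>0 x) \<and>
     (\<forall>x\<^sub>0 t\<^sub>0 \<phi>. x\<^sub>0 \<notin> \<Gamma> \<and> 0 < t\<^sub>0 \<and> t\<^sub>0 < T \<and> C1_near_spacetime R \<phi> x\<^sub>0 t\<^sub>0 \<and>
        (\<forall>\<^sub>F q in at (x\<^sub>0, t\<^sub>0) within cylinder T. f q - \<phi> q \<le> f (x\<^sub>0, t\<^sub>0) - \<phi> (x\<^sub>0, t\<^sub>0)) \<longrightarrow>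
        deriv (\<lambda>t. \<phi> (x\<^sub>0, t)) t\<^sub>0 + rnorm R x\<^sub>0 (grad R (\<lambda>x. \<phi> (x, t\<^sub>0)) x\<^sub>0) \<le> P x\<^sub>0)"

definition viscosity_supersolution ::
    "('m::topological_space, 'e::euclidean_space) rmanifold \<Rightarrow> 'm set \<Rightarrow> ('m \<Rightarrow> real) \<Rightarrow>
     ('m \<Rightarrow> real) \<Rightarrow> real \<Rightarrow> ('m \<times> real \<Rightarrow> real) \<Rightarrow> bool" where
  "viscosity_supersolution R \<Gamma> P f\<^sub>0 T f \<longleftrightarrow>
     lsc_on (cylinder T) f \<and>
     (\<forall>(x, t)\<in>parabolic_boundary \<Gamma> T. f (x, t) \<ge> f\<^sub>0 x) \<and>
     (\<forall>x\<^sub>0 t\<^sub>0 \<phi>. x\<^sub>0 \<notin> \<Gamma> \<and> 0 < t\<^sub>0 \<and> t\<^sub>0 < T \<and> C1_near_spacetime R \<phi> x\<^sub>0 t\<^sub>0 \<and>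
        (\<forall>\<^sub>F q in at (x\<^sub>0, t\<^sub>0) within cylinder T. f q - \<phi> q \<ge> f (x\<^sub>0, t\<^sub>0) - \<phi> (x\<^sub>0, t\<^sub>0)) \<longrightarrow>
        deriv (\<lambda>t. \<phi> (x\<^sub>0, t)) t\<^sub>0 + rnorm R x\<^sub>0 (grad R (\<lambda>x. \<phi> (x, t\<^sub>0)) x\<^sub>0) \<ge> P x\<^sub>0)"

definition viscosity_solution ::
    "('m::topological_space, 'e::euclidean_space) rmanifold \<Rightarrow> 'm set \<Rightarrow> ('m \<Rightarrow> real) \<Rightarrow>
     ('m \<Rightarrow> real) \<Rightarrow> real \<Rightarrow> ('m \<times> real \<Rightarrow> real) \<Rightarrow> bool" where
  "viscosity_solution R \<Gamma> P f\<^sub>0 T f \<longleftrightarrow>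
     locally_bounded_on (cylinder T) f \<and>
     viscosity_subsolution R \<Gamma> P f\<^sub>0 T (usc_envelope (cylinder T) f) \<and>
     viscosity_supersolution R \<Gamma> P f\<^sub>0 T (lsc_envelope (cylinder T) f)"

definition final_time_extension :: "real \<Rightarrow> ('m \<times> real \<Rightarrow> real) \<Rightarrow> 'm \<Rightarrow> real \<Rightarrow> real" where
  "final_time_extension T f x t = (if t < T then f (x, t) else Lim (at_left T) (\<lambda>s. f (x, s)))"

end

theory Submission
  imports Defs
begin

text \<open>
  Because the Dirichlet data are attained by both envelopes, the comparison principle holds by the
  usual doubling of variables, carried out in a chart around the maximum of \<open>f\<^sup>* - f\<^sub>*\<close>; it makes \<open>f\<close>
  continuous. Comparing with the barriers \<open>f\<^sub>0 - L t\<close> and \<open>f\<^sub>0 + \<parallel>P\<parallel> t\<close> (\<open>L\<close> the Lipschitz constant of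
  \<open>f\<^sub>0\<close>) and then with time translates of \<open>f\<close> itself gives the Lipschitz constant \<open>max L \<parallel>P\<parallel>\<close> in time.
  Off \<open>\<Gamma>\<close> the gradient is therefore at most \<open>\<parallel>P\<parallel> + max L \<parallel>P\<parallel>\<close> in the viscosity sense. This bound is
  transferred to the increments of \<open>f\<close> along an arbitrary \<open>C\<^sup>1\<close> curve by penalizing the distance to
  the curve, so that no smoothness of the distance function is needed; where the curve meets \<open>\<Gamma>\<close>,
  the Lipschitz bound of \<open>f\<^sub>0\<close> is used instead.
\<close>

section \<open>Inner products, semicontinuity and penalization\<close>

text \<open>The topology of \<open>'m\<close> and the length distance \<open>rdist\<close> are given
  independently and have to be related. Off \<open>\<Gamma>\<close> this is done by bounds for the
  metric on coordinate balls. At the boundary, where a straight coordinate segment may leave the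
  chart image, only local boundedness of \<open>rdist\<close> is extracted; it makes the supremum
  norm of \<open>P\<close> a genuine bound. Doubling fixes one chart around a maximum point, whereas
  its test points only converge to that point and have charts of their own in the definition of a
  viscosity solution. This is why jets in arbitrary charts are introduced. The doubling closes
  because the norms at nearby points of a coordinate ball differ by a factor
  \<open>1 + \<Lambda> * norm (q - q')\<close>: the error in the Hamiltonian is then of the order of
  the penalty, which vanishes in the limit. Nothing is known about \<open>f\<close> as
  \<open>t\<close> tends to \<open>T\<close> before the comparison is proved, which is the reason
  for a barrier in time. The constants of the statement arise from sharper ones by
  \<open>max L B \<le> L + B\<close>, where \<open>B\<close> is the norm of
  \<open>P\<close>.\<close>

definition inner_form :: "('e::euclidean_space \<Rightarrow> 'e \<Rightarrow> real) \<Rightarrow> bool" where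
  "inner_form b \<longleftrightarrow> bilinear b \<and> (\<forall>u v. b u v = b v u) \<and> (\<forall>u. u \<noteq> 0 \<longrightarrow> b u u > 0)"

text \<open>The musical isomorphism. A covector is stored as the vector \<open>p\<close> that
  represents it in the coordinate inner product, so \<open>sharp\<close> turns a coordinate gradient
  into the Riemannian one.\<close>

definition sharp :: "('e::euclidean_space \<Rightarrow> 'e \<Rightarrow> real) \<Rightarrow> 'e \<Rightarrow> 'e" where
  "sharp b p = (THE v. \<forall>w. b v w = p \<bullet> w)"

text \<open>The norm dual to \<open>sqrt (b w w)\<close>, that is, the supremum of
  \<open>p \<bullet> w\<close> over \<open>b\<close>-unit vectors \<open>w\<close>. For the metric
  it is the Hamiltonian of the equation in coordinates.\<close>

definition dual_norm :: "('e::euclidean_space \<Rightarrow> 'e \<Rightarrow> real) \<Rightarrow> 'e \<Rightarrow> real" where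
  "dual_norm b p = sqrt (b (sharp b p) (sharp b p))"

lemma inner_form_linear:
  assumes "inner_form b"
  shows "linear (\<lambda>u. b u v)" "linear (b u)"
  using assms unfolding inner_form_def bilinear_def by auto

lemma inner_form_nonneg: "inner_form b \<Longrightarrow> b u u \<ge> 0"
  by (metis inner_form_def bilinear_lzero less_eq_real_def)

text \<open>\<open>?A\<close> is the Gram operator of \<open>b\<close>: positivity makes it
  injective, and finite dimension then surjective.\<close>

lemma inner_form_riesz:
  assumes b: "inner_form b" and l: "linear l"
  shows "\<exists>!v. \<forall>w. b v w = l w"
proof -
  let ?A = "\<lambda>v. \<Sum>i\<in>Basis. b v i *\<^sub>R i"
  have linA: "linear ?A"
    by (rule linearI)
      (auto simp: linear_add[OF inner_form_linear(1)[OF b]] linear_cmul[OF inner_form_linear(1)[OF b]]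
        scaleR_add_left sum.distrib scaleR_sum_right)
  have A_inner: "?A v \<bullet> w = b v w" for v w
  proof -
    have "b v w = b v (\<Sum>i\<in>Basis. (w \<bullet> i) *\<^sub>R i)" by (simp add: euclidean_representation)
    also have "\<dots> = (\<Sum>i\<in>Basis. (w \<bullet> i) * b v i)"
      by (simp add: linear_sum[OF inner_form_linear(2)[OF b]] linear_cmul[OF inner_form_linear(2)[OF b]])
    finally show ?thesis
      by (simp add: inner_sum_left mult.commute[of "b v _"] inner_commute[of w])
  qed
  have inj: "v = 0" if "?A v = 0" for v
  proof (rule ccontr)
    assume "v \<noteq> 0"
    then have "b v v > 0" using b unfolding inner_form_def by auto
    moreover have "b v v = 0" using A_inner[of v v] that by simp
    ultimately show False by simp
  qed
  have "inj ?A" using linear_injective_0[OF linA] inj by blast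
  then have "surj ?A" by (rule linear_inj_imp_surj[OF linA])
  let ?p = "\<Sum>i\<in>Basis. l i *\<^sub>R i"
  have p: "?p \<bullet> w = l w" for w
  proof -
    have "l w = l (\<Sum>i\<in>Basis. (w \<bullet> i) *\<^sub>R i)" by (simp add: euclidean_representation)
    also have "\<dots> = (\<Sum>i\<in>Basis. (w \<bullet> i) * l i)"
      by (simp add: linear_sum[OF l] linear_cmul[OF l])
    finally show ?thesis
      by (simp add: inner_sum_left mult.commute[of "l _"] inner_commute[of w])
  qed
  obtain v where v: "?p = ?A v" using \<open>surj ?A\<close> by (rule surjE)
  show ?thesis
  proof (rule ex1I[of _ v])
    show "\<forall>w. b v w = l w" using A_inner[of v] p unfolding v by simp
    fix v' assume "\<forall>w. b v' w = l w"
    then have "?A v' \<bullet> w = ?A v \<bullet> w" for w using A_inner[of v'] p unfolding v by simp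
    then have "?A v' = ?A v" by (intro vector_eq_rdot[THEN iffD1]) blast
    then show "v' = v" by (rule injD[OF \<open>inj ?A\<close>])
  qed
qed

lemma sharp_eqI:
  assumes "inner_form b" "\<And>w. b v w = p \<bullet> w"
  shows "sharp b p = v"
  unfolding sharp_def
  by (rule the1_equality[OF inner_form_riesz[OF assms(1) bounded_linear.linear[OF bounded_linear_inner_right]]])
    (use assms in auto)

lemma inner_sharp:
  assumes "inner_form b"
  shows "b (sharp b p) w = p \<bullet> w"
  unfolding sharp_def
  using theI'[OF inner_form_riesz[OF assms bounded_linear.linear[OF bounded_linear_inner_right]], of p]
  by blast

lemma inner_form_Cauchy_Schwarz:
  assumes b: "inner_form b"
  shows "b u w \<le> sqrt (b u u) * sqrt (b w w)"
proof (cases "w = 0")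
  case True
  then show ?thesis using b unfolding inner_form_def by (simp add: bilinear_rzero bilinear_lzero)
next
  case False
  then have pos: "b w w > 0" using b unfolding inner_form_def by auto
  have bl: "bilinear b" and sym: "b w u = b u w" using b unfolding inner_form_def by auto
  \<comment> \<open>\<open>?s *\<^sub>R w\<close> is the \<open>b\<close>-orthogonal projection of
    \<open>u\<close> onto the line spanned by \<open>w\<close>.\<close>
  let ?s = "b u w / b w w"
  have "0 \<le> b (u - ?s *\<^sub>R w) (u - ?s *\<^sub>R w)" by (rule inner_form_nonneg[OF b])
  also have "\<dots> = b u u - (b u w)\<^sup>2 / b w w"
    using pos sym
    by (simp add: bilinear_lsub[OF bl] bilinear_rsub[OF bl] bilinear_lmul[OF bl] bilinear_rmul[OF bl]
        field_simps power2_eq_square)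
  finally have "(b u w)\<^sup>2 \<le> b u u * b w w" using pos by (simp add: field_simps)
  then have "\<bar>b u w\<bar> \<le> sqrt (b u u * b w w)" by (rule real_le_rsqrt[of "\<bar>b u w\<bar>", simplified])
  then show ?thesis by (simp add: real_sqrt_mult)
qed

lemma dual_norm_nonneg: "inner_form b \<Longrightarrow> dual_norm b p \<ge> 0"
  by (simp add: dual_norm_def inner_form_nonneg)

lemma inner_le_dual_norm:
  assumes "inner_form b"
  shows "p \<bullet> w \<le> dual_norm b p * sqrt (b w w)"
  using inner_form_Cauchy_Schwarz[OF assms, of "sharp b p" w]
  by (simp add: inner_sharp[OF assms] dual_norm_def)

lemma dual_norm_sq:
  assumes "inner_form b"
  shows "dual_norm b p * sqrt (b (sharp b p) (sharp b p)) = p \<bullet> sharp b p"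
  using inner_form_nonneg[OF assms, of "sharp b p"]
  by (simp add: dual_norm_def) (simp add: inner_sharp[OF assms])

text \<open>The dual norm, as a supremum, is attained in the direction \<open>sharp b p\<close>, so
  an upper bound has to be tested at this single vector.\<close>

lemma dual_norm_leI:
  assumes b: "inner_form b" and k: "p \<bullet> sharp b p \<le> k * sqrt (b (sharp b p) (sharp b p))" and "k \<ge> 0"
  shows "dual_norm b p \<le> k"
proof (cases "dual_norm b p = 0")
  case True
  then show ?thesis using \<open>k \<ge> 0\<close> by simp
next
  case False
  then have "sqrt (b (sharp b p) (sharp b p)) > 0"
    using dual_norm_nonneg[OF b, of p] by (simp add: dual_norm_def)
  with k show ?thesis unfolding dual_norm_sq[OF b, symmetric] by simp
qed

lemma dual_norm_add_le:
  assumes b: "inner_form b"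
  shows "dual_norm b (p + q) \<le> dual_norm b p + dual_norm b q"
proof (rule dual_norm_leI[OF b])
  show "(p + q) \<bullet> sharp b (p + q)
      \<le> (dual_norm b p + dual_norm b q) * sqrt (b (sharp b (p + q)) (sharp b (p + q)))"
    using inner_le_dual_norm[OF b, of p "sharp b (p+q)"] inner_le_dual_norm[OF b, of q "sharp b (p+q)"]
    by (simp add: inner_add_left distrib_right)
qed (simp add: dual_norm_nonneg[OF b])

text \<open>Duality reverses the order of norms. This converts comparisons of the metric at nearby
  points into comparisons of the Hamiltonian.\<close>

lemma dual_norm_mono:
  assumes b: "inner_form b" and b': "inner_form b'" and "k \<ge> 0"
    and le: "\<And>v. sqrt (b' v v) \<le> k * sqrt (b v v)"
  shows "dual_norm b p \<le> k * dual_norm b' p"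
proof (rule dual_norm_leI[OF b])
  let ?v = "sharp b p"
  have "p \<bullet> ?v \<le> dual_norm b' p * sqrt (b' ?v ?v)" by (rule inner_le_dual_norm[OF b'])
  also have "\<dots> \<le> dual_norm b' p * (k * sqrt (b ?v ?v))"
    by (rule mult_left_mono[OF le dual_norm_nonneg[OF b']])
  finally show "p \<bullet> ?v \<le> k * dual_norm b' p * sqrt (b ?v ?v)" by (simp add: mult_ac)
qed (simp add: dual_norm_nonneg[OF b'] \<open>k \<ge> 0\<close>)

lemma dual_norm_le_norm:
  assumes b: "inner_form b" and "m > 0" and le: "\<And>v. m * norm v \<le> sqrt (b v v)"
  shows "dual_norm b p \<le> norm p / m"
proof (rule dual_norm_leI[OF b])
  have "p \<bullet> sharp b p \<le> norm p * norm (sharp b p)" by (rule norm_cauchy_schwarz)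
  also have "\<dots> \<le> norm p * (sqrt (b (sharp b p) (sharp b p)) / m)"
    by (rule mult_left_mono) (use le[of "sharp b p"] \<open>m > 0\<close> in \<open>simp_all add: field_simps\<close>)
  finally show "p \<bullet> sharp b p \<le> norm p / m * sqrt (b (sharp b p) (sharp b p))" by simp
qed (use \<open>m > 0\<close> in simp)

text \<open>Without a maximum every \<open>p\<close> has a strictly better point \<open>g p\<close>,
  and \<open>f\<close> stays below \<open>f (g p)\<close> near \<open>p\<close>. Among the finitely
  many \<open>g p\<close> of a subcover, the best one would have to be below itself.\<close>

lemma usc_attains_max:
  fixes f :: "'a::topological_space \<Rightarrow> real"
  assumes S: "compact S" "S \<noteq> {}" and f: "usc_on S f"
  shows "\<exists>p\<in>S. \<forall>q\<in>S. f q \<le> f p"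
proof (rule ccontr)
  assume "\<not> ?thesis"
  then have "\<forall>p\<in>S. \<exists>q\<in>S. f p < f q" by (meson not_le)
  then obtain g where g: "\<And>p. p \<in> S \<Longrightarrow> g p \<in> S \<and> f p < f (g p)" by metis
  have "\<exists>U. open U \<and> p \<in> U \<and> (\<forall>q\<in>U \<inter> S. f q < f (g p))" if "p \<in> S" for p
  proof -
    have "\<forall>\<^sub>F q in at p within S. f q < f (g p)" using f g that unfolding usc_on_def by auto
    then obtain U where "open U" "p \<in> U" "\<forall>q\<in>U. q \<noteq> p \<longrightarrow> q \<in> S \<longrightarrow> f q < f (g p)"
      unfolding eventually_at_topological by blast
    then show ?thesis using g that by (metis IntE)
  qed
  then have "\<exists>U. \<forall>p\<in>S. open (U p) \<and> p \<in> U p \<and> (\<forall>q\<in>U p \<inter> S. f q < f (g p))"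
    by (intro bchoice) blast
  then obtain U where U: "\<And>p. p \<in> S \<Longrightarrow> open (U p) \<and> p \<in> U p \<and> (\<forall>q\<in>U p \<inter> S. f q < f (g p))"
    by blast
  obtain D where D: "D \<subseteq> S" "finite D" "S \<subseteq> (\<Union>p\<in>D. U p)"
    by (rule compactE_image[OF S(1), of S U]) (use U in auto)
  then have "D \<noteq> {}" using S(2) by auto
  let ?m = "Max ((\<lambda>p. f (g p)) ` D)"
  have "?m \<in> (\<lambda>p. f (g p)) ` D" using D \<open>D \<noteq> {}\<close> by (intro Max_in) auto
  then obtain p where p: "p \<in> D" "?m = f (g p)" by auto
  have "g p \<in> S" using g p D by auto
  then obtain p' where p': "p' \<in> D" "g p \<in> U p'" using D by auto
  then have "f (g p) < f (g p')" using U D \<open>g p \<in> S\<close> by auto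
  also have "f (g p') \<le> ?m" using p' D by auto
  finally show False using p by simp
qed

lemma usc_on_subset: "usc_on S f \<Longrightarrow> A \<subseteq> S \<Longrightarrow> usc_on A f"
  unfolding usc_on_def by (meson subsetD at_le filter_leD)

lemma lsc_on_iff_usc_on: "lsc_on S f \<longleftrightarrow> usc_on S (\<lambda>x. - f x)"
proof
  assume "lsc_on S f"
  then show "usc_on S (\<lambda>x. - f x)"
    unfolding usc_on_def lsc_on_def by (auto simp: minus_less_iff[of _ "_::real"])
next
  assume R: "usc_on S (\<lambda>x. - f x)"
  show "lsc_on S f"
    unfolding lsc_on_def
  proof (intro ballI allI impI)
    fix p a assume "p \<in> S" "a < f p"
    then show "\<forall>\<^sub>F q in at p within S. a < f q"
      using R[unfolded usc_on_def, rule_format, of p "- a"] by simp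
  qed
qed

lemma usc_on_add:
  assumes f: "usc_on S f" and g: "usc_on S g"
  shows "usc_on S (\<lambda>x. f x + g x)"
  unfolding usc_on_def
proof (intro ballI allI impI)
  fix p a assume p: "p \<in> S" "f p + g p < a"
  let ?h = "(a - f p - g p) / 2"
  have "\<forall>\<^sub>F q in at p within S. f q < f p + ?h" "\<forall>\<^sub>F q in at p within S. g q < g p + ?h"
    using f g p unfolding usc_on_def by force+
  then show "\<forall>\<^sub>F q in at p within S. f q + g q < a"
    by eventually_elim (simp add: field_simps)
qed

lemma continuous_on_imp_usc_on: "continuous_on S f \<Longrightarrow> usc_on S (f :: 'a::topological_space \<Rightarrow> real)"
  unfolding usc_on_def continuous_on_def by (blast dest: order_tendstoD)

lemma usc_lsc_imp_continuous_on:
  fixes f :: "'a::topological_space \<Rightarrow> real"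
  shows "usc_on S f \<Longrightarrow> lsc_on S f \<Longrightarrow> continuous_on S f"
  unfolding usc_on_def lsc_on_def continuous_on_def by (blast intro: order_tendstoI)

lemma continuous_on_imp_lsc_on: "continuous_on S f \<Longrightarrow> lsc_on S (f :: 'a::topological_space \<Rightarrow> real)"
  unfolding lsc_on_iff_usc_on by (intro continuous_on_imp_usc_on continuous_intros)

lemma usc_on_compose:
  assumes f: "usc_on S f" and g: "continuous_on A g" and gA: "g ` A \<subseteq> S"
  shows "usc_on A (\<lambda>x. f (g x))"
  unfolding usc_on_def
proof (intro ballI allI impI)
  fix p a assume p: "p \<in> A" "f (g p) < a"
  have "g p \<in> S" using p gA by auto
  then have "\<forall>\<^sub>F q in at (g p) within S. f q < a" using f p unfolding usc_on_def by auto
  then obtain U where U: "open U" "g p \<in> U" "\<forall>q\<in>U. q \<noteq> g p \<longrightarrow> q \<in> S \<longrightarrow> f q < a"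
    unfolding eventually_at_topological by blast
  have "(g \<longlongrightarrow> g p) (at p within A)" using g p unfolding continuous_on_def by auto
  then have "\<forall>\<^sub>F q in at p within A. g q \<in> U" using U by (auto dest: topological_tendstoD)
  moreover have "\<forall>\<^sub>F q in at p within A. q \<in> A" by (simp add: eventually_at_filter)
  ultimately show "\<forall>\<^sub>F q in at p within A. f (g q) < a"
  proof eventually_elim
    case (elim q)
    \<comment> \<open>The punctured neighbourhood misses \<open>g p\<close>, a value which
      \<open>g\<close> may also take at other points; there \<open>p(2)\<close> applies.\<close>
    then show ?case using U(3) gA p(2) by (cases "g q = g p") auto
  qed
qed

lemma lsc_on_compose:
  "lsc_on S f \<Longrightarrow> continuous_on A g \<Longrightarrow> g ` A \<subseteq> S \<Longrightarrow> lsc_on A (\<lambda>x. f (g x))"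
  unfolding lsc_on_iff_usc_on by (rule usc_on_compose)

lemma usc_on_sequence:
  assumes "usc_on S f" "p \<in> S" "\<And>n. x n \<in> S" "x \<longlonglongrightarrow> p" "f p < a"
  shows "\<forall>\<^sub>F n in sequentially. f (x n) < (a::real)"
proof -
  have "\<forall>\<^sub>F q in at p within S. f q < a" using assms unfolding usc_on_def by auto
  then obtain U where U: "open U" "p \<in> U" "\<forall>q\<in>U. q \<noteq> p \<longrightarrow> q \<in> S \<longrightarrow> f q < a"
    unfolding eventually_at_topological by blast
  have "\<forall>\<^sub>F n in sequentially. x n \<in> U" using assms U by (auto dest: topological_tendstoD)
  then show ?thesis
  proof eventually_elim
    case (elim n)
    then show ?case using U(3) assms by (cases "x n = p") auto
  qed
qed

text \<open>Doubling of variables in the generality of both of its uses: with \<open>\<zeta>\<close>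
  the identity it compares a sub- and a super-solution, with \<open>\<zeta>\<close> a curve it
  replaces a maximum along the curve by maxima over a full ball. Strictness of the maximum forces
  the maximizers to converge to the given point.\<close>

lemma penalization:
  fixes \<zeta> :: "'y::metric_space \<Rightarrow> 'z::euclidean_space" and A :: "'z \<Rightarrow> real" and B :: "'y \<Rightarrow> real"
  assumes X: "compact X" and Y: "compact Y" and A: "usc_on X A" and B: "lsc_on Y B"
    and \<zeta>: "continuous_on Y \<zeta>" and yh: "yh \<in> Y" "\<zeta> yh \<in> X"
    and strict: "\<And>y. y \<in> Y \<Longrightarrow> \<zeta> y \<in> X \<Longrightarrow> y \<noteq> yh \<Longrightarrow> A (\<zeta> y) - B y < A (\<zeta> yh) - B yh"
  obtains z y k where "\<And>n::nat. z n \<in> X" "\<And>n. y n \<in> Y" "\<And>n. k n > (0::real)"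
    and "\<And>n z' y'. z' \<in> X \<Longrightarrow> y' \<in> Y \<Longrightarrow>
        A z' - B y' - k n * (norm (z' - \<zeta> y'))\<^sup>2 \<le> A (z n) - B (y n) - k n * (norm (z n - \<zeta> (y n)))\<^sup>2"
    and "z \<longlonglongrightarrow> \<zeta> yh" "y \<longlonglongrightarrow> yh" "(\<lambda>n. k n * (norm (z n - \<zeta> (y n)))\<^sup>2) \<longlonglongrightarrow> 0"
proof -
  let ?Q = "\<lambda>k p. A (fst p) - B (snd p) - k * (norm (fst p - \<zeta> (snd p)))\<^sup>2"
  have XY: "compact (X \<times> Y)" "X \<times> Y \<noteq> {}" using X Y yh by (auto intro: compact_Times)
  have "\<exists>p\<in>X \<times> Y. \<forall>q\<in>X \<times> Y. ?Q k q \<le> ?Q k p" for k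
  proof -
    have "usc_on (X \<times> Y) (\<lambda>p. A (fst p))"
      by (rule usc_on_compose[OF A]) (auto intro: continuous_intros)
    moreover have "usc_on (X \<times> Y) (\<lambda>p. - B (snd p))"
      by (rule usc_on_compose[OF B[unfolded lsc_on_iff_usc_on]]) (auto intro: continuous_intros)
    moreover have "usc_on (X \<times> Y) (\<lambda>p. - (k * (norm (fst p - \<zeta> (snd p)))\<^sup>2))"
      by (rule continuous_on_imp_usc_on)
        (intro continuous_intros continuous_on_compose2[OF \<zeta>], auto)
    ultimately have "usc_on (X \<times> Y) (\<lambda>p. (A (fst p) + - B (snd p)) + - (k * (norm (fst p - \<zeta> (snd p)))\<^sup>2))"
      by (intro usc_on_add)
    from usc_attains_max[OF XY this] show ?thesis by simp
  qed
  then have "\<exists>p. \<forall>k. p k \<in> X \<times> Y \<and> (\<forall>q\<in>X \<times> Y. ?Q k q \<le> ?Q k (p k))"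
    by (intro choice) blast
  then obtain p where p: "\<And>k. p k \<in> X \<times> Y" "\<And>k q. q \<in> X \<times> Y \<Longrightarrow> ?Q k q \<le> ?Q k (p k)"
    by blast
  \<comment> \<open>\<open>Suc\<close> keeps all weights positive; compactness of
    \<open>X \<times> Y\<close> gives a convergent subsequence of maximizers.\<close>
  obtain r l where r: "strict_mono (r::nat\<Rightarrow>nat)" and l: "l \<in> X \<times> Y"
    and lim: "((\<lambda>n. p (real (Suc n))) \<circ> r) \<longlonglongrightarrow> l"
    using XY(1)[unfolded compact_def, rule_format, of "\<lambda>n. p (real (Suc n))"] p(1) by blast
  define k where "k n = real (Suc (r n))" for n
  define z where "z n = fst (p (k n))" for n
  define y where "y n = snd (p (k n))" for n
  have zX: "z n \<in> X" and yY: "y n \<in> Y" for n using p(1)[of "k n"] by (auto simp: z_def y_def)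
  have mx: "A z' - B y' - k n * (norm (z' - \<zeta> y'))\<^sup>2 \<le> A (z n) - B (y n) - k n * (norm (z n - \<zeta> (y n)))\<^sup>2"
    if "z' \<in> X" "y' \<in> Y" for n z' y'
    using p(2)[of "(z',y')" "k n"] that by (simp add: z_def y_def)
  have lim': "(\<lambda>n. p (k n)) \<longlonglongrightarrow> l" using lim by (simp add: k_def o_def)
  have zl: "z \<longlonglongrightarrow> fst l" unfolding z_def by (rule tendsto_fst[OF lim'])
  have yl: "y \<longlonglongrightarrow> snd l" unfolding y_def by (rule tendsto_snd[OF lim'])
  have lX: "fst l \<in> X" and lY: "snd l \<in> Y" using l by auto
  have k1: "k n > 0" for n by (simp add: k_def)
  have kn: "k n \<ge> real n" for n using seq_suble[OF r, of n] by (simp add: k_def)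
  let ?M = "A (\<zeta> yh) - B yh"
  let ?D = "\<lambda>n. (norm (z n - \<zeta> (y n)))\<^sup>2"
  \<comment> \<open>The pair \<open>(\<zeta> yh, yh)\<close> has no penalty and competes for every
    weight.\<close>
  have base: "?M + k n * ?D n \<le> A (z n) - B (y n)" for n
    using mx[OF yh(2) yh(1), of n] by simp
  have ev: "\<forall>\<^sub>F n in sequentially. A (z n) - B (y n) < A (fst l) - B (snd l) + e" if "e > 0" for e
  proof -
    have "\<forall>\<^sub>F n in sequentially. A (z n) < A (fst l) + e / 2"
      by (rule usc_on_sequence[OF A lX zX zl]) (use that in simp)
    moreover have "\<forall>\<^sub>F n in sequentially. - B (y n) < - B (snd l) + e / 2"
      by (rule usc_on_sequence[OF B[unfolded lsc_on_iff_usc_on] lY yY yl]) (use that in simp)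
    ultimately show ?thesis by eventually_elim simp
  qed
  have \<zeta>l: "(\<lambda>n. \<zeta> (y n)) \<longlonglongrightarrow> \<zeta> (snd l)"
    by (rule continuous_on_tendsto_compose[OF \<zeta> yl lY]) (simp add: yY)
  have Dl: "?D \<longlonglongrightarrow> (norm (fst l - \<zeta> (snd l)))\<^sup>2"
    by (intro tendsto_intros zl \<zeta>l)
  have eq: "fst l = \<zeta> (snd l)"
  proof (rule ccontr)
    assume "fst l \<noteq> \<zeta> (snd l)"
    then have pos: "(norm (fst l - \<zeta> (snd l)))\<^sup>2 > 0" (is "?d > 0") by simp
    have e1: "\<forall>\<^sub>F n in sequentially. ?D n > ?d / 2"
      using order_tendstoD(1)[OF Dl, of "?d / 2"] pos by simp
    \<comment> \<open>From the index \<open>C\<close> on, the penalty alone would use up all the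
      room that semicontinuity leaves above \<open>?M\<close>.\<close>
    define C where "C = (A (fst l) - B (snd l) + 1 - ?M) / (?d / 2)"
    have e2: "\<forall>\<^sub>F n in sequentially. C \<le> real n" using filterlim_real_sequentially unfolding filterlim_at_top by simp
    have "\<forall>\<^sub>F n in sequentially. False"
      using e1 e2 ev[of 1, simplified]
    proof eventually_elim
      case (elim n)
      have "C * (?d/2) = A (fst l) - B (snd l) + 1 - ?M" using pos by (simp add: C_def)
      then have "A (fst l) - B (snd l) + 1 - ?M \<le> k n * (?d / 2)"
        using mult_right_mono[of C "k n" "?d/2"] elim(2) kn[of n] pos by linarith
      also have "\<dots> \<le> k n * ?D n" using elim(1) k1[of n] by (intro mult_left_mono) auto
      finally show ?case using base[of n] elim(3) by simp
    qed
    then show False by simp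
  qed
  \<comment> \<open>The limit point is no worse than \<open>yh\<close>; strictness of the maximum
    then identifies the two.\<close>
  have Mle: "?M \<le> A (fst l) - B (snd l)"
  proof (rule field_le_epsilon)
    fix e :: real assume "e > 0"
    have "\<forall>\<^sub>F n in sequentially. ?M \<le> A (fst l) - B (snd l) + e"
      using ev[OF \<open>e > 0\<close>]
    proof eventually_elim
      case (elim n)
      have "k n * ?D n \<ge> 0" using k1[of n] by simp
      then show ?case using base[of n] elim by linarith
    qed
    then show "?M \<le> A (fst l) - B (snd l) + e" by simp
  qed
  have yeq: "snd l = yh"
    using strict[OF lY] Mle lX eq by force
  \<comment> \<open>Since the limit value is exactly \<open>?M\<close>, the penalty is squeezed
    between 0 and the excess allowed by semicontinuity.\<close>
  have "(\<lambda>n. k n * ?D n) \<longlonglongrightarrow> 0"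
  proof (rule order_tendstoI)
    fix a :: real assume "a < 0"
    have "a < k n * ?D n" for n
      using k1[of n] \<open>a < 0\<close> by (intro less_le_trans[OF \<open>a < 0\<close>] mult_nonneg_nonneg) auto
    then show "\<forall>\<^sub>F n in sequentially. a < k n * ?D n" by simp
  next
    fix a :: real assume "0 < a"
    from ev[OF this] show "\<forall>\<^sub>F n in sequentially. k n * ?D n < a"
    proof eventually_elim
      case (elim n)
      have "A (fst l) - B (snd l) = ?M" using eq yeq by simp
      then show ?case using elim base[of n] by linarith
    qed
  qed
  then show thesis using that[of z y k] zX yY mx k1 zl yl eq yeq by auto
qed

section \<open>Functions of class C1\<close>

lemma Ck_on_imp_continuous_on: "Ck_on k S f \<Longrightarrow> continuous_on S f"
  by (cases k) (auto intro!: differentiable_imp_continuous_on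
      simp: differentiable_on_def differentiable_at_withinI)

lemma Ck_on_Suc_imp_1: "Ck_on (Suc k) S f \<Longrightarrow> Ck_on 1 S f"
  by (auto dest: Ck_on_imp_continuous_on)

lemma Ck_on_1_iff:
  "Ck_on 1 S f \<longleftrightarrow> (\<forall>x\<in>S. f differentiable (at x)) \<and> (\<forall>v. continuous_on S (\<lambda>x. frechet_derivative f (at x) v))"
  by simp

lemma Ck_on_1_has_derivative:
  "Ck_on 1 S f \<Longrightarrow> x \<in> S \<Longrightarrow> (f has_derivative frechet_derivative f (at x)) (at x)"
  by (simp add: frechet_derivative_works)

text \<open>\<open>Ck_on\<close> asks for continuity of the derivative in each fixed direction only.
  Expanding the moving direction \<open>w s\<close> in the basis gives joint continuity.\<close>

lemma Ck_on_1_derivative_continuous: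
  fixes f :: "'a::euclidean_space \<Rightarrow> 'b::real_normed_vector"
  assumes f: "Ck_on 1 W f" and \<beta>: "continuous_on S \<beta>" "\<beta> ` S \<subseteq> W" and w: "continuous_on S w"
  shows "continuous_on S (\<lambda>s. frechet_derivative f (at (\<beta> s)) (w s))"
proof -
  have "frechet_derivative f (at (\<beta> s)) (w s)
      = (\<Sum>i\<in>Basis. (w s \<bullet> i) *\<^sub>R frechet_derivative f (at (\<beta> s)) i)" if "s \<in> S" for s
  proof -
    have lin: "linear (frechet_derivative f (at (\<beta> s)))"
      using f \<beta> that by (intro linear_frechet_derivative) auto
    have "frechet_derivative f (at (\<beta> s)) (w s)
        = frechet_derivative f (at (\<beta> s)) (\<Sum>i\<in>Basis. (w s \<bullet> i) *\<^sub>R i)"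
      by (simp add: euclidean_representation)
    also have "\<dots> = (\<Sum>i\<in>Basis. (w s \<bullet> i) *\<^sub>R frechet_derivative f (at (\<beta> s)) i)"
      by (simp add: linear_sum[OF lin] linear_cmul[OF lin])
    finally show ?thesis .
  qed
  moreover have "continuous_on S (\<lambda>s. (\<Sum>i\<in>Basis. (w s \<bullet> i) *\<^sub>R frechet_derivative f (at (\<beta> s)) i))"
  proof (intro continuous_intros w)
    fix i :: 'a
    have "continuous_on W (\<lambda>x. frechet_derivative f (at x) i)" using f by simp
    then show "continuous_on S (\<lambda>s. frechet_derivative f (at (\<beta> s)) i)"
      by (rule continuous_on_compose2[OF _ \<beta>])
  qed
  ultimately show ?thesis by (simp cong: continuous_on_cong)
qed

section \<open>Charts and curves\<close>

text \<open>The parameters for which a curve lies in a given chart form a relatively open set.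
  Restricting to it does not change limits, so chart computations yield statements on all of
  \<open>{0..1}\<close>.\<close>

lemma at_within_relopen:
  assumes "continuous_on S g" "t \<in> S" "open U" "g t \<in> U"
  shows "at t within {s\<in>S. g s \<in> U} = at t within S"
proof -
  obtain A where A: "open A" "A \<inter> S = g -` U \<inter> S"
    using assms unfolding continuous_on_open_invariant by blast
  then show ?thesis
    using assms by (intro at_within_nhd[of t A]) auto
qed

locale riem_manifold =
  fixes R :: "('m::{t2_space,second_countable_topology}, 'e::euclidean_space) rmanifold"
  assumes rm: "riemannian_manifold R"
begin

lemma atlas: "C3_atlas_C1_boundary (charts R)"
  using rm unfolding riemannian_manifold_def by simp

lemma chart_open: "c \<in> charts R \<Longrightarrow> open (chart_dom c)"
  and chart_homeo: "c \<in> charts R \<Longrightarrow>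
    homeomorphism (chart_dom c) (chart_image c) (chart_map c) (chart_inv c)"
  and chart_C1_domain: "c \<in> charts R \<Longrightarrow> locally_C1_domain (chart_image c)"
  using atlas unfolding C3_atlas_C1_boundary_def by auto

lemma chart_inv_map: "c \<in> charts R \<Longrightarrow> x \<in> chart_dom c \<Longrightarrow> chart_inv c (chart_map c x) = x"
  using chart_homeo unfolding homeomorphism_def by blast

lemma chart_map_inv: "q \<in> chart_image c \<Longrightarrow> chart_map c (chart_inv c q) = q"
  by (rule f_inv_into_f)

lemma chart_inv_dom: "q \<in> chart_image c \<Longrightarrow> chart_inv c q \<in> chart_dom c"
  by (rule inv_into_into)

lemma continuous_on_chart: "c \<in> charts R \<Longrightarrow> continuous_on (chart_dom c) (chart_map c)"
  and continuous_on_chart_inv: "c \<in> charts R \<Longrightarrow> continuous_on (chart_image c) (chart_inv c)"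
  using chart_homeo unfolding homeomorphism_def by auto

lemma chart_at: "chart_at R x \<in> charts R" "x \<in> chart_dom (chart_at R x)"
proof -
  have "\<exists>c. c \<in> charts R \<and> x \<in> chart_dom c"
    using atlas unfolding C3_atlas_C1_boundary_def by blast
  then have "chart_at R x \<in> charts R \<and> x \<in> chart_dom (chart_at R x)"
    unfolding chart_at_def by (rule someI_ex)
  then show "chart_at R x \<in> charts R" "x \<in> chart_dom (chart_at R x)" by auto
qed

lemma metric_inner_form: "c \<in> charts R \<Longrightarrow> x \<in> chart_dom c \<Longrightarrow> inner_form (metric R c x)"
  using rm unfolding riemannian_manifold_def inner_form_def by blast

text \<open>The image of an overlap need not be open at boundary points, so the transition map is
  replaced by a C1 extension \<open>F\<close>, which agrees with it on that image only.\<close>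

lemma transition:
  assumes "c \<in> charts R" "c' \<in> charts R" "x \<in> chart_dom c" "x \<in> chart_dom c'"
  obtains W F where "open W" "chart_map c x \<in> W" "Ck_on 1 W F"
    "\<And>y. y \<in> chart_dom c \<Longrightarrow> y \<in> chart_dom c' \<Longrightarrow> chart_map c y \<in> W \<Longrightarrow> F (chart_map c y) = chart_map c' y"
proof -
  have "Ck_on_subset 3 (chart_map c ` (chart_dom c \<inter> chart_dom c')) (chart_map c' \<circ> chart_inv c)"
    using assms atlas unfolding C3_atlas_C1_boundary_def by blast
  moreover have "chart_map c x \<in> chart_map c ` (chart_dom c \<inter> chart_dom c')" using assms by auto
  ultimately obtain W F where W: "open W" "chart_map c x \<in> W" "Ck_on 3 W F"
    and F: "\<forall>q\<in>W \<inter> chart_map c ` (chart_dom c \<inter> chart_dom c'). F q = (chart_map c' \<circ> chart_inv c) q"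
    unfolding Ck_on_subset_def by blast
  have "Ck_on 1 W F" using W(3) by (intro Ck_on_Suc_imp_1[of 2]) (simp add: numeral_3_eq_3 numeral_2_eq_2)
  then show thesis
  proof (rule that[OF W(1,2)])
    fix y assume "y \<in> chart_dom c" "y \<in> chart_dom c'" "chart_map c y \<in> W"
    then show "F (chart_map c y) = chart_map c' y"
      using F chart_inv_map[OF assms(1)] by auto
  qed
qed

text \<open>The compatibility axiom speaks of every derivative within the image of the overlap; the
  derivative of a local extension \<open>F\<close> is therefore admissible, at boundary points
  too.\<close>

lemma metric_transition:
  assumes c: "c \<in> charts R" "c' \<in> charts R" "x \<in> chart_dom c" "x \<in> chart_dom c'"
    and W: "open W" "chart_map c x \<in> W"
    and F: "\<And>y. y \<in> chart_dom c \<Longrightarrow> y \<in> chart_dom c' \<Longrightarrow> chart_map c y \<in> W \<Longrightarrow> F (chart_map c y) = chart_map c' y"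
    and D: "(F has_derivative D) (at (chart_map c x))"
  shows "metric R c x u v = metric R c' x (D u) (D v)"
proof -
  let ?s = "chart_map c ` (chart_dom c \<inter> chart_dom c')"
  obtain d where d: "d > 0" "ball (chart_map c x) d \<subseteq> W" using W open_contains_ball by blast
  have "((chart_map c' \<circ> chart_inv c) has_derivative D) (at (chart_map c x) within ?s)"
  proof (rule has_derivative_transform_within[OF has_derivative_at_withinI[OF D] d(1)])
    show "chart_map c x \<in> ?s" using c by auto
    fix q assume q: "q \<in> ?s" "dist q (chart_map c x) < d"
    then obtain y where "q = chart_map c y" "y \<in> chart_dom c" "y \<in> chart_dom c'" by blast
    moreover have "q \<in> W" using q d by (auto simp: dist_commute)
    ultimately show "F q = (chart_map c' \<circ> chart_inv c) q"
      using F chart_inv_map[OF c(1)] by auto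
  qed
  then show ?thesis using c rm unfolding riemannian_manifold_def by blast
qed

lemma metric_C1:
  assumes "c \<in> charts R" "q \<in> chart_image c"
  obtains W F where "open W" "q \<in> W" "Ck_on 1 W F"
    "\<And>q'. q' \<in> W \<Longrightarrow> q' \<in> chart_image c \<Longrightarrow> F q' = metric R c (chart_inv c q') u v"
proof -
  have "Ck_on_subset 2 (chart_image c) (\<lambda>q. metric R c (chart_inv c q) u v)"
    using assms rm unfolding riemannian_manifold_def by blast
  then obtain W F where W: "open W" "q \<in> W" "Ck_on 2 W F"
    "\<forall>q'\<in>W \<inter> chart_image c. F q' = metric R c (chart_inv c q') u v"
    using assms(2) unfolding Ck_on_subset_def by (blast dest: bspec)
  moreover have "Ck_on 1 W F" using W(3) by (intro Ck_on_Suc_imp_1[of 1]) (simp add: numeral_2_eq_2)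
  ultimately show thesis using that by blast
qed

lemma metric_coeff_continuous:
  assumes c: "c \<in> charts R"
  shows "continuous_on (chart_image c) (\<lambda>q. metric R c (chart_inv c q) u v)"
  unfolding continuous_on_def
proof
  fix q assume q: "q \<in> chart_image c"
  obtain W F where W: "open W" "q \<in> W" "Ck_on 1 W F"
    "\<And>q'. q' \<in> W \<Longrightarrow> q' \<in> chart_image c \<Longrightarrow> F q' = metric R c (chart_inv c q') u v"
    using metric_C1[OF c q, of u v] by blast
  have "continuous_on W F" by (rule Ck_on_imp_continuous_on[OF W(3)])
  then have "isCont F q" using W by (simp add: continuous_on_eq_continuous_at)
  then have "(F \<longlongrightarrow> F q) (at q within chart_image c)"
    unfolding isCont_def by (rule tendsto_within_subset) simp
  then have "(F \<longlongrightarrow> metric R c (chart_inv c q) u v) (at q within chart_image c)"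
    using W(2,4) q by metis
  then show "((\<lambda>q. metric R c (chart_inv c q) u v) \<longlongrightarrow> metric R c (chart_inv c q) u v) (at q within chart_image c)"
  proof (rule Lim_transform_eventually)
    have "\<forall>\<^sub>F q' in at q within chart_image c. q' \<in> W"
      using W eventually_nhds_in_open[of W q] by (auto simp: eventually_at_filter elim: eventually_mono)
    moreover have "\<forall>\<^sub>F q' in at q within chart_image c. q' \<in> chart_image c"
      by (simp add: eventually_at_filter)
    ultimately show "\<forall>\<^sub>F q' in at q within chart_image c. F q' = metric R c (chart_inv c q') u v"
      by eventually_elim (rule W(4))
  qed
qed

lemma metric_expand:
  assumes "c \<in> charts R" "x \<in> chart_dom c"
  shows "metric R c x u v = (\<Sum>i\<in>Basis. \<Sum>j\<in>Basis. (u \<bullet> i) * (v \<bullet> j) * metric R c x i j)"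
proof -
  note lin = inner_form_linear[OF metric_inner_form[OF assms]]
  have "metric R c x u v = metric R c x (\<Sum>i\<in>Basis. (u \<bullet> i) *\<^sub>R i) (\<Sum>j\<in>Basis. (v \<bullet> j) *\<^sub>R j)"
    by (simp add: euclidean_representation)
  also have "\<dots> = (\<Sum>i\<in>Basis. (u \<bullet> i) * metric R c x i (\<Sum>j\<in>Basis. (v \<bullet> j) *\<^sub>R j))"
    by (simp only: linear_sum[OF lin(1)] linear_cmul[OF lin(1)] real_scaleR_def)
  also have "\<dots> = (\<Sum>i\<in>Basis. (u \<bullet> i) * (\<Sum>j\<in>Basis. (v \<bullet> j) * metric R c x i j))"
    by (simp only: linear_sum[OF lin(2)] linear_cmul[OF lin(2)] real_scaleR_def)
  finally show ?thesis by (simp add: sum_distrib_left mult.assoc)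
qed

lemma metric_continuous:
  assumes c: "c \<in> charts R" and g: "continuous_on S g" "g ` S \<subseteq> chart_dom c"
    and u: "continuous_on S u" and v: "continuous_on S v"
  shows "continuous_on S (\<lambda>s. metric R c (g s) (u s) (v s))"
proof -
  have "continuous_on S (\<lambda>s. metric R c (g s) i j)" for i j
  proof -
    have "continuous_on S (\<lambda>s. chart_map c (g s))"
      by (rule continuous_on_compose2[OF continuous_on_chart[OF c] g])
    then have "continuous_on S (\<lambda>s. metric R c (chart_inv c (chart_map c (g s))) i j)"
      by (rule continuous_on_compose2[OF metric_coeff_continuous[OF c]]) (use g in auto)
    moreover have "chart_inv c (chart_map c (g s)) = g s" if "s \<in> S" for s
      using g that by (intro chart_inv_map[OF c]) auto
    ultimately show ?thesis by (simp cong: continuous_on_cong)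
  qed
  then have "continuous_on S (\<lambda>s. \<Sum>i\<in>Basis. \<Sum>j\<in>Basis. (u s \<bullet> i) * (v s \<bullet> j) * metric R c (g s) i j)"
    by (intro continuous_intros u v)
  moreover have "metric R c (g s) (u s) (v s)
      = (\<Sum>i\<in>Basis. \<Sum>j\<in>Basis. (u s \<bullet> i) * (v s \<bullet> j) * metric R c (g s) i j)" if "s \<in> S" for s
    using g that by (intro metric_expand[OF c]) auto
  ultimately show ?thesis by (simp cong: continuous_on_cong)
qed

section \<open>Velocity, speed and length of curves\<close>

lemma C1_curve_velocity:
  assumes "C1_curve R 1 \<gamma>" "c \<in> charts R" "t \<in> {0..1}" "\<gamma> t \<in> chart_dom c"
  shows "((chart_map c \<circ> \<gamma>) has_vector_derivative coord_velocity c 1 \<gamma> t) (at t within {0..1})"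
  using assms unfolding C1_curve_def coord_velocity_def
  by (simp add: vector_derivative_works)

lemma transition_velocity:
  assumes c: "c \<in> charts R" "c' \<in> charts R" "t \<in> {0..1}" "\<gamma> t \<in> chart_dom c" "\<gamma> t \<in> chart_dom c'"
    and g: "continuous_on {0..1} \<gamma>"
    and W: "open W" "chart_map c (\<gamma> t) \<in> W"
    and F: "\<And>y. y \<in> chart_dom c \<Longrightarrow> y \<in> chart_dom c' \<Longrightarrow> chart_map c y \<in> W \<Longrightarrow> F (chart_map c y) = chart_map c' y"
    and D: "(F has_derivative D) (at (chart_map c (\<gamma> t)))"
    and v: "((chart_map c \<circ> \<gamma>) has_vector_derivative v) (at t within {0..1})"
  shows "((chart_map c' \<circ> \<gamma>) has_vector_derivative D v) (at t within {0..1})"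
proof -
  let ?U = "chart_dom c \<inter> chart_dom c'"
  have "open (chart_dom c \<inter> chart_map c -` W)"
    using continuous_on_chart[OF c(1)] chart_open[OF c(1)] W(1)
    by (simp add: continuous_on_open_vimage Int_commute)
  then have U: "open ((chart_dom c \<inter> chart_map c -` W) \<inter> chart_dom c')" (is "open ?U")
    using chart_open[OF c(2)] by blast
  have tU: "\<gamma> t \<in> ?U" using c W by auto
  have ev: "\<forall>\<^sub>F s in at t within {0..1}. \<gamma> s \<in> ?U"
    using g c(3) topological_tendstoD[OF _ U tU] unfolding continuous_on_def by blast
  have "(F \<circ> (chart_map c \<circ> \<gamma>) has_vector_derivative D v) (at t within {0..1})"
    by (rule vector_derivative_diff_chain_within[OF v])
      (use D in \<open>simp add: has_derivative_at_withinI\<close>)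
  then show ?thesis
    unfolding has_vector_derivative_def
  proof (rule has_derivative_transform_eventually[OF _ _ _ c(3)])
    show "\<forall>\<^sub>F s in at t within {0..1}. (F \<circ> (chart_map c \<circ> \<gamma>)) s = (chart_map c' \<circ> \<gamma>) s"
      using ev by eventually_elim (use F in auto)
    show "(F \<circ> (chart_map c \<circ> \<gamma>)) t = (chart_map c' \<circ> \<gamma>) t"
      using tU F by auto
  qed
qed

lemma coord_velocity_eqI:
  assumes "((chart_map c \<circ> \<gamma>) has_vector_derivative v) (at t within {0..1})" "t \<in> {0..1}"
  shows "coord_velocity c 1 \<gamma> t = v"
  unfolding coord_velocity_def using vector_derivative_within_cbox[of 0 1 t] assms by simp

definition speed :: "(real \<Rightarrow> 'm) \<Rightarrow> real \<Rightarrow> real" where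
  "speed \<gamma> t = rnorm R (\<gamma> t) (coord_velocity (chart_at R (\<gamma> t)) 1 \<gamma> t)"

text \<open>\<open>speed\<close> is computed in the chart selected at \<open>\<gamma> t\<close>,
  which may jump with \<open>t\<close>. The value is the same in every chart because velocity and
  metric transform by the same derivative; continuity is then checked in one fixed chart.\<close>

lemma speed_eq:
  assumes \<gamma>: "C1_curve R 1 \<gamma>" and c: "c \<in> charts R" and t: "t \<in> {0..1}" "\<gamma> t \<in> chart_dom c"
  shows "speed \<gamma> t = sqrt (metric R c (\<gamma> t) (coord_velocity c 1 \<gamma> t) (coord_velocity c 1 \<gamma> t))"
proof -
  let ?c' = "chart_at R (\<gamma> t)"
  note c' = chart_at[of "\<gamma> t"]
  obtain W F where W: "open W" "chart_map c (\<gamma> t) \<in> W" "Ck_on 1 W F"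
    and F: "\<And>y. y \<in> chart_dom c \<Longrightarrow> y \<in> chart_dom ?c' \<Longrightarrow> chart_map c y \<in> W \<Longrightarrow> F (chart_map c y) = chart_map ?c' y"
    using transition[OF c c'(1) t(2) c'(2)] by blast
  let ?D = "frechet_derivative F (at (chart_map c (\<gamma> t)))"
  have D: "(F has_derivative ?D) (at (chart_map c (\<gamma> t)))"
    by (rule Ck_on_1_has_derivative[OF W(3,2)])
  have "continuous_on {0..1} \<gamma>" using \<gamma> unfolding C1_curve_def by simp
  from transition_velocity[OF c c'(1) t c'(2) this W(1,2) F D C1_curve_velocity[OF \<gamma> c t]]
  have "coord_velocity ?c' 1 \<gamma> t = ?D (coord_velocity c 1 \<gamma> t)"
    using t by (intro coord_velocity_eqI) auto
  then show ?thesis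
    unfolding speed_def rnorm_def
    using metric_transition[OF c c'(1) t(2) c'(2) W(1,2) F D] by simp
qed

lemma speed_nonneg: "speed \<gamma> t \<ge> 0"
  unfolding speed_def rnorm_def using inner_form_nonneg[OF metric_inner_form[OF chart_at]] by simp

lemma speed_continuous:
  assumes \<gamma>: "C1_curve R 1 \<gamma>"
  shows "continuous_on {0..1} (speed \<gamma>)"
  unfolding continuous_on_eq_continuous_within
proof
  fix t :: real assume t: "t \<in> {0..1}"
  have g: "continuous_on {0..1} \<gamma>" using \<gamma> unfolding C1_curve_def by simp
  let ?c = "chart_at R (\<gamma> t)"
  note c = chart_at[of "\<gamma> t"]
  let ?T = "{s\<in>{0..1}. \<gamma> s \<in> chart_dom ?c}"
  have "continuous_on ?T (coord_velocity ?c 1 \<gamma>)" using \<gamma> c unfolding C1_curve_def by auto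
  then have "continuous_on ?T (\<lambda>s. metric R ?c (\<gamma> s) (coord_velocity ?c 1 \<gamma> s) (coord_velocity ?c 1 \<gamma> s))"
    by (intro metric_continuous[OF c(1)] continuous_on_subset[OF g]) auto
  then have "continuous_on ?T (\<lambda>s. sqrt (metric R ?c (\<gamma> s) (coord_velocity ?c 1 \<gamma> s) (coord_velocity ?c 1 \<gamma> s)))"
    by (intro continuous_intros)
  then have "continuous_on ?T (speed \<gamma>)"
    by (rule continuous_on_eq) (use speed_eq[OF \<gamma> c(1)] in auto)
  then have "continuous (at t within ?T) (speed \<gamma>)"
    using t c by (simp add: continuous_on_eq_continuous_within)
  then show "continuous (at t within {0..1}) (speed \<gamma>)"
    using at_within_relopen[OF g t chart_open[OF c(1)] c(2)] by simp
qed

text \<open>A curve that is C1 in one chart is C1 in all of them, as \<open>C1_curve\<close>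
  demands: the extended transition maps carry the velocity over.\<close>

lemma C1_curve_chart:
  assumes c: "c \<in> charts R" and \<beta>: "\<And>t. t \<in> {0..1} \<Longrightarrow> \<beta> t \<in> chart_image c"
    and d: "\<And>t. t \<in> {0..1} \<Longrightarrow> (\<beta> has_vector_derivative \<beta>' t) (at t within {0..1})"
    and \<beta>': "continuous_on {0..1} \<beta>'"
  defines "\<gamma> \<equiv> \<lambda>t. chart_inv c (\<beta> t)"
  shows "C1_curve R 1 \<gamma>"
    and "t \<in> {0..1} \<Longrightarrow> speed \<gamma> t = sqrt (metric R c (\<gamma> t) (\<beta>' t) (\<beta>' t))"
proof -
  have cont\<beta>: "continuous_on {0..1} \<beta>"
    unfolding continuous_on_eq_continuous_within using has_vector_derivative_continuous[OF d] by blast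
  have g: "continuous_on {0..1} \<gamma>"
    unfolding \<gamma>_def by (rule continuous_on_compose2[OF continuous_on_chart_inv[OF c] cont\<beta>]) (use \<beta> in auto)
  have dom: "\<gamma> t \<in> chart_dom c" and cm: "chart_map c (\<gamma> t) = \<beta> t" if "t \<in> {0..1}" for t
    unfolding \<gamma>_def by (rule chart_inv_dom[OF \<beta>[OF that]]) (rule chart_map_inv[OF \<beta>[OF that]])
  have v: "((chart_map c \<circ> \<gamma>) has_vector_derivative \<beta>' t) (at t within {0..1})" if "t \<in> {0..1}" for t
    using d[OF that] unfolding has_vector_derivative_def
    by (rule has_derivative_transform_eventually[OF _ _ _ that])
      (use cm that in \<open>auto simp: eventually_at_filter\<close>)
  have loc: "(chart_map c' \<circ> \<gamma>) differentiable (at t within {0..1})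
      \<and> continuous (at t within {s\<in>{0..1}. \<gamma> s \<in> chart_dom c'}) (coord_velocity c' 1 \<gamma>)"
    if c': "c' \<in> charts R" and t: "t \<in> {0..1}" "\<gamma> t \<in> chart_dom c'" for c' t
  proof -
    obtain W F where W: "open W" "chart_map c (\<gamma> t) \<in> W" "Ck_on 1 W F"
      and F: "\<And>y. y \<in> chart_dom c \<Longrightarrow> y \<in> chart_dom c' \<Longrightarrow> chart_map c y \<in> W \<Longrightarrow> F (chart_map c y) = chart_map c' y"
      using transition[OF c c' dom[OF t(1)] t(2)] by blast
    let ?D = "\<lambda>s. frechet_derivative F (at (\<beta> s))"
    have vel: "((chart_map c' \<circ> \<gamma>) has_vector_derivative ?D s (\<beta>' s)) (at s within {0..1})"
      if s: "s \<in> {0..1}" "\<gamma> s \<in> chart_dom c'" "\<beta> s \<in> W" for s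
      using transition_velocity[OF c c' s(1) dom[OF s(1)] s(2) g W(1) _ F _ v[OF s(1)], of "?D s"]
        Ck_on_1_has_derivative[OF W(3) s(3)] s(3) cm[OF s(1)] by simp
    have tW: "\<beta> t \<in> W" using W(2) cm[OF t(1)] by simp
    let ?T = "{s\<in>{0..1}. \<gamma> s \<in> chart_dom c'}"
    let ?T' = "{s\<in>?T. \<beta> s \<in> W}"
    have "continuous_on ?T' (\<lambda>s. ?D s (\<beta>' s))"
      by (rule Ck_on_1_derivative_continuous[OF W(3)])
        (auto intro: continuous_on_subset[OF cont\<beta>] continuous_on_subset[OF \<beta>'])
    then have "continuous_on ?T' (coord_velocity c' 1 \<gamma>)"
      by (rule continuous_on_eq) (use coord_velocity_eqI[OF vel] in auto)
    then have "continuous (at t within ?T') (coord_velocity c' 1 \<gamma>)"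
      using t tW by (simp add: continuous_on_eq_continuous_within)
    moreover have "continuous_on ?T \<beta>" by (rule continuous_on_subset[OF cont\<beta>]) auto
    then have "at t within ?T' = at t within ?T"
      by (rule at_within_relopen) (use t tW W in auto)
    ultimately show ?thesis
      using vel[OF t tW] by (metis differentiableI_vector)
  qed
  then show 1: "C1_curve R 1 \<gamma>"
    unfolding C1_curve_def continuous_on_eq_continuous_within[of _ "coord_velocity _ _ _"]
    using g by auto
  show "speed \<gamma> t = sqrt (metric R c (\<gamma> t) (\<beta>' t) (\<beta>' t))" if "t \<in> {0..1}"
    using speed_eq[OF 1 c that dom[OF that]] coord_velocity_eqI[OF v[OF that] that] by simp
qed

text \<open>Joins a point to itself, the case that geodesic strong convexity leaves out.\<close>

lemma C1_curve_const: "C1_curve R 1 (\<lambda>_. x)"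
proof -
  let ?c = "chart_at R x"
  note c = chart_at[of x]
  have "C1_curve R 1 (\<lambda>t. chart_inv ?c ((\<lambda>_. chart_map ?c x) t))"
    by (rule C1_curve_chart(1)[OF c(1), where \<beta>' = "\<lambda>_. 0"]) (use c in \<open>auto intro: derivative_eq_intros\<close>)
  then show ?thesis using chart_inv_map[OF c] by simp
qed

lemma curve_length_speed: "curve_length R 1 \<gamma> = integral {0..1} (speed \<gamma>)"
  unfolding curve_length_def speed_def by simp

lemma curve_length_nonneg: "curve_length R 1 \<gamma> \<ge> 0"
  unfolding curve_length_speed using speed_nonneg
  by (cases "speed \<gamma> integrable_on {0..1}") (auto intro: integral_nonneg simp: not_integrable_integral)

lemma rdist_le_length: "C1_curve R 1 \<gamma> \<Longrightarrow> rdist R (\<gamma> 0) (\<gamma> 1) \<le> integral {0..1} (speed \<gamma>)"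
  unfolding rdist_def curve_length_speed[symmetric]
  by (rule cInf_lower) (auto intro!: bdd_belowI[of _ 0] curve_length_nonneg)

lemma rdist_chart_le:
  assumes c: "c \<in> charts R" and \<beta>: "\<And>t. t \<in> {0..1} \<Longrightarrow> \<beta> t \<in> chart_image c"
    and d: "\<And>t. t \<in> {0..1} \<Longrightarrow> (\<beta> has_vector_derivative \<beta>' t) (at t within {0..1})"
    and \<beta>': "continuous_on {0..1} \<beta>'"
    and B: "\<And>t. t \<in> {0..1} \<Longrightarrow> sqrt (metric R c (chart_inv c (\<beta> t)) (\<beta>' t) (\<beta>' t)) \<le> B"
  shows "rdist R (chart_inv c (\<beta> 0)) (chart_inv c (\<beta> 1)) \<le> B"
proof -
  let ?\<gamma> = "\<lambda>t. chart_inv c (\<beta> t)"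
  note C = C1_curve_chart[OF c \<beta> d \<beta>']
  have "integral {0..1} (speed ?\<gamma>) \<le> integral {0..1} (\<lambda>t::real. B)"
    by (rule integral_le)
      (use C B in \<open>auto intro!: integrable_continuous_interval speed_continuous\<close>)
  then show ?thesis using rdist_le_length[OF C(1)] by simp
qed

text \<open>\<open>b < a\<close> is allowed: the same statement yields the pieces of a curve and,
  with \<open>a = 1\<close> and \<open>b = 0\<close>, its reversal.\<close>

lemma C1_curve_affine:
  fixes a b :: real
  assumes \<gamma>: "C1_curve R 1 \<gamma>" and ab: "a \<in> {0..1}" "b \<in> {0..1}"
  defines "\<eta> \<equiv> \<lambda>s. \<gamma> (a + s * (b - a))"
  shows "C1_curve R 1 \<eta>"
    and "s \<in> {0..1} \<Longrightarrow> speed \<eta> s = \<bar>b - a\<bar> * speed \<gamma> (a + s * (b - a))"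
proof -
  let ?h = "\<lambda>s::real. a + s * (b - a)"
  have h: "?h s \<in> {0..1}" if "s \<in> {0..1}" for s
  proof -
    have "?h s = (1 - s) *\<^sub>R a + s *\<^sub>R b" by (simp add: algebra_simps)
    also have "\<dots> \<in> {0..1}" using that by (intro convexD_alt[OF convex_real_interval(5) ab]) auto
    finally show ?thesis .
  qed
  have conth: "continuous_on A ?h" for A by (intro continuous_intros)
  have vel: "((chart_map c \<circ> \<eta>) has_vector_derivative (b - a) *\<^sub>R coord_velocity c 1 \<gamma> (?h s)) (at s within {0..1})"
    if c: "c \<in> charts R" and s: "s \<in> {0..1}" "\<eta> s \<in> chart_dom c" for c s
  proof -
    have h': "(?h has_vector_derivative (b - a)) (at s within {0..1})"
      by (auto intro!: derivative_eq_intros)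
    have "((chart_map c \<circ> \<gamma>) has_vector_derivative coord_velocity c 1 \<gamma> (?h s)) (at (?h s) within ?h ` {0..1})"
      by (rule has_vector_derivative_within_subset[OF C1_curve_velocity[OF \<gamma> c h[OF s(1)] s(2)[unfolded \<eta>_def]]])
        (use h in blast)
    from vector_diff_chain_within[OF h' this] show ?thesis by (simp add: o_def \<eta>_def)
  qed
  show 1: "C1_curve R 1 \<eta>"
    unfolding C1_curve_def
  proof (intro conjI ballI impI)
    show "continuous_on {0..1} \<eta>"
      unfolding \<eta>_def
      by (rule continuous_on_compose2[OF _ conth]) (use \<gamma> h in \<open>auto simp: C1_curve_def\<close>)
    fix c assume c: "c \<in> charts R"
    show "(chart_map c \<circ> \<eta>) differentiable (at s within {0..1})"
      if "s \<in> {0..1}" "\<eta> s \<in> chart_dom c" for s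
      using vel[OF c that] by (rule differentiableI_vector)
    let ?T = "{s\<in>{0..1}. \<eta> s \<in> chart_dom c}"
    have "continuous_on {t\<in>{0..1}. \<gamma> t \<in> chart_dom c} (coord_velocity c 1 \<gamma>)"
      using \<gamma> c unfolding C1_curve_def by auto
    then have "continuous_on ?T (\<lambda>s. coord_velocity c 1 \<gamma> (?h s))"
      by (rule continuous_on_compose2[OF _ conth]) (use h in \<open>auto simp: \<eta>_def\<close>)
    then have "continuous_on ?T (\<lambda>s. (b - a) *\<^sub>R coord_velocity c 1 \<gamma> (?h s))"
      by (intro continuous_intros)
    then show "continuous_on ?T (coord_velocity c 1 \<eta>)"
      by (rule continuous_on_eq) (use coord_velocity_eqI[OF vel[OF c]] in auto)
  qed
  show "speed \<eta> s = \<bar>b - a\<bar> * speed \<gamma> (?h s)" if s: "s \<in> {0..1}"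
  proof -
    let ?c = "chart_at R (\<eta> s)"
    note c = chart_at[of "\<eta> s"]
    note bl = metric_inner_form[OF c, unfolded inner_form_def, THEN conjunct1]
    have "coord_velocity ?c 1 \<eta> s = (b - a) *\<^sub>R coord_velocity ?c 1 \<gamma> (?h s)"
      by (rule coord_velocity_eqI[OF vel[OF c(1) s c(2)] s])
    moreover have "\<eta> s = \<gamma> (?h s)" by (simp add: \<eta>_def)
    ultimately show ?thesis
      unfolding speed_def rnorm_def
      using bl by (simp add: bilinear_lmul bilinear_rmul real_sqrt_mult flip: mult.assoc)
  qed
qed

lemma rdist_restrict_le:
  assumes \<gamma>: "C1_curve R 1 \<gamma>" and ab: "0 \<le> a" "a \<le> b" "b \<le> 1"
  shows "rdist R (\<gamma> a) (\<gamma> b) \<le> integral {a..b} (speed \<gamma>)"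
proof -
  let ?h = "\<lambda>s::real. a + s * (b - a)"
  have ab': "a \<in> {0..1}" "b \<in> {0..1}" using ab by auto
  note \<eta> = C1_curve_affine[OF \<gamma> ab']
  have "?h s \<in> {a..b}" if "s \<in> {0..1}" for s
  proof -
    have "?h s = (1 - s) *\<^sub>R a + s *\<^sub>R b" by (simp add: algebra_simps)
    also have "\<dots> \<in> {a..b}" using that ab by (intro convexD_alt[OF convex_real_interval(5)]) auto
    finally show ?thesis .
  qed
  then have "((\<lambda>s. (b - a) *\<^sub>R speed \<gamma> (?h s)) has_integral integral {?h 0..?h 1} (speed \<gamma>)) {0..1}"
    by (intro has_integral_substitution[where c=a and d=b])
      (use ab in \<open>auto intro!: derivative_eq_intros continuous_on_subset[OF speed_continuous[OF \<gamma>]]\<close>)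
  then have H: "((\<lambda>s. (b - a) *\<^sub>R speed \<gamma> (?h s)) has_integral integral {a..b} (speed \<gamma>)) {0..1}"
    by simp
  have "(speed (\<lambda>s. \<gamma> (?h s)) has_integral integral {a..b} (speed \<gamma>)) {0..1}"
    by (rule has_integral_eq[OF _ H]) (use \<eta>(2) ab in simp)
  then have "integral {0..1} (speed (\<lambda>s. \<gamma> (?h s))) = integral {a..b} (speed \<gamma>)" by (rule integral_unique)
  then show ?thesis using rdist_le_length[OF \<eta>(1)] by simp
qed

lemma rdist_reverse_le:
  assumes \<gamma>: "C1_curve R 1 \<gamma>"
  shows "rdist R (\<gamma> 1) (\<gamma> 0) \<le> integral {0..1} (speed \<gamma>)"
proof -
  let ?h = "\<lambda>s::real. 1 + s * (0 - 1)"
  have 01: "1 \<in> {0..1::real}" "0 \<in> {0..1::real}" by auto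
  note \<eta> = C1_curve_affine[OF \<gamma> 01]
  \<comment> \<open>As \<open>?h\<close> decreases from 1 to 0, the first integral runs over the
    empty interval \<open>{1..0}\<close> and only the subtracted one remains.\<close>
  have "((\<lambda>s. (- 1) *\<^sub>R speed \<gamma> (?h s)) has_integral
      integral {?h 0..?h 1} (speed \<gamma>) - integral {?h 1..?h 0} (speed \<gamma>)) {0..1}"
    by (rule has_integral_substitution_general[where c=0 and d=1 and s="{}"])
      (auto intro!: derivative_eq_intros continuous_intros speed_continuous[OF \<gamma>])
  then have "((\<lambda>s. - ((- 1) *\<^sub>R speed \<gamma> (?h s))) has_integral
      - (integral {?h 0..?h 1} (speed \<gamma>) - integral {?h 1..?h 0} (speed \<gamma>))) {0..1}"
    by (rule has_integral_neg)
  then have H: "((\<lambda>s. speed \<gamma> (?h s)) has_integral integral {0..1} (speed \<gamma>)) {0..1}" by simp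
  have "(speed (\<lambda>s. \<gamma> (?h s)) has_integral integral {0..1} (speed \<gamma>)) {0..1}"
    by (rule has_integral_eq[OF _ H]) (use \<eta>(2) in simp)
  then have "integral {0..1} (speed (\<lambda>s. \<gamma> (?h s))) = integral {0..1} (speed \<gamma>)" by (rule integral_unique)
  then show ?thesis using rdist_le_length[OF \<eta>(1)] by simp
qed

end

section \<open>Local bounds for the metric and the distance\<close>

text \<open>Mean value inequality on a compact ball, where the sum of the absolute partial
  derivatives is bounded and dominates the operator norm.\<close>

lemma Ck_on_1_locally_Lipschitz:
  fixes F :: "'a::euclidean_space \<Rightarrow> real"
  assumes W: "open W" "p \<in> W" and F: "Ck_on 1 W F"
  obtains r B where "r > 0" "B \<ge> 0" "cball p r \<subseteq> W"
    "\<And>q q'. q \<in> cball p r \<Longrightarrow> q' \<in> cball p r \<Longrightarrow> \<bar>F q - F q'\<bar> \<le> B * norm (q - q')"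
proof -
  obtain r where r: "r > 0" "cball p r \<subseteq> W" using W open_contains_cball by blast
  let ?D = "\<lambda>x. frechet_derivative F (at x)"
  let ?b = "\<lambda>x. \<Sum>i\<in>Basis. \<bar>?D x i\<bar>"
  have "continuous_on W ?b" using F by (intro continuous_intros) auto
  then have "continuous_on (cball p r) ?b" using r(2) by (rule continuous_on_subset)
  then have "bounded (?b ` cball p r)" by (intro compact_imp_bounded compact_continuous_image) auto
  then obtain B where B0: "\<forall>y\<in>?b ` cball p r. norm y \<le> B" unfolding bounded_iff by blast
  have B: "\<bar>?b x\<bar> \<le> B" if "x \<in> cball p r" for x
    using bspec[OF B0 imageI[OF that]] by (simp only: real_norm_def)
  have "B \<ge> 0" using order_trans[OF abs_ge_zero B[of p]] r by simp
  have der: "(F has_derivative ?D x) (at x)" if "x \<in> cball p r" for x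
    using Ck_on_1_has_derivative[OF F] that r by blast
  have on: "onorm (?D x) \<le> B" if x: "x \<in> cball p r" for x
  proof (rule onorm_bound[OF \<open>B \<ge> 0\<close>])
    fix v
    have lin: "linear (?D x)" using der[OF x] by (rule has_derivative_linear)
    have "?D x v = ?D x (\<Sum>i\<in>Basis. (v \<bullet> i) *\<^sub>R i)" by (simp add: euclidean_representation)
    also have "\<dots> = (\<Sum>i\<in>Basis. (v \<bullet> i) * ?D x i)"
      by (simp add: linear_sum[OF lin] linear_cmul[OF lin])
    finally have "norm (?D x v) \<le> (\<Sum>i\<in>Basis. \<bar>v \<bullet> i\<bar> * \<bar>?D x i\<bar>)"
      using sum_abs[of "\<lambda>i. (v \<bullet> i) * ?D x i" Basis] by (simp add: abs_mult)
    also have "\<dots> \<le> (\<Sum>i\<in>Basis. norm v * \<bar>?D x i\<bar>)"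
      by (intro sum_mono mult_right_mono Basis_le_norm) auto
    also have "\<dots> = norm v * ?b x" by (simp add: sum_distrib_left)
    also have "\<dots> \<le> norm v * B" using B[OF x] by (intro mult_left_mono) auto
    finally show "norm (?D x v) \<le> B * norm v" by (simp add: mult.commute)
  qed
  have "norm (F q - F q') \<le> B * norm (q - q')" if "q \<in> cball p r" "q' \<in> cball p r" for q q'
    by (rule differentiable_bound[OF convex_cball has_derivative_at_withinI[OF der] on that])
  then show thesis using that[OF r(1) \<open>B \<ge> 0\<close> r(2)] by simp
qed

text \<open>Uniform interior cone property. At an interior point \<open>v = 0\<close> will do; at a
  boundary point \<open>v\<close> is chosen so that the derivative of \<open>\<rho>\<close> in
  direction \<open>v\<close> is positive, which persists for nearby points and directions.\<close>

lemma locally_C1_domain_cone: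
  fixes S :: "'e::euclidean_space set"
  assumes S: "locally_C1_domain S" and p: "p \<in> S"
  obtains v r where "r > 0"
    "\<And>q w \<tau>. q \<in> S \<Longrightarrow> dist p q < r \<Longrightarrow> dist v w < r \<Longrightarrow> 0 \<le> \<tau> \<Longrightarrow> \<tau> \<le> r \<Longrightarrow> q + \<tau> *\<^sub>R w \<in> S"
proof -
  note wit = that
  have step: thesis if r1: "r1 > 0" and H: "\<And>q w \<tau>. q \<in> S \<Longrightarrow> dist v w < r1 \<Longrightarrow> 0 \<le> \<tau> \<Longrightarrow>
      (\<And>s. 0 \<le> s \<Longrightarrow> s \<le> \<tau> \<Longrightarrow> dist p (q + s *\<^sub>R w) < r1) \<Longrightarrow> q + \<tau> *\<^sub>R w \<in> S" for v r1
  proof -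
    \<comment> \<open>A segment starts within \<open>r\<close> of \<open>p\<close> and has length at
      most \<open>r * (norm v + 1)\<close>; together this stays below \<open>r1\<close>.\<close>
    define r where "r = min 1 (r1 / (norm v + 2))"
    have nv: "norm v + 2 > 0" using norm_ge_zero[of v] by linarith
    have r: "r > 0" "r \<le> 1" using r1 nv by (auto simp: r_def)
    have "r \<le> r1 / (norm v + 2)" by (simp add: r_def)
    then have rr: "r * (norm v + 2) \<le> r1" using nv by (simp add: field_simps)
    moreover have "r * 1 \<le> r * (norm v + 2)" using r norm_ge_zero[of v] by (intro mult_left_mono) auto
    ultimately have rr1: "r \<le> r1" by simp
    show thesis
    proof (rule wit[OF r(1)])
      fix q w \<tau> assume q: "q \<in> S" "dist p q < r" "dist v w < r" "0 \<le> \<tau>" "\<tau> \<le> r"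
      have w: "norm w \<le> norm v + 1"
        using q(3) r norm_triangle_ineq[of v "w - v"] by (simp add: dist_norm norm_minus_commute)
      show "q + \<tau> *\<^sub>R w \<in> S"
      proof (rule H[OF q(1) _ q(4)])
        show "dist v w < r1" using q rr1 by simp
        fix s assume s: "0 \<le> s" "s \<le> \<tau>"
        have "dist p (q + s *\<^sub>R w) \<le> dist p q + s * norm w"
          using dist_triangle[of p "q + s *\<^sub>R w" q] s by (simp add: dist_norm)
        also have "\<dots> < r + s * norm w" using q by simp
        also have "\<dots> \<le> r + r * (norm v + 1)" using s q w by (intro add_left_mono mult_mono) auto
        finally show "dist p (q + s *\<^sub>R w) < r1" using rr by (simp add: algebra_simps)
      qed
    qed
  qed
  show thesis
  proof (cases "p \<in> interior S")
    case True
    then obtain r1 where r1: "r1 > 0" "ball p r1 \<subseteq> S" unfolding mem_interior by blast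
    show thesis
    proof (rule step[OF r1(1), of 0])
      fix q w \<tau> assume "0 \<le> \<tau>" "\<And>s. 0 \<le> s \<Longrightarrow> s \<le> \<tau> \<Longrightarrow> dist p (q + s *\<^sub>R w) < r1"
      then have "dist p (q + \<tau> *\<^sub>R w) < r1" by simp
      then show "q + \<tau> *\<^sub>R w \<in> S" using r1(2) by auto
    qed
  next
    case False
    then obtain W \<rho> v0 where W: "open W" "p \<in> W" and \<rho>: "Ck_on 1 W (\<rho> :: 'e \<Rightarrow> real)"
      and v0: "frechet_derivative \<rho> (at p) v0 \<noteq> 0" and SW: "S \<inter> W = {q\<in>W. \<rho> q \<ge> 0}"
      using S p unfolding locally_C1_domain_def by blast
    have "linear (frechet_derivative \<rho> (at p))"
      using Ck_on_1_has_derivative[OF \<rho> W(2)] by (rule has_derivative_linear)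
    then have "frechet_derivative \<rho> (at p) (- v0) = - frechet_derivative \<rho> (at p) v0" by (rule linear_neg)
    \<comment> \<open>One of \<open>v0\<close> and \<open>- v0\<close> increases
      \<open>\<rho>\<close>.\<close>
    then obtain v where v: "frechet_derivative \<rho> (at p) v > 0"
      using v0 by (cases "frechet_derivative \<rho> (at p) v0 > 0") (auto, metis neg_0_less_iff_less not_less_iff_gr_or_eq)
    let ?h = "\<lambda>z. frechet_derivative \<rho> (at (fst z)) (snd z)"
    have "continuous_on (W \<times> UNIV) ?h"
      by (rule Ck_on_1_derivative_continuous[OF \<rho>]) (auto intro: continuous_intros)
    then have "open ((W \<times> UNIV) \<inter> ?h -` {0<..})"
      using W by (intro continuous_open_preimage open_Times) auto
    moreover have "(p, v) \<in> (W \<times> UNIV) \<inter> ?h -` {0<..}" using W v by simp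
    ultimately obtain A B where AB: "open A" "open B" "p \<in> A" "v \<in> B" "A \<times> B \<subseteq> (W \<times> UNIV) \<inter> ?h -` {0<..}"
      by (rule open_prod_elim) auto
    obtain a b where a: "a > 0" "ball p a \<subseteq> A" and b: "b > 0" "ball v b \<subseteq> B"
      using AB open_contains_ball by metis
    show thesis
    proof (rule step[of "min a b" v])
      show "min a b > 0" using a b by simp
      fix q w \<tau>
      assume q: "q \<in> S" "dist v w < min a b" "0 \<le> \<tau>"
        and s: "\<And>s. 0 \<le> s \<Longrightarrow> s \<le> \<tau> \<Longrightarrow> dist p (q + s *\<^sub>R w) < min a b"
      have w: "w \<in> B" using q b by auto
      have A: "q + s *\<^sub>R w \<in> A" if "0 \<le> s" "s \<le> \<tau>" for s using s[OF that] a by auto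
      have AW: "A \<subseteq> W" using AB(5) w by auto
      \<comment> \<open>\<open>\<rho>\<close> is nondecreasing along the segment, so the sign
        condition at \<open>q\<close> propagates.\<close>
      have "\<rho> (q + 0 *\<^sub>R w) \<le> \<rho> (q + \<tau> *\<^sub>R w)"
      proof (rule DERIV_nonneg_imp_nondecreasing[OF q(3)])
        fix s assume s': "0 \<le> s" "s \<le> \<tau>"
        let ?D = "frechet_derivative \<rho> (at (q + s *\<^sub>R w))"
        have D: "(\<rho> has_derivative ?D) (at (q + s *\<^sub>R w))"
          using Ck_on_1_has_derivative[OF \<rho>] A[OF s'] AW by blast
        have "((\<lambda>s. q + s *\<^sub>R w) has_vector_derivative w) (at s)"
          by (auto intro!: derivative_eq_intros)
        from vector_derivative_diff_chain_within[OF this, of \<rho> ?D] D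
        have "((\<lambda>s. \<rho> (q + s *\<^sub>R w)) has_vector_derivative ?D w) (at s)"
          by (simp add: o_def has_derivative_at_withinI)
        then have "DERIV (\<lambda>s. \<rho> (q + s *\<^sub>R w)) s :> ?D w"
          by (simp add: has_real_derivative_iff_has_vector_derivative)
        moreover have "?D w > 0" using AB(5) A[OF s'] w by auto
        ultimately show "\<exists>y. DERIV (\<lambda>s. \<rho> (q + s *\<^sub>R w)) s :> y \<and> 0 \<le> y" by (meson less_imp_le)
      qed
      moreover have "\<rho> q \<ge> 0" using A[of 0] q AW SW by auto
      ultimately show "q + \<tau> *\<^sub>R w \<in> S" using A[of \<tau>] q AW SW by auto
    qed
  qed
qed

context riem_manifold
begin

text \<open>The last estimate is what the doubling arguments rest on: a relative Lipschitz bound for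
  the norms. It results from an additive Lipschitz bound for the metric coefficients, divided by the
  uniform lower bound of the metric.\<close>

lemma metric_bounds:
  assumes c: "c \<in> charts R" and p: "p \<in> interior (chart_image c)"
  obtains r m \<Lambda> where "r > 0" "m > 0" "\<Lambda> > 0" "cball p r \<subseteq> interior (chart_image c)"
    "\<And>q v. q \<in> cball p r \<Longrightarrow> m * norm v \<le> sqrt (metric R c (chart_inv c q) v v)"
    "\<And>q v. q \<in> cball p r \<Longrightarrow> sqrt (metric R c (chart_inv c q) v v) \<le> \<Lambda> * norm v"
    "\<And>q q' v. q \<in> cball p r \<Longrightarrow> q' \<in> cball p r \<Longrightarrow>
       sqrt (metric R c (chart_inv c q') v v)
         \<le> (1 + \<Lambda> * norm (q - q')) * sqrt (metric R c (chart_inv c q) v v)"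
proof -
  let ?g = "\<lambda>q. metric R c (chart_inv c q)"
  have pI: "p \<in> chart_image c" using p interior_subset by blast
  \<comment> \<open>Radius and Lipschitz constant are packed into one pair \<open>h\<close>, to be
    selected together for all \<open>i\<close> and \<open>j\<close>.\<close>
  define Q where "Q i j h \<longleftrightarrow> fst h > 0 \<and> snd h \<ge> 0 \<and> (\<forall>q q'. q \<in> cball p (fst h) \<longrightarrow> q' \<in> cball p (fst h) \<longrightarrow>
      q \<in> chart_image c \<longrightarrow> q' \<in> chart_image c \<longrightarrow>
      \<bar>?g q i j - ?g q' i j\<bar> \<le> snd h * norm (q - q'))" for i j and h :: "real \<times> real"
  have "\<exists>h. Q i j h" for i j
  proof -
    obtain W F where W: "open W" "p \<in> W" "Ck_on 1 W F"
      and F: "\<And>q'. q' \<in> W \<Longrightarrow> q' \<in> chart_image c \<Longrightarrow> F q' = metric R c (chart_inv c q') i j"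
      using metric_C1[OF c pI, of i j] by blast
    obtain r B where rB: "r > 0" "B \<ge> 0" "cball p r \<subseteq> W"
      "\<And>q q'. q \<in> cball p r \<Longrightarrow> q' \<in> cball p r \<Longrightarrow> \<bar>F q - F q'\<bar> \<le> B * norm (q - q')"
      using Ck_on_1_locally_Lipschitz[OF W] by blast
    show ?thesis
      unfolding Q_def
    proof (rule exI[of _ "(r, B)"], unfold fst_conv snd_conv, intro conjI rB(1) rB(2) allI impI)
      fix q q' assume q: "q \<in> cball p r" "q' \<in> cball p r" "q \<in> chart_image c" "q' \<in> chart_image c"
      show "\<bar>?g q i j - ?g q' i j\<bar> \<le> B * norm (q - q')"
        using rB(4)[OF q(1,2)] F[OF subsetD[OF rB(3) q(1)] q(3)] F[OF subsetD[OF rB(3) q(2)] q(4)] by simp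
    qed
  qed
  then have "\<forall>i. \<exists>h. \<forall>j. Q i j (h j)" by (intro allI choice) blast
  from choice[OF this] obtain h where h: "\<And>i j. Q i j (h i j)" by blast
  define r0 where "r0 i j = fst (h i j)" for i j
  define B where "B i j = snd (h i j)" for i j
  have r0: "r0 i j > 0" and B: "B i j \<ge> 0" for i j using h[of i j] by (auto simp: Q_def r0_def B_def)
  have Lip: "\<bar>?g q i j - ?g q' i j\<bar> \<le> B i j * norm (q - q')"
    if "q \<in> cball p (r0 i j)" "q' \<in> cball p (r0 i j)" "q \<in> chart_image c" "q' \<in> chart_image c" for i j q q'
    using h[of i j] that unfolding Q_def r0_def B_def by blast
  obtain r1 where r1: "r1 > 0" "cball p r1 \<subseteq> interior (chart_image c)"
    using p open_contains_cball[of "interior (chart_image c)"] by auto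
  define r2 where "r2 = Min (insert r1 ((\<lambda>(i,j). r0 i j) ` (Basis \<times> Basis)))"
  have r2: "r2 > 0" "r2 \<le> r1" unfolding r2_def using r0 r1 by auto
  have r2': "r2 \<le> r0 i j" if "i \<in> Basis" "j \<in> Basis" for i j
    unfolding r2_def using that by (intro Min_le) auto
  define b where "b = (\<Sum>i\<in>Basis. \<Sum>j\<in>Basis. B i j)"
  have b: "b \<ge> 0" unfolding b_def by (intro sum_nonneg B)
  have im: "q \<in> chart_image c" if "q \<in> cball p r2" for q
    using that r2 r1(2) interior_subset by (meson mem_cball order_trans subsetD)
  have diff: "\<bar>?g q v v - ?g q' v v\<bar> \<le> b * norm (q - q') * (norm v)\<^sup>2"
    if q: "q \<in> cball p r2" "q' \<in> cball p r2" for q q' v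
  proof -
    have "\<bar>?g q v v - ?g q' v v\<bar> = \<bar>\<Sum>i\<in>Basis. \<Sum>j\<in>Basis. (v \<bullet> i) * (v \<bullet> j) * (?g q i j - ?g q' i j)\<bar>"
      unfolding metric_expand[OF c chart_inv_dom[OF im[OF q(1)]], of v v]
        metric_expand[OF c chart_inv_dom[OF im[OF q(2)]], of v v]
      by (simp add: sum_subtractf right_diff_distrib)
    also have "\<dots> \<le> (\<Sum>i\<in>Basis. \<bar>\<Sum>j\<in>Basis. (v \<bullet> i) * (v \<bullet> j) * (?g q i j - ?g q' i j)\<bar>)"
      by (rule sum_abs)
    also have "\<dots> \<le> (\<Sum>i\<in>Basis. \<Sum>j\<in>Basis. B i j * (norm (q - q') * (norm v)\<^sup>2))"
    proof (rule sum_mono)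
      fix i :: 'e assume i: "i \<in> Basis"
      have "\<bar>\<Sum>j\<in>Basis. (v \<bullet> i) * (v \<bullet> j) * (?g q i j - ?g q' i j)\<bar>
          \<le> (\<Sum>j\<in>Basis. \<bar>(v \<bullet> i) * (v \<bullet> j) * (?g q i j - ?g q' i j)\<bar>)" by (rule sum_abs)
      also have "\<dots> \<le> (\<Sum>j\<in>Basis. B i j * (norm (q - q') * (norm v)\<^sup>2))"
      proof (rule sum_mono)
        fix j :: 'e assume j: "j \<in> Basis"
        have "\<bar>v \<bullet> i\<bar> * \<bar>v \<bullet> j\<bar> * \<bar>?g q i j - ?g q' i j\<bar> \<le> norm v * norm v * (B i j * norm (q - q'))"
          using r2'[OF i j] q im[OF q(1)] im[OF q(2)] Lip[of q i j q'] i j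
          by (intro mult_mono Basis_le_norm) auto
        then show "\<bar>(v \<bullet> i) * (v \<bullet> j) * (?g q i j - ?g q' i j)\<bar> \<le> B i j * (norm (q - q') * (norm v)\<^sup>2)"
          by (simp add: abs_mult power2_eq_square mult_ac)
      qed
      finally show "\<bar>\<Sum>j\<in>Basis. (v \<bullet> i) * (v \<bullet> j) * (?g q i j - ?g q' i j)\<bar>
          \<le> (\<Sum>j\<in>Basis. B i j * (norm (q - q') * (norm v)\<^sup>2))" .
    qed
    also have "\<dots> = b * norm (q - q') * (norm v)\<^sup>2"
      unfolding b_def by (simp add: sum_distrib_right mult.assoc)
    finally show ?thesis .
  qed
  have pD: "chart_inv c p \<in> chart_dom c" using chart_inv_dom[OF pI] .
  note ip = metric_inner_form[OF c pD]
  have cont: "continuous_on UNIV (\<lambda>v. ?g p v v)"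
    by (rule metric_continuous[OF c]) (use pD in \<open>auto intro: continuous_intros\<close>)
  have "\<exists>i. i \<in> (Basis::'e set)" using nonempty_Basis by blast
  then have ne: "sphere (0::'e) 1 \<noteq> {}" by simp
  have csph: "continuous_on (sphere 0 1) (\<lambda>v. ?g p v v)" by (rule continuous_on_subset[OF cont]) simp
  obtain vm where vm: "vm \<in> sphere 0 1" "\<And>v. v \<in> sphere 0 1 \<Longrightarrow> ?g p vm vm \<le> ?g p v v"
    using continuous_attains_inf[OF compact_sphere ne csph] by blast
  obtain vM where vM: "\<And>v. v \<in> sphere 0 1 \<Longrightarrow> ?g p v v \<le> ?g p vM vM"
    using continuous_attains_sup[OF compact_sphere ne csph] by blast
  define \<mu> where "\<mu> = ?g p vm vm"
  define M where "M = ?g p vM vM"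
  have "vm \<noteq> 0" using vm by auto
  then have \<mu>: "\<mu> > 0" unfolding \<mu>_def using ip unfolding inner_form_def by blast
  have bl: "bilinear (?g p)" using ip unfolding inner_form_def by blast
  have gp: "\<mu> * (norm v)\<^sup>2 \<le> ?g p v v \<and> ?g p v v \<le> M * (norm v)\<^sup>2" for v
  proof (cases "v = 0")
    case True
    then show ?thesis using bl by (simp add: bilinear_lzero)
  next
    case False
    define u where "u = v /\<^sub>R norm v"
    have "u \<in> sphere 0 1" using False by (simp add: u_def)
    moreover have "v = norm v *\<^sub>R u" using False by (simp add: u_def)
    then have "?g p v v = ?g p (norm v *\<^sub>R u) (norm v *\<^sub>R u)" by simp
    then have "?g p v v = (norm v)\<^sup>2 * ?g p u u"
      by (simp only: bilinear_lmul[OF bl] bilinear_rmul[OF bl] power2_eq_square real_scaleR_def mult.assoc)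
    ultimately show ?thesis
      using vm(2)[of u] vM[of u] unfolding \<mu>_def M_def by (auto simp: mult.commute intro!: mult_left_mono)
  qed
  \<comment> \<open>Within this radius the form changes by at most
    \<open>b * r \<le> \<mu> / 2\<close> times the squared norm, half of its minimum on the unit
    sphere at \<open>p\<close>.\<close>
  define r where "r = min r2 (\<mu> / (2 * (b + 1)))"
  have r: "r > 0" "r \<le> r2" using r2 \<mu> b by (auto simp: r_def)
  have "r \<le> \<mu> / (2 * (b + 1))" by (simp add: r_def)
  then have "r * (2 * (b + 1)) \<le> \<mu>" using b by (simp add: pos_le_divide_eq)
  then have br: "b * r \<le> \<mu> / 2" using r by (simp add: algebra_simps)
  have low: "\<mu> / 2 * (norm v)\<^sup>2 \<le> ?g q v v" and up: "?g q v v \<le> (M + \<mu>) * (norm v)\<^sup>2"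
    if q: "q \<in> cball p r" for q v
  proof -
    have q2: "q \<in> cball p r2" "p \<in> cball p r2" using q r by auto
    have "b * norm (q - p) * (norm v)\<^sup>2 \<le> \<mu> / 2 * (norm v)\<^sup>2"
      using br mult_left_mono[of "norm (q - p)" r b] q b
      by (intro mult_right_mono) (auto simp: dist_norm norm_minus_commute)
    then have "\<bar>?g q v v - ?g p v v\<bar> \<le> \<mu> / 2 * (norm v)\<^sup>2" using diff[OF q2, of v] by linarith
    then have "?g p v v - \<mu> / 2 * (norm v)\<^sup>2 \<le> ?g q v v" "?g q v v \<le> ?g p v v + \<mu> / 2 * (norm v)\<^sup>2"
      unfolding abs_le_iff by linarith+
    moreover have "0 \<le> \<mu> / 2 * (norm v)\<^sup>2" using \<mu> by simp
    ultimately show "\<mu> / 2 * (norm v)\<^sup>2 \<le> ?g q v v" "?g q v v \<le> (M + \<mu>) * (norm v)\<^sup>2"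
      using gp[of v] by (auto simp: algebra_simps)
  qed
  define m where "m = sqrt (\<mu> / 2)"
  \<comment> \<open>One constant for two purposes: the square root serves the upper bound, the last
    summand is the Lipschitz constant \<open>b\<close> relative to the lower bound
    \<open>\<mu> / 2\<close>.\<close>
  define \<Lambda> where "\<Lambda> = 1 + sqrt \<bar>M + \<mu>\<bar> + b / (\<mu> / 2)"
  have m: "m > 0" "m\<^sup>2 = \<mu> / 2" using \<mu> by (auto simp: m_def)
  have \<Lambda>: "\<Lambda> > 0" unfolding \<Lambda>_def using b \<mu> by (intro add_pos_nonneg) auto
  show thesis
  proof (rule that[OF r(1) m(1) \<Lambda>])
    show "cball p r \<subseteq> interior (chart_image c)" using r r2 r1 by (meson order_trans subset_cball)
  next
    fix q v :: 'e assume q: "q \<in> cball p r"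
    have "m * norm v = sqrt (\<mu> / 2 * (norm v)\<^sup>2)" by (simp only: m_def real_sqrt_mult real_sqrt_abs abs_norm_cancel)
    also have "\<dots> \<le> sqrt (?g q v v)" using low[OF q, of v] by (rule real_sqrt_le_mono)
    finally show "m * norm v \<le> sqrt (?g q v v)" .
    have "sqrt (?g q v v) \<le> sqrt (\<bar>M + \<mu>\<bar> * (norm v)\<^sup>2)"
      using up[OF q, of v] by (intro real_sqrt_le_mono order_trans[OF up[OF q]] mult_right_mono) auto
    also have "\<dots> = sqrt \<bar>M + \<mu>\<bar> * norm v" by (simp add: real_sqrt_mult)
    also have "\<dots> \<le> \<Lambda> * norm v" unfolding \<Lambda>_def using b \<mu> by (intro mult_right_mono) auto
    finally show "sqrt (?g q v v) \<le> \<Lambda> * norm v" .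
  next
    fix q q' v :: 'e assume q: "q \<in> cball p r" "q' \<in> cball p r"
    let ?k = "b / (\<mu> / 2) * norm (q - q')"
    have k: "?k \<ge> 0" using b \<mu> by simp
    have q2: "q \<in> cball p r2" "q' \<in> cball p r2" using q r by auto
    have g0: "?g q v v \<ge> 0"
      by (rule inner_form_nonneg[OF metric_inner_form[OF c chart_inv_dom[OF im[OF q2(1)]]]])
    have "?g q' v v \<le> ?g q v v + b * norm (q - q') * (norm v)\<^sup>2" using diff[OF q2, of v] by linarith
    also have "b * norm (q - q') * (norm v)\<^sup>2 = ?k * (\<mu> / 2 * (norm v)\<^sup>2)" using \<mu> by simp
    also have "\<dots> \<le> ?k * ?g q v v" by (rule mult_left_mono[OF low[OF q(1)] k])
    finally have "?g q' v v \<le> (1 + ?k) * ?g q v v" by (simp add: algebra_simps)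
    \<comment> \<open>Weakened to a square, so that the root is again affine in the
      distance.\<close>
    also have "\<dots> \<le> (1 + ?k)\<^sup>2 * ?g q v v"
      using k g0 self_le_power[of "1 + ?k" 2] by (intro mult_right_mono) simp_all
    finally have "sqrt (?g q' v v) \<le> sqrt ((1 + ?k)\<^sup>2 * ?g q v v)" by (rule real_sqrt_le_mono)
    also have "\<dots> = (1 + ?k) * sqrt (?g q v v)" using k by (simp add: real_sqrt_mult)
    also have "\<dots> \<le> (1 + \<Lambda> * norm (q - q')) * sqrt (?g q v v)"
      unfolding \<Lambda>_def
      using g0 \<mu> by (intro mult_right_mono add_left_mono) auto
    finally show "sqrt (?g q' v v) \<le> (1 + \<Lambda> * norm (q - q')) * sqrt (?g q v v)" .
  qed
qed

lemma rdist_segment_le: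
  assumes c: "c \<in> charts R" and conv: "convex K" "K \<subseteq> chart_image c" and q: "q \<in> K" "q' \<in> K"
    and B: "\<And>z. z \<in> K \<Longrightarrow> sqrt (metric R c (chart_inv c z) (q' - q) (q' - q)) \<le> B"
  shows "rdist R (chart_inv c q) (chart_inv c q') \<le> B"
proof -
  let ?\<beta> = "\<lambda>t::real. q + t *\<^sub>R (q' - q)"
  have K: "?\<beta> t \<in> K" if "t \<in> {0..1}" for t
  proof -
    have "?\<beta> t = (1 - t) *\<^sub>R q + t *\<^sub>R q'" by (simp add: algebra_simps)
    then show ?thesis using convexD_alt[OF conv(1) q] that by auto
  qed
  have "rdist R (chart_inv c (?\<beta> 0)) (chart_inv c (?\<beta> 1)) \<le> B"
  proof (rule rdist_chart_le[OF c, where \<beta>' = "\<lambda>t. q' - q"])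
    show "(?\<beta> has_vector_derivative q' - q) (at t within {0..1})" for t
      by (auto intro!: derivative_eq_intros)
  qed (use K conv B in auto)
  then show ?thesis by simp
qed

text \<open>Nearby points may lie on the boundary, so they are joined in the chart by a parabolic arc
  \<open>q + t (q' - q) + t (1 - t) \<sigma> v\<close> bending in a direction \<open>v\<close> that points into the domain.\<close>

lemma rdist_locally_bounded:
  obtains U B where "open U" "x \<in> U" "\<And>y z. y \<in> U \<Longrightarrow> z \<in> U \<Longrightarrow> rdist R y z \<le> B"
proof -
  define c where "c = chart_at R x"
  have c: "c \<in> charts R" "x \<in> chart_dom c" using chart_at by (auto simp: c_def)
  define p where "p = chart_map c x"
  let ?S = "chart_image c"
  let ?g = "\<lambda>q. metric R c (chart_inv c q)"
  have p: "p \<in> ?S" using c by (auto simp: p_def)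
  obtain v r where r: "r > 0"
    and cone: "\<And>q w \<tau>. q \<in> ?S \<Longrightarrow> dist p q < r \<Longrightarrow> dist v w < r \<Longrightarrow> 0 \<le> \<tau> \<Longrightarrow> \<tau> \<le> r \<Longrightarrow> q + \<tau> *\<^sub>R w \<in> ?S"
    by (rule locally_C1_domain_cone[OF chart_C1_domain[OF c(1)] p]) (rule that)
  have "\<forall>\<^sub>F q in at p within ?S. \<bar>?g q i j\<bar> < \<bar>?g p i j\<bar> + 1" for i j
  proof -
    have "((\<lambda>q. \<bar>?g q i j\<bar>) \<longlongrightarrow> \<bar>?g p i j\<bar>) (at p within ?S)"
      using metric_coeff_continuous[OF c(1), of i j] p unfolding continuous_on_def
      by (intro tendsto_intros) auto
    then show ?thesis by (rule order_tendstoD) simp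
  qed
  then have "\<forall>\<^sub>F q in at p within ?S. \<forall>i\<in>Basis. \<forall>j\<in>Basis. \<bar>?g q i j\<bar> < \<bar>?g p i j\<bar> + 1"
    by (intro eventually_ball_finite ballI) auto
  then obtain e where e: "e > 0"
    and eb: "\<And>q i j. q \<in> ?S \<Longrightarrow> q \<noteq> p \<Longrightarrow> dist q p < e \<Longrightarrow> i \<in> Basis \<Longrightarrow> j \<in> Basis \<Longrightarrow> \<bar>?g q i j\<bar> < \<bar>?g p i j\<bar> + 1"
    unfolding eventually_at by blast
  have eb': "\<bar>?g q i j\<bar> \<le> \<bar>?g p i j\<bar> + 1" if "q \<in> ?S" "dist q p < e" "i \<in> Basis" "j \<in> Basis" for q i j
    using eb[of q i j] that by (cases "q = p") auto
  define C where "C = (\<Sum>i\<in>Basis. \<Sum>j\<in>Basis. \<bar>?g p i j\<bar> + 1)"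
  have gC: "?g q w w \<le> (norm w)\<^sup>2 * C" if q: "q \<in> ?S" "dist q p < e" for q w
  proof -
    have "?g q w w = (\<Sum>i\<in>Basis. \<Sum>j\<in>Basis. (w \<bullet> i) * (w \<bullet> j) * ?g q i j)"
      by (rule metric_expand[OF c(1) chart_inv_dom[OF q(1)]])
    also have "\<dots> \<le> (\<Sum>i\<in>Basis. \<Sum>j\<in>Basis. (norm w)\<^sup>2 * (\<bar>?g p i j\<bar> + 1))"
    proof (intro sum_mono)
      fix i j :: 'e assume ij: "i \<in> Basis" "j \<in> Basis"
      have "(w \<bullet> i) * (w \<bullet> j) * ?g q i j \<le> \<bar>w \<bullet> i\<bar> * \<bar>w \<bullet> j\<bar> * \<bar>?g q i j\<bar>"
        by (simp add: abs_mult[symmetric])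
      also have "\<dots> \<le> norm w * norm w * (\<bar>?g p i j\<bar> + 1)"
        using eb'[OF q ij] ij by (intro mult_mono Basis_le_norm) auto
      finally show "(w \<bullet> i) * (w \<bullet> j) * ?g q i j \<le> (norm w)\<^sup>2 * (\<bar>?g p i j\<bar> + 1)"
        by (simp add: power2_eq_square)
    qed
    also have "\<dots> = (norm w)\<^sup>2 * C" unfolding C_def by (simp add: sum_distrib_left)
    finally show ?thesis .
  qed
  \<comment> \<open>\<open>\<sigma> \<le> r\<close> makes \<open>t (1 - t) \<sigma>\<close> an
    admissible time in the cone property; \<open>\<sigma> * norm v \<le> e / 4\<close> keeps the arc
    and its velocity small.\<close>
  define \<sigma> where "\<sigma> = min r (e / (4 * (norm v + 1)))"
  have nv: "norm v + 1 > 0" using norm_ge_zero[of v] by linarith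
  have \<sigma>: "\<sigma> > 0" "\<sigma> \<le> r" using r e nv by (auto simp: \<sigma>_def)
  have "\<sigma> \<le> e / (4 * (norm v + 1))" by (simp add: \<sigma>_def)
  then have "\<sigma> * (4 * (norm v + 1)) \<le> e" using nv by (simp add: pos_le_divide_eq)
  then have \<sigma>v: "\<sigma> * norm v \<le> e / 4" using \<sigma> by (simp add: algebra_simps)
  \<comment> \<open>\<open>r * \<sigma> / 4\<close> limits the tilt of the cone direction to
    \<open>r\<close>; \<open>e / 8\<close> keeps the arc in the region of bounded metric.\<close>
  define d where "d = min (r * \<sigma> / 4) (min r (e / 8))"
  have d: "d > 0" "d \<le> r * \<sigma> / 4" "d \<le> r" "d \<le> e / 8" using r \<sigma> e by (auto simp: d_def)
  have main: "rdist R (chart_inv c q) (chart_inv c q') \<le> sqrt C * e"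
    if q: "q \<in> ?S" "dist p q < d" and q': "q' \<in> ?S" "dist p q' < d" for q q'
  proof -
    let ?\<beta> = "\<lambda>t. q + t *\<^sub>R (q' - q) + (t * (1 - t) * \<sigma>) *\<^sub>R v"
    let ?\<beta>' = "\<lambda>t. (q' - q) + ((1 - 2 * t) * \<sigma>) *\<^sub>R v"
    have qq: "norm (q' - q) < 2 * d"
      using q q' dist_triangle[of q' q p] by (simp add: dist_norm norm_minus_commute)
    \<comment> \<open>For \<open>t \<le> 1/2\<close> the point of the arc is reached from
      \<open>a\<close> in time \<open>t (1 - t) \<sigma>\<close> along \<open>?w\<close>, a tilted
      copy of \<open>v\<close>. The tilt has denominator \<open>(1 - t) \<sigma>\<close>, at least
      \<open>\<sigma> / 2\<close> on this half of the arc.\<close>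
    have half: "a + (t * (1 - t) * \<sigma>) *\<^sub>R v + t *\<^sub>R (a' - a) \<in> ?S"
      if a: "a \<in> ?S" "dist p a < d" and aa: "norm (a' - a) < 2 * d" and t: "0 \<le> t" "t \<le> 1/2" for a a' t
    proof -
      let ?w = "v + (1 / ((1 - t) * \<sigma>)) *\<^sub>R (a' - a)"
      let ?\<tau> = "t * (1 - t) * \<sigma>"
      have t1: "(1 - t) * \<sigma> \<ge> \<sigma> / 2" using t \<sigma> mult_right_mono[of "1/2" "1 - t" \<sigma>] by simp
      have "dist v ?w = norm (a' - a) / ((1 - t) * \<sigma>)" using t \<sigma> by (simp add: dist_norm)
      also have "\<dots> \<le> norm (a' - a) / (\<sigma> / 2)" using t1 \<sigma> by (intro divide_left_mono) auto
      also have "\<dots> < r" using aa d(2) \<sigma> by (simp add: field_simps)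
      finally have w: "dist v ?w < r" .
      have "t * (1 - t) \<le> 1 * 1" using t by (intro mult_mono) auto
      then have "?\<tau> \<le> 1 * \<sigma>" using \<sigma> by (intro mult_right_mono) auto
      from order_trans[OF this] have \<tau>: "?\<tau> \<le> r" using \<sigma>(2) by simp
      have \<tau>0: "0 \<le> ?\<tau>" using t \<sigma> by simp
      have "a + ?\<tau> *\<^sub>R ?w = a + ?\<tau> *\<^sub>R v + t *\<^sub>R (a' - a)"
        using t \<sigma> by (simp add: scaleR_add_right)
      then show ?thesis using cone[OF a(1) _ w \<tau>0 \<tau>] a d by (simp add: add.assoc)
    qed
    have \<beta>S: "?\<beta> t \<in> ?S" if t: "t \<in> {0..1}" for t
    proof (cases "t \<le> 1/2")
      case True
      then show ?thesis using half[OF q qq, of t] t by (simp add: add_ac)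
    next
      case False
      \<comment> \<open>The arc is symmetric under exchange of its ends together with
        \<open>t\<close> and \<open>1 - t\<close>.\<close>
      then have "0 \<le> 1 - t" "1 - t \<le> 1/2" using t by auto
      from half[OF q' _ this, of q] qq
      have "q' + ((1 - t) * t * \<sigma>) *\<^sub>R v + (1 - t) *\<^sub>R (q - q') \<in> ?S" by (simp add: norm_minus_commute)
      moreover have "q' + ((1 - t) * t * \<sigma>) *\<^sub>R v + (1 - t) *\<^sub>R (q - q') = ?\<beta> t" by (simp add: algebra_simps)
      ultimately show ?thesis by simp
    qed
    have \<beta>p: "dist (?\<beta> t) p < e" if t: "t \<in> {0..1}" for t
    proof -
      have "t * (1 - t) \<le> 1 * 1" using t by (intro mult_mono) auto
      then have "t * (1 - t) * (\<sigma> * norm v) \<le> 1 * (\<sigma> * norm v)" using \<sigma> by (intro mult_right_mono) auto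
      moreover have "norm ((t * (1 - t) * \<sigma>) *\<^sub>R v) = t * (1 - t) * (\<sigma> * norm v)"
        using t \<sigma> by (simp add: abs_mult)
      ultimately have 1: "norm ((t * (1 - t) * \<sigma>) *\<^sub>R v) \<le> e / 4" using \<sigma>v by linarith
      have 2: "norm (t *\<^sub>R (q' - q)) \<le> 2 * d" using qq t mult_right_mono[of t 1 "norm (q' - q)"] by simp
      have "dist (?\<beta> t) p = norm ((q - p) + t *\<^sub>R (q' - q) + (t * (1 - t) * \<sigma>) *\<^sub>R v)"
        by (simp add: dist_norm algebra_simps)
      also have "\<dots> \<le> norm (q - p) + norm (t *\<^sub>R (q' - q)) + norm ((t * (1 - t) * \<sigma>) *\<^sub>R v)"
        by (intro norm_triangle_mono) auto
      also have "\<dots> < e" using 1 2 q d e by (simp add: dist_norm norm_minus_commute)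
      finally show ?thesis .
    qed
    have "rdist R (chart_inv c (?\<beta> 0)) (chart_inv c (?\<beta> 1)) \<le> sqrt C * e"
    proof (rule rdist_chart_le[OF c(1) \<beta>S, where \<beta>' = ?\<beta>'])
      show "(?\<beta> has_vector_derivative ?\<beta>' t) (at t within {0..1})" for t
        by (auto intro!: derivative_eq_intros simp: algebra_simps)
      show "continuous_on {0..1} ?\<beta>'" by (intro continuous_intros)
      fix t :: real assume t: "t \<in> {0..1}"
      have "\<bar>1 - 2 * t\<bar> \<le> 1" using t by auto
      then have "\<bar>1 - 2 * t\<bar> * (\<sigma> * norm v) \<le> 1 * (\<sigma> * norm v)" using \<sigma> by (intro mult_right_mono) auto
      moreover have "norm (((1 - 2 * t) * \<sigma>) *\<^sub>R v) = \<bar>1 - 2 * t\<bar> * (\<sigma> * norm v)"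
        using \<sigma> by (simp add: abs_mult)
      ultimately have 1: "norm (((1 - 2 * t) * \<sigma>) *\<^sub>R v) \<le> e / 4" using \<sigma>v by linarith
      have nb: "norm (?\<beta>' t) \<le> e" using norm_triangle_ineq[of "q' - q" "((1 - 2 * t) * \<sigma>) *\<^sub>R v"] 1 qq d e by linarith
      have C0: "C \<ge> 0" unfolding C_def by (intro sum_nonneg) auto
      have "sqrt (?g (?\<beta> t) (?\<beta>' t) (?\<beta>' t)) \<le> sqrt ((norm (?\<beta>' t))\<^sup>2 * C)"
        by (rule real_sqrt_le_mono[OF gC[OF \<beta>S[OF t] \<beta>p[OF t]]])
      also have "\<dots> = norm (?\<beta>' t) * sqrt C" by (simp add: real_sqrt_mult)
      also have "\<dots> \<le> e * sqrt C" using nb C0 by (intro mult_right_mono) auto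
      finally show "sqrt (?g (?\<beta> t) (?\<beta>' t) (?\<beta>' t)) \<le> sqrt C * e" by (simp add: mult.commute)
    qed simp_all
    then show ?thesis by simp
  qed
  let ?U = "chart_dom c \<inter> chart_map c -` ball p d"
  have "open ?U"
    using continuous_on_chart[OF c(1)] chart_open[OF c(1)] by (simp add: continuous_on_open_vimage Int_commute)
  moreover have "x \<in> ?U" using c d by (simp add: p_def)
  moreover have "rdist R y z \<le> sqrt C * e" if "y \<in> ?U" "z \<in> ?U" for y z
    using main[of "chart_map c y" "chart_map c z"] that chart_inv_map[OF c(1)] by simp
  ultimately show thesis using that by blast
qed

end

section \<open>Quadratic test functions in arbitrary charts\<close>

lemma Ck_on_1I:
  assumes D: "\<And>x. x \<in> S \<Longrightarrow> (f has_derivative D x) (at x)"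
    and cont: "\<And>v. continuous_on S (\<lambda>x. D x v)"
  shows "Ck_on 1 S f"
  unfolding Ck_on_1_iff
proof (intro conjI ballI allI)
  show "f differentiable (at x)" if "x \<in> S" for x using D[OF that] by (rule differentiableI)
  show "continuous_on S (\<lambda>x. frechet_derivative f (at x) v)" for v
    by (rule continuous_on_eq[OF cont]) (use frechet_derivative_at[OF D] in simp)
qed

context riem_manifold
begin

text \<open>\<open>mboundary\<close> collects a point as soon as one chart sees it on the boundary,
  so a point outside it is interior in all charts.\<close>

lemma interior_chart:
  assumes "x \<notin> mboundary R" "c \<in> charts R" "x \<in> chart_dom c"
  shows "chart_map c x \<in> interior (chart_image c)"
  using assms unfolding mboundary_def by blast

text \<open>The transition derivative \<open>D\<close> is an isometry of the tangent space, hence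
  bijective, and maps the gradient computed in \<open>c0\<close> to the one computed in
  \<open>c\<close>.\<close>

lemma dual_norm_transition:
  assumes c: "c0 \<in> charts R" "c \<in> charts R" "x \<in> chart_dom c0" "x \<in> chart_dom c"
    and lin: "linear D" and g: "\<And>u v. metric R c0 x u v = metric R c x (D u) (D v)"
    and v: "\<And>w. metric R c0 x v w = p \<bullet> D w"
  shows "sqrt (metric R c0 x v v) = dual_norm (metric R c x) p"
proof -
  note i0 = metric_inner_form[OF c(1,3)] and i = metric_inner_form[OF c(2,4)]
  have "u = 0" if "D u = 0" for u
  proof (rule ccontr)
    assume "u \<noteq> 0"
    then have "metric R c0 x u u > 0" using i0 unfolding inner_form_def by blast
    moreover have "metric R c x 0 0 = 0"
      using i bilinear_lzero unfolding inner_form_def by blast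
    ultimately show False using g[of u u] that by simp
  qed
  then have "inj D" using linear_injective_0[OF lin] by blast
  then have "surj D" by (rule linear_inj_imp_surj[OF lin])
  have "metric R c x (D v) w = p \<bullet> w" for w
  proof -
    obtain w' where "w = D w'" using \<open>surj D\<close> by (rule surjE)
    then show ?thesis using g[of v w'] v[of w'] by simp
  qed
  then have "sharp (metric R c x) p = D v" by (rule sharp_eqI[OF i])
  then show ?thesis unfolding dual_norm_def using g by simp
qed

text \<open>Test functions and gradients are defined through \<open>chart_at R x\<close>, while
  \<open>\<phi>\<close> is quadratic in an arbitrary chart \<open>c\<close>. Pulled back by the
  transition map it is still C1, and its second-order part contributes nothing at
  \<open>(x, t)\<close>.\<close>

lemma quadratic_test_function:
  fixes p :: 'e and a N t :: real
  assumes x: "x \<notin> mboundary R" and c: "c \<in> charts R" "x \<in> chart_dom c"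
  defines "\<phi> \<equiv> \<lambda>z. p \<bullet> (chart_map c (fst z) - chart_map c x) + a * (snd z - t)
      + N * ((norm (chart_map c (fst z) - chart_map c x))\<^sup>2 + (snd z - t)\<^sup>2)"
  shows "C1_near_spacetime R \<phi> x t"
    and "deriv (\<lambda>s. \<phi> (x, s)) t = a"
    and "rnorm R x (grad R (\<lambda>y. \<phi> (y, t)) x) = dual_norm (metric R c x) p"
proof -
  let ?c0 = "chart_at R x"
  note c0 = chart_at[of x]
  obtain W F where W: "open W" "chart_map ?c0 x \<in> W" "Ck_on 1 W F"
    and F: "\<And>y. y \<in> chart_dom ?c0 \<Longrightarrow> y \<in> chart_dom c \<Longrightarrow> chart_map ?c0 y \<in> W \<Longrightarrow> F (chart_map ?c0 y) = chart_map c y"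
    by (rule transition[OF c0(1) c(1) c0(2) c(2)]) (rule that)
  let ?I = "interior (chart_image ?c0)"
  let ?D = "\<lambda>q. frechet_derivative F (at q)"
  define p0 where "p0 = chart_map c x"
  \<comment> \<open>On \<open>V\<close> the points lie in both charts, so \<open>\<phi>\<close> is
    given there by a formula in \<open>F\<close>.\<close>
  define V where "V = W \<inter> (?I \<inter> chart_inv ?c0 -` chart_dom c)"
  have "continuous_on ?I (chart_inv ?c0)"
    by (rule continuous_on_subset[OF continuous_on_chart_inv[OF c0(1)] interior_subset])
  then have "open (?I \<inter> chart_inv ?c0 -` chart_dom c)"
    by (intro continuous_open_preimage chart_open[OF c(1)]) auto
  then have V: "open V" unfolding V_def using W by blast
  have xI: "chart_map ?c0 x \<in> ?I" by (rule interior_chart[OF x c0])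
  then have xV: "chart_map ?c0 x \<in> V" using W c chart_inv_map[OF c0] by (simp add: V_def)
  have VI: "V \<subseteq> chart_image ?c0" unfolding V_def using interior_subset by blast
  have FV: "chart_map c (chart_inv ?c0 q) = F q" if "q \<in> V" for q
    using F[OF chart_inv_dom, of q] that VI chart_map_inv[of q ?c0] unfolding V_def by auto
  have VW: "V \<subseteq> W" unfolding V_def by blast
  have FD: "(F has_derivative ?D q) (at q)" if "q \<in> V" for q
    using Ck_on_1_has_derivative[OF W(3)] that VW by blast
  have Fx: "F (chart_map ?c0 x) = p0" using FV[OF xV] chart_inv_map[OF c0] by (simp add: p0_def)

  let ?\<psi> = "\<lambda>z::'e \<times> real. p \<bullet> (F (fst z) - p0) + a * (snd z - t) + N * ((norm (F (fst z) - p0))\<^sup>2 + (snd z - t)\<^sup>2)"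
  let ?E = "\<lambda>z w. p \<bullet> ?D (fst z) (fst w) + a * snd w
      + N * (2 * ((F (fst z) - p0) \<bullet> ?D (fst z) (fst w)) + 2 * (snd z - t) * snd w)"
  have \<psi>: "(?\<psi> has_derivative ?E z) (at z)" if z: "z \<in> V \<times> UNIV" for z
  proof -
    have Fz: "((\<lambda>z. F (fst z)) has_derivative (\<lambda>w. ?D (fst z) (fst w))) (at z)"
      by (rule has_derivative_compose[OF has_derivative_fst[OF has_derivative_ident]])
        (use FD z in auto)
    show ?thesis
      unfolding power2_norm_eq_inner
      by (auto intro!: derivative_eq_intros Fz simp: inner_commute algebra_simps fun_eq_iff)
  qed
  have eq: "(\<lambda>(q, s). \<phi> (chart_inv ?c0 q, s)) z = ?\<psi> z" if "z \<in> V \<times> UNIV" for z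
    using that FV by (auto simp: \<phi>_def p0_def)
  have oV: "open (V \<times> (UNIV :: real set))" using V by (intro open_Times) auto
  have "((\<lambda>(q, s). \<phi> (chart_inv ?c0 q, s)) has_derivative ?E z) (at z)" if "z \<in> V \<times> UNIV" for z
    by (rule has_derivative_transform_within_open[OF \<psi>[OF that] oV that]) (simp add: eq)
  then have "Ck_on 1 (V \<times> UNIV) (\<lambda>(q, s). \<phi> (chart_inv ?c0 q, s))"
  proof (rule Ck_on_1I)
    fix w :: "'e \<times> real"
    have 1: "continuous_on (V \<times> UNIV) (\<lambda>z::'e\<times>real. ?D (fst z) (fst w))"
      by (rule Ck_on_1_derivative_continuous[OF W(3)]) (use VW in \<open>auto intro!: continuous_intros\<close>)
    have 2: "continuous_on (V \<times> UNIV) (\<lambda>z::'e\<times>real. F (fst z))"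
      by (rule continuous_on_compose2[OF Ck_on_imp_continuous_on[OF W(3)]])
        (use VW in \<open>auto intro!: continuous_intros\<close>)
    show "continuous_on (V \<times> UNIV) (\<lambda>z. ?E z w)" by (intro continuous_intros 1 2)
  qed
  then show "C1_near_spacetime R \<phi> x t"
    unfolding C1_near_spacetime_def Let_def
    using oV xV VI by (intro exI[of _ "V \<times> UNIV"]) auto

  have "((\<lambda>s. \<phi> (x, s)) has_real_derivative a) (at t)"
    unfolding \<phi>_def by (auto intro!: derivative_eq_intros)
  then show "deriv (\<lambda>s. \<phi> (x, s)) t = a" by (rule DERIV_imp_deriv)

  let ?q0 = "chart_map ?c0 x"
  let ?h = "(\<lambda>y. \<phi> (y, t)) \<circ> chart_inv ?c0"
  have "((\<lambda>q. p \<bullet> (F q - p0) + N * (norm (F q - p0))\<^sup>2) has_derivative (\<lambda>w. p \<bullet> ?D ?q0 w)) (at ?q0)"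
    unfolding power2_norm_eq_inner
    by (auto intro!: derivative_eq_intros FD[OF xV] simp: Fx)
  then have "(?h has_derivative (\<lambda>w. p \<bullet> ?D ?q0 w)) (at ?q0)"
    by (rule has_derivative_transform_within_open[OF _ V xV]) (simp add: \<phi>_def FV p0_def)
  then have fd: "frechet_derivative ?h (at ?q0) = (\<lambda>w. p \<bullet> ?D ?q0 w)"
    by (rule frechet_derivative_at[symmetric])
  have lin: "linear (?D ?q0)" using FD[OF xV] by (rule has_derivative_linear)
  \<comment> \<open>Riesz representation makes the definite description in \<open>grad\<close>
    denote.\<close>
  have ex: "\<exists>!v. \<forall>w. metric R ?c0 x v w = p \<bullet> ?D ?q0 w"
    by (rule inner_form_riesz[OF metric_inner_form[OF c0]])
      (use linear_compose[OF lin bounded_linear.linear[OF bounded_linear_inner_right[of p]]] in \<open>simp add: o_def\<close>)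
  have "\<forall>w. metric R ?c0 x (grad R (\<lambda>y. \<phi> (y, t)) x) w = p \<bullet> ?D ?q0 w"
    unfolding grad_def Let_def fd by (rule theI'[OF ex])
  then show "rnorm R x (grad R (\<lambda>y. \<phi> (y, t)) x) = dual_norm (metric R c x) p"
    unfolding rnorm_def
    by (intro dual_norm_transition[OF c0(1) c(1) c0(2) c(2) lin]
        metric_transition[OF c0(1) c(1) c0(2) c(2) W(1,2) F FD[OF xV]]) auto
qed

text \<open>A polynomial with value 0, coordinate differential \<open>p\<close> and time derivative
  \<open>a\<close> at \<open>(x, t)\<close>. As \<open>N\<close> may have either sign, one formula
  serves for touching from above and from below.\<close>

definition jet :: "('m, 'e) chart \<Rightarrow> 'm \<Rightarrow> real \<Rightarrow> 'e \<Rightarrow> real \<Rightarrow> real \<Rightarrow> 'm \<times> real \<Rightarrow> real" where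
  "jet c x t p a N z = p \<bullet> (chart_map c (fst z) - chart_map c x) + a * (snd z - t)
      + N * ((norm (chart_map c (fst z) - chart_map c x))\<^sup>2 + (snd z - t)\<^sup>2)"

text \<open>Unlike \<^const>\<open>viscosity_subsolution\<close>, which tests with \<open>C\<^sup>1\<close> functions in the chosen chart
  \<^term>\<open>chart_at R x\<close>, the following notions test with quadratic functions only, but in every chart.
  They are visibly invariant under time translation.\<close>

definition prox_sub :: "'m set \<Rightarrow> ('m \<Rightarrow> real) \<Rightarrow> real \<Rightarrow> ('m \<times> real \<Rightarrow> real) \<Rightarrow> bool" where
  "prox_sub \<Gamma> P T u \<longleftrightarrow> (\<forall>c x t p a N. c \<in> charts R \<and> x \<in> chart_dom c \<and> x \<notin> \<Gamma> \<and> 0 < t \<and> t < T \<and>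
      (\<forall>\<^sub>F z in nhds (x, t). u z \<le> u (x, t) + jet c x t p a N z)
      \<longrightarrow> a + dual_norm (metric R c x) p \<le> P x)"

definition prox_super :: "'m set \<Rightarrow> ('m \<Rightarrow> real) \<Rightarrow> real \<Rightarrow> ('m \<times> real \<Rightarrow> real) \<Rightarrow> bool" where
  "prox_super \<Gamma> P T u \<longleftrightarrow> (\<forall>c x t p a N. c \<in> charts R \<and> x \<in> chart_dom c \<and> x \<notin> \<Gamma> \<and> 0 < t \<and> t < T \<and>
      (\<forall>\<^sub>F z in nhds (x, t). u z \<ge> u (x, t) + jet c x t p a N z)
      \<longrightarrow> a + dual_norm (metric R c x) p \<ge> P x)"

text \<open>The condition on \<open>\<Gamma>\<close> makes the test point interior, where a jet is a
  C1 test function. The jet vanishes at that point, so touching from above is a local maximum of the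
  difference.\<close>

lemma viscosity_subsolution_imp_prox_sub:
  assumes u: "viscosity_subsolution R \<Gamma> P f0 T u" and \<Gamma>: "mboundary R \<subseteq> \<Gamma>"
  shows "prox_sub \<Gamma> P T u"
  unfolding prox_sub_def
proof (intro allI impI, elim conjE)
  fix c x t p a N
  assume c: "c \<in> charts R" "x \<in> chart_dom c" and x: "x \<notin> \<Gamma>" and t: "0 < t" "t < T"
    and ev: "\<forall>\<^sub>F z in nhds (x, t). u z \<le> u (x, t) + jet c x t p a N z"
  have x': "x \<notin> mboundary R" using x \<Gamma> by blast
  note q = quadratic_test_function[OF x' c, where p=p and a=a and N=N and t=t, folded jet_def]
  have "jet c x t p a N (x, t) = 0" by (simp add: jet_def)
  then have "\<forall>\<^sub>F z in at (x, t) within cylinder T. u z - jet c x t p a N z \<le> u (x, t) - jet c x t p a N (x, t)"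
    unfolding eventually_at_filter using ev by (auto elim!: eventually_mono)
  then have "deriv (\<lambda>s. jet c x t p a N (x, s)) t + rnorm R x (grad R (\<lambda>y. jet c x t p a N (y, t)) x) \<le> P x"
    using u x t q(1) unfolding viscosity_subsolution_def by blast
  then show "a + dual_norm (metric R c x) p \<le> P x" unfolding q(2,3) .
qed

lemma viscosity_supersolution_imp_prox_super:
  assumes u: "viscosity_supersolution R \<Gamma> P f0 T u" and \<Gamma>: "mboundary R \<subseteq> \<Gamma>"
  shows "prox_super \<Gamma> P T u"
  unfolding prox_super_def
proof (intro allI impI, elim conjE)
  fix c x t p a N
  assume c: "c \<in> charts R" "x \<in> chart_dom c" and x: "x \<notin> \<Gamma>" and t: "0 < t" "t < T"
    and ev: "\<forall>\<^sub>F z in nhds (x, t). u z \<ge> u (x, t) + jet c x t p a N z"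
  have x': "x \<notin> mboundary R" using x \<Gamma> by blast
  note q = quadratic_test_function[OF x' c, where p=p and a=a and N=N and t=t, folded jet_def]
  have "jet c x t p a N (x, t) = 0" by (simp add: jet_def)
  then have "\<forall>\<^sub>F z in at (x, t) within cylinder T. u z - jet c x t p a N z \<ge> u (x, t) - jet c x t p a N (x, t)"
    unfolding eventually_at_filter using ev by (auto elim!: eventually_mono)
  then have "deriv (\<lambda>s. jet c x t p a N (x, s)) t + rnorm R x (grad R (\<lambda>y. jet c x t p a N (y, t)) x) \<ge> P x"
    using u x t q(1) unfolding viscosity_supersolution_def by blast
  then show "a + dual_norm (metric R c x) p \<ge> P x" unfolding q(2,3) .
qed

lemma eventually_chart_ball:
  fixes t :: real
  assumes c: "c \<in> charts R" and x: "x \<in> chart_dom c" and z: "(chart_map c x, t) \<in> ball zh r"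
  shows "\<forall>\<^sub>F z in nhds (x, t). fst z \<in> chart_dom c \<and> (chart_map c (fst z), snd z) \<in> ball zh r"
proof -
  let ?A = "(chart_dom c \<times> UNIV) \<inter> (\<lambda>z. (chart_map c (fst z), snd z)) -` ball zh r"
  have "continuous_on (chart_dom c \<times> (UNIV::real set)) (\<lambda>z. (chart_map c (fst z), snd z))"
    by (intro continuous_intros continuous_on_compose2[OF continuous_on_chart[OF c]]) auto
  then have "open ?A"
    using chart_open[OF c] by (intro continuous_open_preimage open_Times) auto
  moreover have "(x, t) \<in> ?A" using x z by simp
  ultimately show ?thesis
    by (rule eventually_nhds_in_open[THEN eventually_mono]) auto
qed

text \<open>\<open>p\<close> is the full space-time covector. The form is adapted to doubling:
  maxima over a closed coordinate ball are tested at points \<open>z\<close> of the open one, of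
  which the ball is a neighbourhood.\<close>

lemma prox_sub_chart:
  assumes u: "prox_sub \<Gamma> P T u" and c: "c \<in> charts R" and z: "z \<in> ball zh r" "fst z \<in> chart_image c"
    and \<Gamma>: "chart_inv c (fst z) \<notin> \<Gamma>" and t: "0 < snd z" "snd z < T"
    and le: "\<And>z'. z' \<in> cball zh r \<Longrightarrow> u (chart_inv c (fst z'), snd z')
        \<le> u (chart_inv c (fst z), snd z) + p \<bullet> (z' - z) + N * (norm (z' - z))\<^sup>2"
  shows "snd p + dual_norm (metric R c (chart_inv c (fst z))) (fst p) \<le> P (chart_inv c (fst z))"
proof -
  let ?x = "chart_inv c (fst z)"
  have x: "?x \<in> chart_dom c" "chart_map c ?x = fst z"
    by (rule chart_inv_dom[OF z(2)]) (rule chart_map_inv[OF z(2)])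
  have "\<forall>\<^sub>F w in nhds (?x, snd z). fst w \<in> chart_dom c \<and> (chart_map c (fst w), snd w) \<in> ball zh r"
    by (rule eventually_chart_ball[OF c x(1)]) (use x z in simp)
  then have "\<forall>\<^sub>F w in nhds (?x, snd z). u w \<le> u (?x, snd z) + jet c ?x (snd z) (fst p) (snd p) N w"
  proof eventually_elim
    case (elim w)
    then show ?case
      using le[of "(chart_map c (fst w), snd w)"] chart_inv_map[OF c, of "fst w"] x(2)
      by (simp add: jet_def inner_prod_def norm_prod_def)
  qed
  then show ?thesis using u c x(1) \<Gamma> t unfolding prox_sub_def by blast
qed

lemma prox_super_chart:
  assumes u: "prox_super \<Gamma> P T u" and c: "c \<in> charts R" and z: "z \<in> ball zh r" "fst z \<in> chart_image c"
    and \<Gamma>: "chart_inv c (fst z) \<notin> \<Gamma>" and t: "0 < snd z" "snd z < T"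
    and le: "\<And>z'. z' \<in> cball zh r \<Longrightarrow> u (chart_inv c (fst z'), snd z')
        \<ge> u (chart_inv c (fst z), snd z) + p \<bullet> (z' - z) - N * (norm (z' - z))\<^sup>2"
  shows "snd p + dual_norm (metric R c (chart_inv c (fst z))) (fst p) \<ge> P (chart_inv c (fst z))"
proof -
  let ?x = "chart_inv c (fst z)"
  have x: "?x \<in> chart_dom c" "chart_map c ?x = fst z"
    by (rule chart_inv_dom[OF z(2)]) (rule chart_map_inv[OF z(2)])
  have "\<forall>\<^sub>F w in nhds (?x, snd z). fst w \<in> chart_dom c \<and> (chart_map c (fst w), snd w) \<in> ball zh r"
    by (rule eventually_chart_ball[OF c x(1)]) (use x z in simp)
  then have "\<forall>\<^sub>F w in nhds (?x, snd z). u w \<ge> u (?x, snd z) + jet c ?x (snd z) (fst p) (snd p) (- N) w"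
  proof eventually_elim
    case (elim w)
    then show ?case
      using le[of "(chart_map c (fst w), snd w)"] chart_inv_map[OF c, of "fst w"] x(2)
      by (simp add: jet_def inner_prod_def norm_prod_def)
  qed
  then show ?thesis using u c x(1) \<Gamma> t unfolding prox_super_def by blast
qed

end

section \<open>Comparison principle\<close>

text \<open>Doubling in coordinates for an abstract Hamiltonian \<open>H\<close>. \<open>a\<close>
  is the strict gain in time that the barrier of the comparison provides, and \<open>N\<close>
  bounds its second-order part. \<open>H1\<close> to \<open>H3\<close> are Lipschitz dependence on
  the covector, relative Lipschitz dependence on the point, and linear growth.\<close>

lemma local_doubling:
  fixes U V :: "'e::euclidean_space \<times> real \<Rightarrow> real" and H :: "'e \<Rightarrow> 'e \<Rightarrow> real" and G :: "'e \<Rightarrow> real"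
  assumes r: "r > 0" and a: "a > 0" and C: "C \<ge> 0"
    and U: "usc_on (cball zh r) U" and V: "lsc_on (cball zh r) V"
    and max: "\<And>z. z \<in> cball zh r \<Longrightarrow>
        U z - V z \<le> U zh - V zh + a * (snd z - snd zh) + N * (norm (z - zh))\<^sup>2"
    and jetU: "\<And>z p M. z \<in> ball zh r \<Longrightarrow>
        (\<And>z'. z' \<in> cball zh r \<Longrightarrow> U z' \<le> U z + p \<bullet> (z' - z) + M * (norm (z' - z))\<^sup>2) \<Longrightarrow>
        snd p + H (fst z) (fst p) \<le> G (fst z)"
    and jetV: "\<And>z p M. z \<in> ball zh r \<Longrightarrow>
        (\<And>z'. z' \<in> cball zh r \<Longrightarrow> V z' \<ge> V z + p \<bullet> (z' - z) - M * (norm (z' - z))\<^sup>2) \<Longrightarrow>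
        snd p + H (fst z) (fst p) \<ge> G (fst z)"
    and H1: "\<And>q p d. q \<in> cball (fst zh) r \<Longrightarrow> H q p \<le> H q (d + p) + C * norm d"
    and H2: "\<And>q q' p. q \<in> cball (fst zh) r \<Longrightarrow> q' \<in> cball (fst zh) r \<Longrightarrow>
        H q' p \<le> (1 + C * norm (q' - q)) * H q p"
    and H3: "\<And>q p. q \<in> cball (fst zh) r \<Longrightarrow> H q p \<le> C * norm p"
    and G: "continuous_on (cball (fst zh) r) G"
  shows False
proof -
  let ?N = "2 * (N + 1)"
  \<comment> \<open>\<open>N + 1\<close> in place of \<open>N\<close> makes \<open>zh\<close> a
    strict maximum point of \<open>?A - V\<close>.\<close>
  let ?A = "\<lambda>z. U z - a * (snd z - snd zh) - (N + 1) * (norm (z - zh))\<^sup>2"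
  have zh: "zh \<in> cball zh r" using r by simp
  have "usc_on (cball zh r) (\<lambda>z. U z + (- a * (snd z - snd zh) - (N + 1) * (norm (z - zh))\<^sup>2))"
    by (intro usc_on_add U continuous_on_imp_usc_on continuous_intros)
  then have A: "usc_on (cball zh r) ?A" by (simp add: algebra_simps)
  have strict: "?A z - V z < ?A zh - V zh" if "z \<in> cball zh r" "z \<noteq> zh" for z
  proof -
    have "(norm (z - zh))\<^sup>2 > 0" using that by simp
    moreover have "(N + 1) * (norm (z - zh))\<^sup>2 = N * (norm (z - zh))\<^sup>2 + (norm (z - zh))\<^sup>2"
      by (simp add: distrib_right)
    moreover have "(N + 1) * (norm (zh - zh))\<^sup>2 = 0" "a * (snd zh - snd zh) = 0" by simp_all
    ultimately show ?thesis using max[OF that(1)] by linarith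
  qed
  obtain z y k where zX: "\<And>n::nat. z n \<in> cball zh r" and yX: "\<And>n. y n \<in> cball zh r"
    and k: "\<And>n. k n > (0::real)"
    and mx: "\<And>n z' y'. z' \<in> cball zh r \<Longrightarrow> y' \<in> cball zh r \<Longrightarrow>
        ?A z' - V y' - k n * (norm (z' - y'))\<^sup>2 \<le> ?A (z n) - V (y n) - k n * (norm (z n - y n))\<^sup>2"
    and zl: "z \<longlonglongrightarrow> zh" and yl: "y \<longlonglongrightarrow> zh" and kl: "(\<lambda>n. k n * (norm (z n - y n))\<^sup>2) \<longlonglongrightarrow> 0"
    using penalization[OF compact_cball compact_cball A V continuous_on_id zh zh] strict
    by (smt (verit))
  \<comment> \<open>\<open>p\<close> is the differential of the penalty and is shared by both test
    functions; \<open>d\<close> is the differential of the quadratic term around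
    \<open>zh\<close>.\<close>
  define p where "p n = (2 * k n) *\<^sub>R (z n - y n)" for n
  define d where "d n = ?N *\<^sub>R (z n - zh)" for n
  have fz: "fst (w::'e\<times>real) \<in> cball (fst zh) r" if "w \<in> cball zh r" for w
    using that dist_fst_le[of zh w] by auto
  \<comment> \<open>Subtracting the two jet inequalities cancels \<open>snd (p n)\<close> and leaves
    \<open>a\<close>. The change of \<open>H\<close> between the two points is at most
    \<open>C * norm (z n - y n)\<close> times \<open>C * norm (p n)\<close>, a multiple of the
    vanishing penalty.\<close>
  have le: "a \<le> (1 + C) * norm (d n) + 2 * C\<^sup>2 * (k n * (norm (z n - y n))\<^sup>2) + (G (fst (z n)) - G (fst (y n)))"
    if zb: "z n \<in> ball zh r" and yb: "y n \<in> ball zh r" for n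
  proof -
    have sU: "snd (d n + p n + (0, a)) + H (fst (z n)) (fst (d n + p n + (0, a))) \<le> G (fst (z n))"
    proof (rule jetU[OF zb, where M = "N + 1 + k n"])
      fix z' assume z': "z' \<in> cball zh r"
      have 1: "?A z' - k n * (norm (z' - y n))\<^sup>2 \<le> ?A (z n) - k n * (norm (z n - y n))\<^sup>2"
        using mx[OF z' yX[of n], of n] by simp
      have e1: "(norm (z' - y n))\<^sup>2 = (norm (z n - y n))\<^sup>2 + 2 * ((z n - y n) \<bullet> (z' - z n)) + (norm (z' - z n))\<^sup>2"
        by (simp add: power2_norm_eq_inner inner_diff_left inner_diff_right inner_commute algebra_simps)
      have e2: "(norm (z' - zh))\<^sup>2 = (norm (z n - zh))\<^sup>2 + 2 * ((z n - zh) \<bullet> (z' - z n)) + (norm (z' - z n))\<^sup>2"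
        by (simp add: power2_norm_eq_inner inner_diff_left inner_diff_right inner_commute algebra_simps)
      have e3: "(d n + p n + (0, a)) \<bullet> (z' - z n)
          = ?N * ((z n - zh) \<bullet> (z' - z n)) + 2 * k n * ((z n - y n) \<bullet> (z' - z n)) + a * (snd z' - snd (z n))"
        unfolding d_def p_def inner_add_left inner_scaleR_left by (simp add: inner_prod_def)
      show "U z' \<le> U (z n) + (d n + p n + (0, a)) \<bullet> (z' - z n) + (N + 1 + k n) * (norm (z' - z n))\<^sup>2"
        using 1 unfolding e1 e2 e3 by (simp add: algebra_simps)
    qed
    have sV: "snd (p n) + H (fst (y n)) (fst (p n)) \<ge> G (fst (y n))"
    proof (rule jetV[OF yb, where M = "k n"])
      fix y' assume y': "y' \<in> cball zh r"
      have 1: "- V y' - k n * (norm (z n - y'))\<^sup>2 \<le> - V (y n) - k n * (norm (z n - y n))\<^sup>2"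
        using mx[OF zX[of n] y', of n] by simp
      have e1: "(norm (z n - y'))\<^sup>2 = (norm (z n - y n))\<^sup>2 - 2 * ((z n - y n) \<bullet> (y' - y n)) + (norm (y' - y n))\<^sup>2"
        by (simp add: power2_norm_eq_inner inner_diff_left inner_diff_right inner_commute algebra_simps)
      have e3: "p n \<bullet> (y' - y n) = 2 * k n * ((z n - y n) \<bullet> (y' - y n))"
        unfolding p_def inner_scaleR_left ..
      show "V y' \<ge> V (y n) + p n \<bullet> (y' - y n) - k n * (norm (y' - y n))\<^sup>2"
        using 1 unfolding e1 e3 by (simp add: algebra_simps)
    qed
    note fq = fz[OF zX[of n]] fz[OF yX[of n]]
    let ?p = "fst (p n)" and ?d = "fst (d n)"
    have "norm (p n) = 2 * k n * norm (z n - y n)" using k[of n] by (simp add: p_def)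
    moreover have "norm ?p \<le> norm (p n)"
      using norm_fst_le[of "fst (p n)" "snd (p n)"] by (simp only: prod.collapse)
    ultimately have np: "norm ?p \<le> 2 * k n * norm (z n - y n)" by simp
    have nz: "norm (fst (y n) - fst (z n)) \<le> norm (z n - y n)"
      using dist_fst_le[of "y n" "z n"] by (simp add: dist_norm norm_minus_commute)
    have "H (fst (y n)) ?p \<le> (1 + C * norm (fst (y n) - fst (z n))) * H (fst (z n)) ?p"
      by (rule H2[OF fq])
    also have "\<dots> = H (fst (z n)) ?p + (C * norm (fst (y n) - fst (z n))) * H (fst (z n)) ?p"
      by (simp add: algebra_simps)
    also have "(C * norm (fst (y n) - fst (z n))) * H (fst (z n)) ?p
        \<le> (C * norm (fst (y n) - fst (z n))) * (C * norm ?p)"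
      by (rule mult_left_mono[OF H3[OF fq(1)]]) (use C in simp)
    also have "\<dots> \<le> (C * norm (z n - y n)) * (C * (2 * k n * norm (z n - y n)))"
      using C nz np by (intro mult_mono mult_left_mono) auto
    also have "\<dots> = 2 * C\<^sup>2 * (k n * (norm (z n - y n))\<^sup>2)" by (simp add: power2_eq_square)
    finally have Hy: "H (fst (y n)) ?p \<le> H (fst (z n)) ?p + 2 * C\<^sup>2 * (k n * (norm (z n - y n))\<^sup>2)" by simp
    have "H (fst (z n)) ?p \<le> H (fst (z n)) (?d + ?p) + C * norm ?d" by (rule H1[OF fq(1)])
    also have "\<dots> \<le> H (fst (z n)) (?d + ?p) + C * norm (d n)"
      using C norm_fst_le[of "fst (d n)" "snd (d n)"] by (simp add: mult_left_mono)
    finally have Hz: "H (fst (z n)) ?p \<le> H (fst (z n)) (?d + ?p) + C * norm (d n)" .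
    have "- snd (d n) \<le> norm (d n)"
      using norm_snd_le[of "snd (d n)" "fst (d n)"] by simp
    then show ?thesis using sU sV Hy Hz by (simp add: distrib_right)
  qed
  have "\<forall>\<^sub>F n in sequentially. z n \<in> ball zh r" "\<forall>\<^sub>F n in sequentially. y n \<in> ball zh r"
    using zl yl r by (auto elim!: topological_tendstoD simp del: mem_ball)
  then have ev: "\<forall>\<^sub>F n in sequentially. a \<le> (1 + C) * norm (d n)
      + 2 * C\<^sup>2 * (k n * (norm (z n - y n))\<^sup>2) + (G (fst (z n)) - G (fst (y n)))"
    by eventually_elim (rule le)
  have "d \<longlonglongrightarrow> ?N *\<^sub>R (zh - zh)" unfolding d_def by (intro tendsto_intros zl)
  moreover have "(\<lambda>n. G (fst (z n))) \<longlonglongrightarrow> G (fst zh)"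
    by (rule continuous_on_tendsto_compose[OF G tendsto_fst[OF zl]])
      (use fz[OF zh] fz[OF zX] in \<open>auto simp del: mem_cball\<close>)
  moreover have "(\<lambda>n. G (fst (y n))) \<longlonglongrightarrow> G (fst zh)"
    by (rule continuous_on_tendsto_compose[OF G tendsto_fst[OF yl]])
      (use fz[OF zh] fz[OF yX] in \<open>auto simp del: mem_cball\<close>)
  ultimately have "(\<lambda>n. (1 + C) * norm (d n) + 2 * C\<^sup>2 * (k n * (norm (z n - y n))\<^sup>2) + (G (fst (z n)) - G (fst (y n))))
      \<longlonglongrightarrow> (1 + C) * norm (?N *\<^sub>R (zh - zh)) + 2 * C\<^sup>2 * 0 + (G (fst zh) - G (fst zh))"
    by (intro tendsto_intros kl)
  from tendsto_lowerbound[OF this ev] show False using a by simp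
qed

context riem_manifold
begin

lemma interior_chart_ball:
  assumes \<Gamma>: "mboundary R \<subseteq> \<Gamma>" "closed \<Gamma>" and x: "x \<notin> \<Gamma>" and c: "c \<in> charts R" "x \<in> chart_dom c" and e: "e > 0"
  obtains r m \<Lambda> where "r > 0" "r \<le> e" "m > 0" "\<Lambda> > 0" "cball (chart_map c x) r \<subseteq> interior (chart_image c)"
    "\<And>q. q \<in> cball (chart_map c x) r \<Longrightarrow> chart_inv c q \<notin> \<Gamma>"
    "\<And>q v. q \<in> cball (chart_map c x) r \<Longrightarrow> m * norm v \<le> sqrt (metric R c (chart_inv c q) v v)"
    "\<And>q v. q \<in> cball (chart_map c x) r \<Longrightarrow> sqrt (metric R c (chart_inv c q) v v) \<le> \<Lambda> * norm v"
    "\<And>q q' v. q \<in> cball (chart_map c x) r \<Longrightarrow> q' \<in> cball (chart_map c x) r \<Longrightarrow>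
       sqrt (metric R c (chart_inv c q') v v)
         \<le> (1 + \<Lambda> * norm (q - q')) * sqrt (metric R c (chart_inv c q) v v)"
proof -
  let ?I = "interior (chart_image c)"
  let ?p = "chart_map c x"
  have pI: "?p \<in> ?I" using interior_chart[OF _ c] x \<Gamma> by blast
  obtain r0 m \<Lambda> where r0: "r0 > 0" "m > 0" "\<Lambda> > 0" "cball ?p r0 \<subseteq> ?I"
    and b: "\<And>q v. q \<in> cball ?p r0 \<Longrightarrow> m * norm v \<le> sqrt (metric R c (chart_inv c q) v v)"
    "\<And>q v. q \<in> cball ?p r0 \<Longrightarrow> sqrt (metric R c (chart_inv c q) v v) \<le> \<Lambda> * norm v"
    "\<And>q q' v. q \<in> cball ?p r0 \<Longrightarrow> q' \<in> cball ?p r0 \<Longrightarrow>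
       sqrt (metric R c (chart_inv c q') v v)
         \<le> (1 + \<Lambda> * norm (q - q')) * sqrt (metric R c (chart_inv c q) v v)"
    by (rule metric_bounds[OF c(1) pI]) (rule that)
  have "continuous_on ?I (chart_inv c)"
    by (rule continuous_on_subset[OF continuous_on_chart_inv[OF c(1)] interior_subset])
  then have "open (?I \<inter> chart_inv c -` (- \<Gamma>))"
    using \<Gamma> by (intro continuous_open_preimage) auto
  moreover have "?p \<in> ?I \<inter> chart_inv c -` (- \<Gamma>)" using pI x chart_inv_map[OF c] by simp
  ultimately obtain r1 where r1: "r1 > 0" "cball ?p r1 \<subseteq> ?I \<inter> chart_inv c -` (- \<Gamma>)"
    using open_contains_cball by blast
  define r where "r = min (min r0 r1) e"
  have r: "r > 0" "r \<le> e" "r \<le> r0" "r \<le> r1" using r0 r1 e by (auto simp: r_def)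
  have s: "cball ?p r \<subseteq> cball ?p r0" "cball ?p r \<subseteq> cball ?p r1" using r by (auto intro: subset_cball)
  show thesis
  proof (rule that[OF r(1,2) r0(2,3)])
    show "cball ?p r \<subseteq> ?I" using s r0 by blast
    show "chart_inv c q \<notin> \<Gamma>" if "q \<in> cball ?p r" for q using that s r1 by blast
  qed (use b subsetD[OF s(1)] in \<open>simp_all del: mem_cball\<close>)
qed

text \<open>Semicontinuity on \<open>[0, T[\<close> gives no control as \<open>t\<close> tends to
  \<open>T\<close>. The term \<open>\<sigma> / (T1 - t)\<close> keeps the maximum away from
  \<open>T1 < T\<close>, and its positive time derivative is the strict gain that the doubling
  requires.\<close>

theorem comparison:
  assumes \<Gamma>: "mboundary R \<subseteq> \<Gamma>" "closed \<Gamma>" and cpt: "compact (UNIV :: 'm set)"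
    and P: "continuous_on (- \<Gamma>) P"
    and u: "usc_on (cylinder T) u" "prox_sub \<Gamma> P T u"
    and v: "lsc_on (cylinder T) v" "prox_super \<Gamma> P T v"
    and bd: "\<And>x t. (x, t) \<in> parabolic_boundary \<Gamma> T \<Longrightarrow> u (x, t) \<le> v (x, t)"
    and z1: "z1 \<in> cylinder T"
  shows "u z1 \<le> v z1"
proof (rule ccontr)
  assume "\<not> u z1 \<le> v z1"
  then have pos: "u z1 - v z1 > 0" by simp
  define t1 where "t1 = snd z1"
  have t1: "0 \<le> t1" "t1 < T" using z1 by (auto simp: cylinder_def t1_def)
  define T1 where "T1 = (t1 + T) / 2"
  have T1: "t1 < T1" "T1 < T" using t1 by (auto simp: T1_def)
  \<comment> \<open>The barrier at \<open>z1\<close> then takes exactly half of the supposed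
    excess.\<close>
  define \<sigma> where "\<sigma> = (u z1 - v z1) * (T1 - t1) / 2"
  have \<sigma>: "\<sigma> > 0" using pos T1 by (simp add: \<sigma>_def)
  let ?w = "\<lambda>z. u z - v z - \<sigma> / (T1 - snd z)"
  have "\<sigma> / (T1 - t1) = (u z1 - v z1) / 2" 
    using T1 by (simp add: \<sigma>_def nonzero_eq_divide_eq nonzero_divide_eq_eq)
  then have w1: "?w z1 > 0" using pos by (simp add: t1_def field_simps)
  have usc: "usc_on (UNIV \<times> {0..s}) (\<lambda>z. u z + - v z)" if "s < T" for s
    using that by (intro usc_on_add usc_on_subset[OF u(1)]
        usc_on_subset[OF v(1)[unfolded lsc_on_iff_usc_on]]) (auto simp: cylinder_def)
  have cK: "compact ((UNIV :: 'm set) \<times> {0..s::real})" for s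
    using cpt by (intro compact_Times) auto
  have z1K: "z1 \<in> UNIV \<times> {0..T1}" using t1 T1 by (auto simp: t1_def mem_Times_iff)
  obtain zM where zM: "zM \<in> UNIV \<times> {0..T1}" "\<And>z. z \<in> UNIV \<times> {0..T1} \<Longrightarrow> u z - v z \<le> u zM - v zM"
    using usc_attains_max[OF cK, of T1 "\<lambda>z. u z - v z"] usc[OF T1(2)] z1K
    unfolding diff_conv_add_uminus by blast
  define M where "M = u zM - v zM"
  have M1: "u z1 - v z1 \<le> M" unfolding M_def by (rule zM(2)[OF z1K])
  then have M: "M > 0" using pos by simp
  \<comment> \<open>After \<open>T2\<close> the barrier is at least \<open>M\<close>, the maximum of
    \<open>u - v\<close> up to \<open>T1\<close>, so the maximum over \<open>[0, T1[\<close> is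
    found in the compact cylinder up to \<open>T2\<close>.\<close>
  define T2 where "T2 = T1 - \<sigma> / M"
  have T2: "T2 < T1" using \<sigma> M by (simp add: T2_def)
  have "\<sigma> / (T1 - t1) < M" using w1 M1 by (simp add: t1_def)
  then have "t1 < T2" using M T1 by (simp add: T2_def field_simps)
  then have z1K2: "z1 \<in> UNIV \<times> {0..T2}" using t1 by (auto simp: t1_def mem_Times_iff)
  have "usc_on (UNIV \<times> {0..T2}) (\<lambda>z. (u z + - v z) + - (\<sigma> / (T1 - snd z)))"
    using T2 T1 by (intro usc_on_add[OF usc] continuous_on_imp_usc_on continuous_intros) auto
  then have "usc_on (UNIV \<times> {0..T2}) ?w" by simp
  then obtain zh where zh: "zh \<in> UNIV \<times> {0..T2}" "\<And>z. z \<in> UNIV \<times> {0..T2} \<Longrightarrow> ?w z \<le> ?w zh"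
    using usc_attains_max[OF cK, of T2 ?w] z1K2 by blast
  have wh: "?w zh > 0" using zh(2)[OF z1K2] w1 by simp
  define xh th where "xh = fst zh" and "th = snd zh"
  have zeq: "zh = (xh, th)" by (simp add: xh_def th_def)
  have th: "0 \<le> th" "th < T1" using zh(1) T2 by (auto simp: th_def)
  have mx: "?w z \<le> ?w zh" if z: "0 \<le> snd z" "snd z < T1" for z
  proof (cases "snd z \<le> T2")
    case True
    then show ?thesis using zh(2)[of z] z by (simp add: mem_Times_iff)
  next
    case False
    then have "T1 - snd z \<le> \<sigma> / M" by (simp add: T2_def)
    then have "M \<le> \<sigma> / (T1 - snd z)" using z M by (simp add: field_simps)
    moreover have "u z - v z \<le> M" unfolding M_def using z by (intro zM(2)) (simp add: mem_Times_iff)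
    ultimately show ?thesis using wh by linarith
  qed
  have "\<sigma> / (T1 - th) > 0" using \<sigma> th by simp
  then have uvh: "v zh < u zh" using wh by (simp add: th_def)
  then have "(xh, th) \<notin> parabolic_boundary \<Gamma> T" using bd[of xh th] unfolding zeq by fastforce
  then have th0: "th > 0" and xh: "xh \<notin> \<Gamma>"
    using th T1 by (cases "th = 0"; auto simp: parabolic_boundary_def)+

  let ?c = "chart_at R xh"
  note c = chart_at[of xh]
  \<comment> \<open>The bound on \<open>r\<close> keeps the times in the ball positive and at
    distance at least \<open>r\<close> from \<open>T1\<close>.\<close>
  obtain r m \<Lambda> where r: "r > 0" "r \<le> min (th / 2) ((T1 - th) / 2)" and m: "m > 0" and \<Lambda>: "\<Lambda> > 0"
    and rI: "cball (chart_map ?c xh) r \<subseteq> interior (chart_image ?c)"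
    and rG: "\<And>q. q \<in> cball (chart_map ?c xh) r \<Longrightarrow> chart_inv ?c q \<notin> \<Gamma>"
    and b1: "\<And>q v. q \<in> cball (chart_map ?c xh) r \<Longrightarrow> m * norm v \<le> sqrt (metric R ?c (chart_inv ?c q) v v)"
    and b3: "\<And>q q' v. q \<in> cball (chart_map ?c xh) r \<Longrightarrow> q' \<in> cball (chart_map ?c xh) r \<Longrightarrow>
       sqrt (metric R ?c (chart_inv ?c q') v v)
         \<le> (1 + \<Lambda> * norm (q - q')) * sqrt (metric R ?c (chart_inv ?c q) v v)"
    by (rule interior_chart_ball[OF \<Gamma> xh c, of "min (th / 2) ((T1 - th) / 2)"])
      (use th0 th that in auto)
  define Zh where "Zh = (chart_map ?c xh, th)"
  let ?e = "\<lambda>z::'e\<times>real. (chart_inv ?c (fst z), snd z)"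
  have fB: "fst z \<in> cball (chart_map ?c xh) r" and tB: "\<bar>snd z - th\<bar> \<le> r" if "z \<in> cball Zh r" for z
    using that dist_fst_le[of Zh z] dist_snd_le[of Zh z] by (auto simp: Zh_def dist_real_def abs_minus_commute)
  have tB': "th / 2 \<le> snd z" "r \<le> T1 - snd z" "snd z < T" "snd z < T1" if "z \<in> cball Zh r" for z
    using tB[OF that] r th0 T1 by auto
  have im: "q \<in> chart_image ?c" if "q \<in> cball (chart_map ?c xh) r" for q
    using that rI interior_subset by blast
  have conte: "continuous_on (cball Zh r) ?e"
    by (intro continuous_intros continuous_on_compose2[OF continuous_on_chart_inv[OF c(1)]])
      (use im fB in \<open>auto simp del: mem_cball\<close>)
  have eC: "?e ` cball Zh r \<subseteq> cylinder T" using tB' th0 by (force simp: cylinder_def)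
  let ?g = "\<lambda>q. metric R ?c (chart_inv ?c q)"
  have ig: "inner_form (?g q)" if "q \<in> cball (chart_map ?c xh) r" for q
    by (rule metric_inner_form[OF c(1) chart_inv_dom[OF im[OF that]]])
  define C where "C = max (1 / m) \<Lambda>"
  have C: "1 / m \<le> C" "\<Lambda> \<le> C" "C \<ge> 0" using m \<Lambda> by (auto simp: C_def)
  have eZh: "?e Zh = zh" using chart_inv_map[OF c] by (simp add: Zh_def zeq)
  \<comment> \<open>\<open>a\<close> is the derivative of the barrier at \<open>th\<close>;
    \<open>N\<close> bounds its exact second-order remainder by means of
    \<open>T1 - t \<ge> r\<close>.\<close>
  define a where "a = \<sigma> / (T1 - th)\<^sup>2"
  define N where "N = \<sigma> / (r * (T1 - th)\<^sup>2)"
  show False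
  proof (rule local_doubling[of r a C Zh "\<lambda>z. u (?e z)" "\<lambda>z. v (?e z)" N
        "\<lambda>q. dual_norm (?g q)" "\<lambda>q. P (chart_inv ?c q)"])
    show "r > 0" by fact
    show "a > 0" using \<sigma> th by (simp add: a_def)
    show "C \<ge> 0" by fact
    show "usc_on (cball Zh r) (\<lambda>z. u (?e z))" by (rule usc_on_compose[OF u(1) conte eC])
    show "lsc_on (cball Zh r) (\<lambda>z. v (?e z))" by (rule lsc_on_compose[OF v(1) conte eC])
  next
    fix z assume z: "z \<in> cball Zh r"
    let ?t = "snd z"
    have 1: "u (?e z) - v (?e z) \<le> u zh - v zh + (\<sigma> / (T1 - ?t) - \<sigma> / (T1 - th))"
      using mx[of "?e z"] tB'[OF z] th0 by (simp add: th_def)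
    have d: "T1 - ?t > 0" "T1 - th > 0" using tB'[OF z] th by auto
    have "\<sigma> / (T1 - ?t) - \<sigma> / (T1 - th) = a * (?t - th) + \<sigma> * (?t - th)\<^sup>2 / ((T1 - ?t) * (T1 - th)\<^sup>2)"
      using d unfolding a_def by (simp add: divide_simps power2_eq_square) (simp add: algebra_simps)
    also have "\<sigma> * (?t - th)\<^sup>2 / ((T1 - ?t) * (T1 - th)\<^sup>2) \<le> \<sigma> * (?t - th)\<^sup>2 / (r * (T1 - th)\<^sup>2)"
      using d r \<sigma> tB'(2)[OF z] by (intro divide_left_mono mult_right_mono) auto
    also have "\<dots> = N * (?t - th)\<^sup>2" by (simp add: N_def)
    also have "\<dots> \<le> N * (norm (z - Zh))\<^sup>2"
    proof (rule mult_left_mono)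
      have "\<bar>?t - th\<bar> \<le> norm (z - Zh)"
        using dist_snd_le[of z Zh] by (simp add: Zh_def dist_norm)
      then show "(?t - th)\<^sup>2 \<le> (norm (z - Zh))\<^sup>2" by (metis abs_ge_zero power2_abs power_mono)
      show "N \<ge> 0" using \<sigma> r by (simp add: N_def)
    qed
    finally show "u (?e z) - v (?e z) \<le> u (?e Zh) - v (?e Zh) + a * (snd z - snd Zh) + N * (norm (z - Zh))\<^sup>2"
      using 1 unfolding eZh by (simp add: Zh_def)
  next
    fix z p K assume z: "z \<in> ball Zh r"
      and le: "\<And>z'. z' \<in> cball Zh r \<Longrightarrow> u (?e z') \<le> u (?e z) + p \<bullet> (z' - z) + K * (norm (z' - z))\<^sup>2"
    then have zc: "z \<in> cball Zh r" by simp
    have tz: "0 < snd z" "snd z < T" using tB'[OF zc] th0 by auto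
    show "snd p + dual_norm (?g (fst z)) (fst p) \<le> P (chart_inv ?c (fst z))"
      by (rule prox_sub_chart[OF u(2) c(1) z im[OF fB[OF zc]] rG[OF fB[OF zc]] tz le])
  next
    fix z p K assume z: "z \<in> ball Zh r"
      and le: "\<And>z'. z' \<in> cball Zh r \<Longrightarrow> v (?e z') \<ge> v (?e z) + p \<bullet> (z' - z) - K * (norm (z' - z))\<^sup>2"
    then have zc: "z \<in> cball Zh r" by simp
    have tz: "0 < snd z" "snd z < T" using tB'[OF zc] th0 by auto
    show "snd p + dual_norm (?g (fst z)) (fst p) \<ge> P (chart_inv ?c (fst z))"
      by (rule prox_super_chart[OF v(2) c(1) z im[OF fB[OF zc]] rG[OF fB[OF zc]] tz le])
  next
    fix q p d assume "q \<in> cball (fst Zh) r"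
    then have q: "q \<in> cball (chart_map ?c xh) r" by (simp add: Zh_def)
    have "dual_norm (?g q) p \<le> dual_norm (?g q) (d + p) + dual_norm (?g q) (- d)"
      using dual_norm_add_le[OF ig[OF q], of "d + p" "- d"] by simp
    also have "dual_norm (?g q) (- d) \<le> norm (- d) / m"
      by (rule dual_norm_le_norm[OF ig[OF q] m b1[OF q]])
    also have "\<dots> \<le> C * norm d" using C(1) mult_right_mono[OF C(1), of "norm d"] by simp
    finally show "dual_norm (?g q) p \<le> dual_norm (?g q) (d + p) + C * norm d" by simp
  next
    fix q q' p assume "q \<in> cball (fst Zh) r" "q' \<in> cball (fst Zh) r"
    then have q: "q \<in> cball (chart_map ?c xh) r" "q' \<in> cball (chart_map ?c xh) r" by (simp_all add: Zh_def)
    have "dual_norm (?g q') p \<le> (1 + \<Lambda> * norm (q' - q)) * dual_norm (?g q) p"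
      by (rule dual_norm_mono[OF ig[OF q(2)] ig[OF q(1)] _ b3[OF q(2) q(1)]]) (use \<Lambda> in simp)
    also have "\<dots> \<le> (1 + C * norm (q' - q)) * dual_norm (?g q) p"
      using C(2) dual_norm_nonneg[OF ig[OF q(1)]] by (intro mult_right_mono add_left_mono) auto
    finally show "dual_norm (?g q') p \<le> (1 + C * norm (q' - q)) * dual_norm (?g q) p" .
  next
    fix q p assume "q \<in> cball (fst Zh) r"
    then have q: "q \<in> cball (chart_map ?c xh) r" by (simp add: Zh_def)
    have "dual_norm (?g q) p \<le> norm p / m" by (rule dual_norm_le_norm[OF ig[OF q] m b1[OF q]])
    also have "\<dots> \<le> C * norm p" using mult_right_mono[OF C(1), of "norm p"] by simp
    finally show "dual_norm (?g q) p \<le> C * norm p" .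
  next
    have "continuous_on (cball (chart_map ?c xh) r) (chart_inv ?c)"
      by (rule continuous_on_subset[OF continuous_on_chart_inv[OF c(1)]]) (use im in blast)
    then have "continuous_on (cball (chart_map ?c xh) r) (\<lambda>q. P (chart_inv ?c q))"
      by (rule continuous_on_compose2[OF P]) (use rG in \<open>auto simp del: mem_cball\<close>)
    then show "continuous_on (cball (fst Zh) r) (\<lambda>q. P (chart_inv ?c q))" by (simp add: Zh_def)
  qed
qed

end

section \<open>Barriers and time translates\<close>

lemma lip_const_nonneg: "h \<in> Lip d A \<Longrightarrow> lip_const d A h \<ge> 0"
  unfolding lip_const_def Lip_def by (rule cInf_greatest) auto

text \<open>The infimum is itself a Lipschitz constant: for \<open>d x y > 0\<close> the difference
  quotient is a lower bound of the set, and for \<open>d x y = 0\<close> any element of the set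
  forces equal values.\<close>

lemma lip_const_bound:
  assumes h: "h \<in> Lip d A" and xy: "x \<in> A" "y \<in> A" and d: "d x y \<ge> 0"
  shows "\<bar>h x - h y\<bar> \<le> lip_const d A h * d x y"
proof -
  let ?S = "{L. L \<ge> 0 \<and> (\<forall>x\<in>A. \<forall>y\<in>A. \<bar>h x - h y\<bar> \<le> L * d x y)}"
  have ne: "?S \<noteq> {}" using h unfolding Lip_def by blast
  show ?thesis
  proof (cases "d x y = 0")
    case True
    obtain L where "L \<in> ?S" using ne by blast
    then have "\<bar>h x - h y\<bar> \<le> L * d x y" using xy by blast
    then show ?thesis using True by simp
  next
    case False
    then have pos: "d x y > 0" using d by simp
    have "\<bar>h x - h y\<bar> / d x y \<le> Inf ?S"
    proof (rule cInf_greatest[OF ne])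
      fix L assume "L \<in> ?S"
      then have "\<bar>h x - h y\<bar> \<le> L * d x y" using xy by blast
      then show "\<bar>h x - h y\<bar> / d x y \<le> L" using pos by (simp add: pos_divide_le_eq)
    qed
    then show ?thesis using pos unfolding lip_const_def by (simp add: pos_divide_le_eq)
  qed
qed

lemma lip_const_le:
  assumes "C \<ge> 0" "\<And>x y. x \<in> A \<Longrightarrow> y \<in> A \<Longrightarrow> \<bar>h x - h y\<bar> \<le> C * d x y"
  shows "lip_const d A h \<le> C"
  unfolding lip_const_def by (rule cInf_lower) (use assms in \<open>auto intro: bdd_belowI[of _ 0]\<close>)

text \<open>Local boundedness makes both limits finite, so \<open>real_of_ereal\<close>, which sends
  infinite values to 0, loses nothing. The neighbourhoods contain \<open>p\<close> itself, whence
  the inequalities.\<close>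

lemma envelope_bounds:
  assumes f: "locally_bounded_on S f" and p: "p \<in> S"
  shows "lsc_envelope S f p \<le> f p" and "f p \<le> usc_envelope S f p"
proof -
  let ?F = "inf (nhds p) (principal S)"
  obtain W B where W: "open W" "p \<in> W" "\<forall>q\<in>W \<inter> S. \<bar>f q\<bar> \<le> B"
    using f p unfolding locally_bounded_on_def by blast
  have ev: "\<forall>\<^sub>F q in ?F. \<bar>f q\<bar> \<le> B"
    unfolding eventually_inf_principal using eventually_nhds_in_open[OF W(1,2)]
    by eventually_elim (use W(3) in blast)
  have at: "Q p" if "eventually Q ?F" for Q
    using that p unfolding eventually_inf_principal by (blast dest: eventually_nhds_x_imp_x)
  have "Limsup ?F (\<lambda>q. ereal (f q)) \<le> ereal B"
    by (rule Limsup_bounded) (use ev in \<open>auto elim!: eventually_mono\<close>)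
  moreover have le: "ereal (f p) \<le> Limsup ?F (\<lambda>q. ereal (f q))"
    unfolding Limsup_def le_INF_iff by (auto dest!: at intro!: SUP_upper)
  ultimately have "\<bar>Limsup ?F (\<lambda>q. ereal (f q))\<bar> \<noteq> \<infinity>" by auto
  with le show "f p \<le> usc_envelope S f p"
    unfolding usc_envelope_def by (cases "Limsup ?F (\<lambda>q. ereal (f q))") auto
  have "Liminf ?F (\<lambda>q. ereal (f q)) \<ge> ereal (- B)"
    by (rule Liminf_bounded) (use ev in \<open>auto elim!: eventually_mono\<close>)
  moreover have le: "Liminf ?F (\<lambda>q. ereal (f q)) \<le> ereal (f p)"
    unfolding Liminf_def SUP_le_iff by (auto dest!: at intro!: INF_lower)
  ultimately have "\<bar>Liminf ?F (\<lambda>q. ereal (f q))\<bar> \<noteq> \<infinity>" by auto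
  with le show "lsc_envelope S f p \<le> f p"
    unfolding lsc_envelope_def by (cases "Liminf ?F (\<lambda>q. ereal (f q))") auto
qed

text \<open>The difference of the two sides has a local minimum at \<open>t\<close> with derivative
  \<open>b\<close>. This pins the time slope of a jet that touches a function affine in
  time.\<close>

lemma linear_ge_quadratic_imp_zero:
  fixes b N t :: real
  assumes "\<forall>\<^sub>F s in nhds t. b * (s - t) \<ge> N * (s - t)\<^sup>2"
  shows "b = 0"
proof -
  let ?g = "\<lambda>s. b * (s - t) - N * (s - t)\<^sup>2"
  obtain d where d: "d > 0" "\<And>s. dist s t < d \<Longrightarrow> b * (s - t) \<ge> N * (s - t)\<^sup>2"
    using assms unfolding eventually_nhds_metric by blast
  have "DERIV ?g t :> b" by (auto intro!: derivative_eq_intros)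
  then show ?thesis
  proof (rule DERIV_local_min[OF _ d(1)])
    show "\<forall>y. \<bar>t - y\<bar> < d \<longrightarrow> ?g t \<le> ?g y" using d(2) by (auto simp: dist_real_def abs_minus_commute)
  qed
qed

context riem_manifold
begin

text \<open>\<open>Lip\<close> refers to \<open>rdist\<close>, continuity to the topology of the
  type. In a chart ball off \<open>\<Gamma>\<close>, coordinate segments bound \<open>rdist\<close>
  by \<open>\<Lambda>\<close> times the coordinate distance.\<close>

lemma Lip_continuous_on:
  assumes \<Gamma>: "mboundary R \<subseteq> \<Gamma>" "closed \<Gamma>" and P: "P \<in> Lip (rdist R) (- \<Gamma>)"
  shows "continuous_on (- \<Gamma>) P"
  unfolding continuous_on_def
proof
  fix x assume "x \<in> - \<Gamma>"
  then have x: "x \<notin> \<Gamma>" by simp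
  obtain L where L: "L \<ge> 0" "\<And>y z. y \<in> - \<Gamma> \<Longrightarrow> z \<in> - \<Gamma> \<Longrightarrow> \<bar>P y - P z\<bar> \<le> L * rdist R y z"
    using P unfolding Lip_def by blast
  let ?c = "chart_at R x"
  note c = chart_at[of x]
  obtain r m \<Lambda> where r: "r > 0" and \<Lambda>: "\<Lambda> > 0"
    and rI: "cball (chart_map ?c x) r \<subseteq> interior (chart_image ?c)"
    and b2: "\<And>q v. q \<in> cball (chart_map ?c x) r \<Longrightarrow> sqrt (metric R ?c (chart_inv ?c q) v v) \<le> \<Lambda> * norm v"
    by (rule interior_chart_ball[OF \<Gamma> x c zero_less_one]) (use that in blast)
  have isC: "(chart_map ?c \<longlongrightarrow> chart_map ?c x) (at x within - \<Gamma>)"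
    using continuous_on_chart[OF c(1)] chart_open[OF c(1)] c(2)
    by (auto simp: continuous_on_eq_continuous_at isCont_def intro: tendsto_within_subset)
  have "\<forall>\<^sub>F y in nhds x. y \<in> chart_dom ?c" by (rule eventually_nhds_in_open[OF chart_open[OF c(1)] c(2)])
  then have dom: "\<forall>\<^sub>F y in at x within - \<Gamma>. y \<in> chart_dom ?c"
    unfolding eventually_at_filter by (auto elim: eventually_mono)
  have inG: "\<forall>\<^sub>F y in at x within - \<Gamma>. y \<in> - \<Gamma>" by (simp add: eventually_at_filter)
  have "\<forall>\<^sub>F y in at x within - \<Gamma>. dist (chart_map ?c y) (chart_map ?c x) < r"
    using isC r by (rule tendstoD)
  then have ev: "\<forall>\<^sub>F y in at x within - \<Gamma>. norm (P y - P x) \<le> L * (\<Lambda> * norm (chart_map ?c x - chart_map ?c y))"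
    using dom inG
  proof eventually_elim
    case (elim y)
    have "rdist R (chart_inv ?c (chart_map ?c y)) (chart_inv ?c (chart_map ?c x)) \<le> \<Lambda> * norm (chart_map ?c x - chart_map ?c y)"
      by (rule rdist_segment_le[OF c(1) convex_cball])
        (use elim r rI interior_subset b2 in \<open>auto simp: dist_commute\<close>)
    then have "rdist R y x \<le> \<Lambda> * norm (chart_map ?c x - chart_map ?c y)"
      using chart_inv_map[OF c(1)] c elim by simp
    then have "L * rdist R y x \<le> L * (\<Lambda> * norm (chart_map ?c x - chart_map ?c y))"
      using L(1) by (rule mult_left_mono)
    moreover have "\<bar>P y - P x\<bar> \<le> L * rdist R y x" using L(2)[of y x] elim x by simp
    ultimately show ?case by simp
  qed
  have "((\<lambda>y. L * (\<Lambda> * norm (chart_map ?c x - chart_map ?c y))) \<longlongrightarrow> L * (\<Lambda> * norm (chart_map ?c x - chart_map ?c x))) (at x within - \<Gamma>)"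
    by (intro tendsto_intros isC)
  then have "((\<lambda>y. L * (\<Lambda> * norm (chart_map ?c x - chart_map ?c y))) \<longlongrightarrow> 0) (at x within - \<Gamma>)" by simp
  then have "((\<lambda>y. P y - P x) \<longlongrightarrow> 0) (at x within - \<Gamma>)" by (rule Lim_null_comparison[OF ev])
  then show "(P \<longlongrightarrow> P x) (at x within - \<Gamma>)" by (rule LIM_zero_cancel)
qed

text \<open>\<open>A\<close> need not be compact. The whole manifold is covered by finitely many
  sets of bounded \<open>rdist\<close>, and in each of them \<open>P\<close> is compared with its
  value at one point of \<open>A\<close>.\<close>

lemma Lip_bounded:
  assumes cpt: "compact (UNIV :: 'm set)" and P: "P \<in> Lip (rdist R) A"
  obtains B where "\<And>x. x \<in> A \<Longrightarrow> \<bar>P x\<bar> \<le> B"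
proof -
  obtain L where L: "L \<ge> 0" "\<And>y z. y \<in> A \<Longrightarrow> z \<in> A \<Longrightarrow> \<bar>P y - P z\<bar> \<le> L * rdist R y z"
    using P unfolding Lip_def by blast
  have "\<exists>Ub. open (fst Ub) \<and> x \<in> fst Ub \<and> (\<forall>z\<in>fst Ub \<inter> A. \<bar>P z\<bar> \<le> snd Ub)" for x
  proof -
    obtain U B where U: "open U" "x \<in> U" "\<And>y z. y \<in> U \<Longrightarrow> z \<in> U \<Longrightarrow> rdist R y z \<le> B"
      by (rule rdist_locally_bounded[of x]) (rule that)
    show ?thesis
    proof (cases "U \<inter> A = {}")
      case True
      then show ?thesis using U by (intro exI[of _ "(U, 0)"]) auto
    next
      case False
      then obtain y where y: "y \<in> U" "y \<in> A" by blast
      have "\<bar>P z\<bar> \<le> \<bar>P y\<bar> + L * B" if z: "z \<in> U \<inter> A" for z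
      proof -
        have "\<bar>P z - P y\<bar> \<le> L * rdist R z y" using L(2) z y by blast
        also have "\<dots> \<le> L * B" using U(3)[of z y] z y L(1) by (intro mult_left_mono) auto
        finally show ?thesis by linarith
      qed
      then show ?thesis using U by (intro exI[of _ "(U, \<bar>P y\<bar> + L * B)"]) auto
    qed
  qed
  then have "\<forall>x. \<exists>Ub. open (fst Ub) \<and> x \<in> fst Ub \<and> (\<forall>z\<in>fst Ub \<inter> A. \<bar>P z\<bar> \<le> snd Ub)" by blast
  from choice[OF this] obtain h where h: "\<And>x. open (fst (h x)) \<and> x \<in> fst (h x) \<and> (\<forall>z\<in>fst (h x) \<inter> A. \<bar>P z\<bar> \<le> snd (h x))"
    by blast
  obtain D where D: "finite D" "UNIV \<subseteq> (\<Union>x\<in>D. fst (h x))"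
    by (rule compactE_image[OF cpt, of UNIV "\<lambda>x. fst (h x)"]) (use h that in auto)
  have "\<bar>P z\<bar> \<le> (\<Sum>x\<in>D. \<bar>snd (h x)\<bar>)" if z: "z \<in> A" for z
  proof -
    obtain x where x: "x \<in> D" "z \<in> fst (h x)" using D by auto
    have "\<bar>P z\<bar> \<le> snd (h x)" using h x z by blast
    also have "\<dots> \<le> \<bar>snd (h x)\<bar>" by simp
    also have "\<dots> \<le> (\<Sum>x\<in>D. \<bar>snd (h x)\<bar>)" using D x by (intro member_le_sum) auto
    finally show ?thesis .
  qed
  then show thesis by (rule that)
qed

text \<open>Jets are tested on full neighbourhoods, but at times in \<open>]0, T[\<close>, where
  these can be shrunk into the cylinder. This lets \<open>f\<close> replace its envelope.\<close>

lemma prox_sub_cong: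
  assumes "prox_sub \<Gamma> P T u" and eq: "\<And>z. z \<in> cylinder T \<Longrightarrow> u z = u' z"
  shows "prox_sub \<Gamma> P T u'"
  unfolding prox_sub_def
proof (intro allI impI, elim conjE)
  fix c x t p a N
  assume c: "c \<in> charts R" "x \<in> chart_dom c" and x: "x \<notin> \<Gamma>" and t: "0 < t" "t < T"
    and ev: "\<forall>\<^sub>F z in nhds (x, t). u' z \<le> u' (x, t) + jet c x t p a N z"
  have "\<forall>\<^sub>F z in nhds (x, t). z \<in> UNIV \<times> {0<..<T}"
    using t by (intro eventually_nhds_in_open open_Times) auto
  with ev have "\<forall>\<^sub>F z in nhds (x, t). u z \<le> u (x, t) + jet c x t p a N z"
  proof eventually_elim
    case (elim z)
    then have "z \<in> cylinder T" "(x, t) \<in> cylinder T" using t by (auto simp: cylinder_def)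
    then show ?case using elim eq by simp
  qed
  then show "a + dual_norm (metric R c x) p \<le> P x"
    using assms(1) c x t unfolding prox_sub_def by blast
qed

lemma prox_super_cong:
  assumes "prox_super \<Gamma> P T u" and eq: "\<And>z. z \<in> cylinder T \<Longrightarrow> u z = u' z"
  shows "prox_super \<Gamma> P T u'"
  unfolding prox_super_def
proof (intro allI impI, elim conjE)
  fix c x t p a N
  assume c: "c \<in> charts R" "x \<in> chart_dom c" and x: "x \<notin> \<Gamma>" and t: "0 < t" "t < T"
    and ev: "\<forall>\<^sub>F z in nhds (x, t). u' z \<ge> u' (x, t) + jet c x t p a N z"
  have "\<forall>\<^sub>F z in nhds (x, t). z \<in> UNIV \<times> {0<..<T}"
    using t by (intro eventually_nhds_in_open open_Times) auto
  with ev have "\<forall>\<^sub>F z in nhds (x, t). u z \<ge> u (x, t) + jet c x t p a N z"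
  proof eventually_elim
    case (elim z)
    then have "z \<in> cylinder T" "(x, t) \<in> cylinder T" using t by (auto simp: cylinder_def)
    then show ?case using elim eq by simp
  qed
  then show "a + dual_norm (metric R c x) p \<ge> P x"
    using assms(1) c x t unfolding prox_super_def by blast
qed

lemma filterlim_time_shift:
  fixes t h :: real
  shows "filterlim (\<lambda>z. (fst z, snd z - h)) (nhds (x, t)) (nhds (x :: 'm, t + h))"
proof -
  have "isCont (\<lambda>z::'m\<times>real. (fst z, snd z - h)) (x, t + h)" by (intro continuous_intros)
  from this[unfolded isCont_def, THEN tendsto_at_iff_tendsto_nhds[THEN iffD1]] show ?thesis by simp
qed

text \<open>The equation is autonomous and insensitive to additive constants, so jets move along
  with the translate as long as \<open>t + h < T\<close>.\<close>

lemma prox_sub_shift: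
  assumes u: "prox_sub \<Gamma> P T u" and h: "h \<ge> 0"
  shows "prox_sub \<Gamma> P (T - h) (\<lambda>z. u (fst z, snd z + h) - k)"
  unfolding prox_sub_def
proof (intro allI impI, elim conjE)
  fix c x t p a N
  assume c: "c \<in> charts R" "x \<in> chart_dom c" and x: "x \<notin> \<Gamma>" and t: "0 < t" "t < T - h"
    and ev: "\<forall>\<^sub>F z in nhds (x, t). u (fst z, snd z + h) - k \<le> u (fst (x, t), snd (x, t) + h) - k + jet c x t p a N z"
  have "\<forall>\<^sub>F z in nhds (x, t + h). u (fst z, snd z) \<le> u (x, t + h) + jet c x (t + h) p a N z"
    using eventually_compose_filterlim[OF ev filterlim_time_shift]
    by eventually_elim (simp add: jet_def algebra_simps)
  then have "\<forall>\<^sub>F z in nhds (x, t + h). u z \<le> u (x, t + h) + jet c x (t + h) p a N z" by simp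
  moreover have "0 < t + h" "t + h < T" using t h by auto
  ultimately show "a + dual_norm (metric R c x) p \<le> P x"
    using u c x unfolding prox_sub_def by blast
qed

lemma prox_super_shift:
  assumes u: "prox_super \<Gamma> P T u" and h: "h \<ge> 0"
  shows "prox_super \<Gamma> P (T - h) (\<lambda>z. u (fst z, snd z + h) + k)"
  unfolding prox_super_def
proof (intro allI impI, elim conjE)
  fix c x t p a N
  assume c: "c \<in> charts R" "x \<in> chart_dom c" and x: "x \<notin> \<Gamma>" and t: "0 < t" "t < T - h"
    and ev: "\<forall>\<^sub>F z in nhds (x, t). u (fst z, snd z + h) + k \<ge> u (fst (x, t), snd (x, t) + h) + k + jet c x t p a N z"
  have "\<forall>\<^sub>F z in nhds (x, t + h). u (fst z, snd z) \<ge> u (x, t + h) + jet c x (t + h) p a N z"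
    using eventually_compose_filterlim[OF ev filterlim_time_shift]
    by eventually_elim (simp add: jet_def algebra_simps)
  then have "\<forall>\<^sub>F z in nhds (x, t + h). u z \<ge> u (x, t + h) + jet c x (t + h) p a N z" by simp
  moreover have "0 < t + h" "t + h < T" using t h by auto
  ultimately show "a + dual_norm (metric R c x) p \<ge> P x"
    using u c x unfolding prox_super_def by blast
qed

lemma prox_sub_antimono: "prox_sub \<Gamma> P T u \<Longrightarrow> T' \<le> T \<Longrightarrow> prox_sub \<Gamma> P T' u"
  unfolding prox_sub_def by (meson less_le_trans)

lemma prox_super_antimono: "prox_super \<Gamma> P T u \<Longrightarrow> T' \<le> T \<Longrightarrow> prox_super \<Gamma> P T' u"
  unfolding prox_super_def by (meson less_le_trans)

lemma eventually_nhds_time: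
  fixes t :: real
  assumes "\<forall>\<^sub>F z in nhds (x :: 'm, t). Q z"
  shows "\<forall>\<^sub>F s in nhds t. Q (x, s)"
proof -
  obtain S where S: "open S" "(x, t) \<in> S" "\<forall>z\<in>S. Q z" using assms unfolding eventually_nhds by blast
  have "open ((\<lambda>s. (x, s)) -` S)" using S(1) by (intro open_vimage continuous_intros)
  then show ?thesis unfolding eventually_nhds using S by (intro exI[of _ "(\<lambda>s. (x, s)) -` S"]) auto
qed

text \<open>Along the time line through \<open>x\<close> the barrier is affine, so a jet touching
  from below has slope \<open>a = B\<close>, whatever \<open>g\<close> is; the dual norm only adds
  to it.\<close>

lemma barrier_prox_super:
  assumes B: "\<And>x. x \<notin> \<Gamma> \<Longrightarrow> P x \<le> B"
  shows "prox_super \<Gamma> P T (\<lambda>z. g (fst z) + B * snd z)"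
  unfolding prox_super_def
proof (intro allI impI, elim conjE)
  fix c x t p a N
  assume c: "c \<in> charts R" "x \<in> chart_dom c" and x: "x \<notin> \<Gamma>"
    and ev: "\<forall>\<^sub>F z in nhds (x, t). g (fst z) + B * snd z \<ge> g (fst (x, t)) + B * snd (x, t) + jet c x t p a N z"
  have "\<forall>\<^sub>F s in nhds t. (B - a) * (s - t) \<ge> N * (s - t)\<^sup>2"
    using eventually_nhds_time[OF ev] by eventually_elim (simp add: jet_def algebra_simps)
  then have "B - a = 0" by (rule linear_ge_quadratic_imp_zero)
  then show "a + dual_norm (metric R c x) p \<ge> P x"
    using B[OF x] dual_norm_nonneg[OF metric_inner_form[OF c], of p] by simp
qed

text \<open>Along the time line a touching jet has slope \<open>a = - L\<close>. Moving from
  \<open>x\<close> against the Riemannian gradient \<open>sharp\<close> of \<open>p\<close>, the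
  function \<open>g\<close> drops at most at the rate \<open>L\<close>, so the dual norm of
  \<open>p\<close> is at most \<open>L\<close> and the sum is not positive.\<close>

lemma barrier_prox_sub:
  assumes \<Gamma>: "mboundary R \<subseteq> \<Gamma>" "closed \<Gamma>" and P: "\<And>x. x \<notin> \<Gamma> \<Longrightarrow> P x \<ge> 0"
    and L: "L \<ge> 0" "\<And>x y. \<bar>g x - g y\<bar> \<le> L * rdist R x y"
  shows "prox_sub \<Gamma> P T (\<lambda>z. g (fst z) - L * snd z)"
  unfolding prox_sub_def
proof (intro allI impI, elim conjE)
  fix c x t p a N
  assume c: "c \<in> charts R" "x \<in> chart_dom c" and x: "x \<notin> \<Gamma>"
    and ev: "\<forall>\<^sub>F z in nhds (x, t). g (fst z) - L * snd z \<le> g (fst (x, t)) - L * snd (x, t) + jet c x t p a N z"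
  have "\<forall>\<^sub>F s in nhds t. (L + a) * (s - t) \<ge> - N * (s - t)\<^sup>2"
    using eventually_nhds_time[OF ev] by eventually_elim (simp add: jet_def algebra_simps)
  then have a: "L + a = 0" by (rule linear_ge_quadratic_imp_zero)
  obtain r m \<Lambda> where r: "r > 0" and \<Lambda>: "\<Lambda> > 0"
    and rI: "cball (chart_map c x) r \<subseteq> interior (chart_image c)"
    and b3: "\<And>q q' v. q \<in> cball (chart_map c x) r \<Longrightarrow> q' \<in> cball (chart_map c x) r \<Longrightarrow>
       sqrt (metric R c (chart_inv c q') v v)
         \<le> (1 + \<Lambda> * norm (q - q')) * sqrt (metric R c (chart_inv c q) v v)"
    by (rule interior_chart_ball[OF \<Gamma> x c zero_less_one]) (use that in blast)
  note b = metric_inner_form[OF c]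
  have bl: "bilinear (metric R c x)" using b unfolding inner_form_def by blast
  let ?q = "chart_map c x"
  let ?v = "sharp (metric R c x) p"
  let ?G = "sqrt (metric R c x ?v ?v)"
  have im: "q \<in> chart_image c" if "q \<in> cball ?q r" for q using that rI interior_subset by blast
  have curve: "((\<lambda>h. (chart_inv c (?q - h *\<^sub>R ?v), t)) \<longlongrightarrow> (x, t)) (at_right 0)"
  proof -
    have isC: "isCont (chart_inv c) ?q"
      using continuous_on_subset[OF continuous_on_chart_inv[OF c(1)] interior_subset] rI r
      by (auto simp: continuous_on_eq_continuous_at dest!: subsetD[of _ _ ?q])
    have "((\<lambda>h. ?q - h *\<^sub>R ?v) \<longlongrightarrow> ?q - 0 *\<^sub>R ?v) (at_right 0)" by (intro tendsto_intros)
    then have "((\<lambda>h. ?q - h *\<^sub>R ?v) \<longlongrightarrow> ?q) (at_right 0)" by simp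
    from isCont_tendsto_compose[OF isC this]
    have "((\<lambda>h. chart_inv c (?q - h *\<^sub>R ?v)) \<longlongrightarrow> x) (at_right 0)" using chart_inv_map[OF c] by simp
    then show ?thesis by (rule tendsto_Pair[OF _ tendsto_const])
  qed
  have "\<forall>\<^sub>F h in at_right 0. h * norm ?v < r"
  proof -
    have "((\<lambda>h. h * norm ?v) \<longlongrightarrow> 0 * norm ?v) (at_right 0)" by (intro tendsto_intros)
    then show ?thesis using r by (intro order_tendstoD(2)) auto
  qed
  moreover have "\<forall>\<^sub>F h in at_right (0::real). h > 0" by (simp add: eventually_at_right_less)
  \<comment> \<open>Already divided by \<open>h\<close>: the coordinate step
    \<open>- h *\<^sub>R ?v\<close> covers a distance of at most \<open>h * ?G\<close> times a
    factor tending to 1.\<close>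
  ultimately have "\<forall>\<^sub>F h in at_right 0. p \<bullet> ?v \<le> L * ((1 + \<Lambda> * (h * norm ?v)) * ?G) + N * (h * (norm ?v)\<^sup>2)"
    using eventually_compose_filterlim[OF ev curve]
  proof eventually_elim
    case (elim h)
    let ?y = "?q - h *\<^sub>R ?v"
    let ?K = "cball ?q (h * norm ?v)"
    have Kr: "?K \<subseteq> cball ?q r" using elim by (intro subset_cball) simp
    have yK: "?y \<in> ?K" using elim by (simp add: dist_norm)
    have qK: "?q \<in> ?K" using elim by simp
    have "rdist R (chart_inv c ?q) (chart_inv c ?y) \<le> (1 + \<Lambda> * (h * norm ?v)) * (h * ?G)"
    proof (rule rdist_segment_le[OF c(1) convex_cball _ qK yK])
      show "?K \<subseteq> chart_image c" using Kr im by blast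
      fix z assume z: "z \<in> ?K"
      have hv: "?y - ?q = (- h) *\<^sub>R ?v" by simp
      have "metric R c x (?y - ?q) (?y - ?q) = h\<^sup>2 * metric R c x ?v ?v"
        unfolding hv bilinear_lmul[OF bl] bilinear_rmul[OF bl] by (simp add: power2_eq_square)
      then have G: "sqrt (metric R c (chart_inv c ?q) (?y - ?q) (?y - ?q)) = h * ?G"
        using elim chart_inv_map[OF c] by (simp add: real_sqrt_mult)
      have "sqrt (metric R c (chart_inv c z) (?y - ?q) (?y - ?q)) \<le> (1 + \<Lambda> * norm (?q - z)) * (h * ?G)"
        using b3[of ?q z "?y - ?q"] z Kr r unfolding G by auto
      also have "\<dots> \<le> (1 + \<Lambda> * (h * norm ?v)) * (h * ?G)"
        using z \<Lambda> elim inner_form_nonneg[OF b]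
        by (intro mult_right_mono add_left_mono mult_left_mono) (auto simp: dist_norm)
      finally show "sqrt (metric R c (chart_inv c z) (?y - ?q) (?y - ?q)) \<le> (1 + \<Lambda> * (h * norm ?v)) * (h * ?G)" .
    qed
    then have "L * rdist R x (chart_inv c ?y) \<le> L * ((1 + \<Lambda> * (h * norm ?v)) * (h * ?G))"
      using chart_inv_map[OF c] L(1) by (intro mult_left_mono) auto
    moreover have "\<bar>g x - g (chart_inv c ?y)\<bar> \<le> L * rdist R x (chart_inv c ?y)" by (rule L(2))
    moreover have "g (chart_inv c ?y) \<le> g x + (- h * (p \<bullet> ?v) + N * (h\<^sup>2 * (norm ?v)\<^sup>2))"
    proof -
      have "chart_map c (chart_inv c ?y) = ?y" by (rule chart_map_inv) (use yK Kr im in blast)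
      then show ?thesis using elim by (simp add: jet_def power_mult_distrib)
    qed
    ultimately have "h * (p \<bullet> ?v) \<le> L * ((1 + \<Lambda> * (h * norm ?v)) * (h * ?G)) + N * (h\<^sup>2 * (norm ?v)\<^sup>2)"
      by linarith
    also have "\<dots> = h * (L * ((1 + \<Lambda> * (h * norm ?v)) * ?G) + N * (h * (norm ?v)\<^sup>2))"
      by (simp add: algebra_simps power2_eq_square)
    finally show ?case using elim by simp
  qed
  moreover have "((\<lambda>h. L * ((1 + \<Lambda> * (h * norm ?v)) * ?G) + N * (h * (norm ?v)\<^sup>2))
      \<longlongrightarrow> L * ((1 + \<Lambda> * (0 * norm ?v)) * ?G) + N * (0 * (norm ?v)\<^sup>2)) (at_right 0)"
    by (intro tendsto_intros)
  ultimately have "p \<bullet> ?v \<le> L * ?G"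
    using tendsto_lowerbound[of _ "L * ((1 + \<Lambda> * (0 * norm ?v)) * ?G) + N * (0 * (norm ?v)\<^sup>2)" "at_right (0::real)"]
    by simp
  then have "dual_norm (metric R c x) p \<le> L" using L(1) by (rule dual_norm_leI[OF b])
  then show "a + dual_norm (metric R c x) p \<le> P x" using a P[OF x] by simp
qed

end

section \<open>Lipschitz bounds for the solution\<close>

text \<open>Only differences to the left are used, since the parameter to which this is applied may
  be the right end of its interval.\<close>

lemma left_derivative_nonpos_at_min:
  fixes \<Phi> :: "real \<Rightarrow> real"
  assumes D: "(\<Phi> has_real_derivative D) (at \<tau> within {l..\<tau>})" and l: "l < \<tau>"
    and min: "\<And>s. s \<in> {l..\<tau>} \<Longrightarrow> \<Phi> \<tau> \<le> \<Phi> s"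
  shows "D \<le> 0"
proof (rule ccontr)
  assume "\<not> D \<le> 0"
  then obtain d where d: "d > 0" "\<And>h. h > 0 \<Longrightarrow> \<tau> - h \<in> {l..\<tau>} \<Longrightarrow> h < d \<Longrightarrow> \<Phi> (\<tau> - h) < \<Phi> \<tau>"
    using has_real_derivative_pos_inc_left[OF D] by auto
  define h where "h = min (d / 2) (\<tau> - l)"
  have h: "h > 0" "h < d" "\<tau> - h \<in> {l..\<tau>}" using d(1) l by (auto simp: h_def)
  show False using d(2)[OF h(1,3,2)] min[OF h(3)] by simp
qed

locale eikonal = riem_manifold R
  for R :: "('m::{t2_space,second_countable_topology}, 'e::euclidean_space) rmanifold" +
  fixes \<Gamma> :: "'m set" and P f0 :: "'m \<Rightarrow> real" and T :: real and f :: "'m \<times> real \<Rightarrow> real"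
  assumes T: "T > 0" and cpt: "compact (UNIV :: 'm set)"
    and conn: "\<And>x y. \<exists>\<gamma>. C1_curve R 1 \<gamma> \<and> \<gamma> 0 = x \<and> \<gamma> 1 = y"
    and closed: "closed \<Gamma>" and bdry: "mboundary R \<subseteq> \<Gamma>"
    and P: "P \<in> Lip (rdist R) (- \<Gamma>)" and P_nonneg: "\<And>x. x \<notin> \<Gamma> \<Longrightarrow> P x \<ge> 0"
    and f0: "f0 \<in> Lip (rdist R) UNIV"
    and sol: "viscosity_solution R \<Gamma> P f0 T f"
begin

section \<open>Distance, constants and continuity of the solution\<close>

abbreviation L :: real where "L \<equiv> lip_const (rdist R) UNIV f0"
abbreviation B :: real where "B \<equiv> sup_norm (- \<Gamma>) P"

text \<open>Without a connecting curve the infimum in \<open>rdist\<close> would be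
  unspecified.\<close>

lemma lengths_nonempty: "{curve_length R 1 \<gamma> | \<gamma>. C1_curve R 1 \<gamma> \<and> \<gamma> 0 = x \<and> \<gamma> 1 = y} \<noteq> {}"
  using conn[of x y] by blast

lemma rdist_geI:
  assumes "\<And>\<gamma>. C1_curve R 1 \<gamma> \<Longrightarrow> \<gamma> 0 = x \<Longrightarrow> \<gamma> 1 = y \<Longrightarrow> b \<le> integral {0..1} (speed \<gamma>)"
  shows "b \<le> rdist R x y"
  unfolding rdist_def
  by (rule cInf_greatest[OF lengths_nonempty]) (use assms in \<open>auto simp: curve_length_speed\<close>)

lemma rdist_nonneg: "rdist R x y \<ge> 0"
  using curve_length_nonneg by (intro rdist_geI) (simp add: curve_length_speed)

lemma rdist_sym: "rdist R x y = rdist R y x"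
proof -
  have "rdist R x y \<le> rdist R y x" for x y
    by (rule rdist_geI) (use rdist_reverse_le in blast)
  then show ?thesis by (meson antisym)
qed

lemma L_nonneg: "L \<ge> 0"
  by (rule lip_const_nonneg[OF f0])

lemma f0_Lip: "\<bar>f0 x - f0 y\<bar> \<le> L * rdist R x y"
  by (rule lip_const_bound[OF f0]) (simp_all add: rdist_nonneg)

text \<open>\<open>Sup\<close> is a genuine supremum for bounded sets only; boundedness of
  \<open>P\<close> comes from its Lipschitz property and compactness.\<close>

lemma P_le_B: "x \<notin> \<Gamma> \<Longrightarrow> P x \<le> B" and B_nonneg: "B \<ge> 0"
proof -
  obtain b where "\<And>x. x \<in> - \<Gamma> \<Longrightarrow> \<bar>P x\<bar> \<le> b" by (rule Lip_bounded[OF cpt P]) (rule that)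
  then have bdd: "bdd_above (insert 0 ((\<lambda>x. \<bar>P x\<bar>) ` (- \<Gamma>)))" by (auto intro!: bdd_aboveI[of _ b])
  show "B \<ge> 0" unfolding sup_norm_def by (rule cSup_upper[OF _ bdd]) simp
  show "P x \<le> B" if "x \<notin> \<Gamma>"
    using cSup_upper[OF _ bdd, of "\<bar>P x\<bar>"] that unfolding sup_norm_def by force
qed

lemma P_cont: "continuous_on (- \<Gamma>) P"
  by (rule Lip_continuous_on[OF bdry closed P])

text \<open>Always \<open>f\<^sub>* \<le> f \<le> f\<^sup>*\<close>; comparison puts the envelopes
  in the opposite order, so all three agree.\<close>

lemma envelopes_eq:
  assumes z: "z \<in> cylinder T"
  shows "usc_envelope (cylinder T) f z = f z" and "lsc_envelope (cylinder T) f z = f z"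
proof -
  let ?u = "usc_envelope (cylinder T) f" and ?v = "lsc_envelope (cylinder T) f"
  have sub: "viscosity_subsolution R \<Gamma> P f0 T ?u" and super: "viscosity_supersolution R \<Gamma> P f0 T ?v"
    and lb: "locally_bounded_on (cylinder T) f"
    using sol unfolding viscosity_solution_def by auto
  have u: "usc_on (cylinder T) ?u" "\<And>x t. (x, t) \<in> parabolic_boundary \<Gamma> T \<Longrightarrow> ?u (x, t) \<le> f0 x"
    using sub unfolding viscosity_subsolution_def by auto
  have v: "lsc_on (cylinder T) ?v" "\<And>x t. (x, t) \<in> parabolic_boundary \<Gamma> T \<Longrightarrow> f0 x \<le> ?v (x, t)"
    using super unfolding viscosity_supersolution_def by auto
  have "?u z \<le> ?v z"
    by (rule comparison[OF bdry closed cpt P_cont u(1) viscosity_subsolution_imp_prox_sub[OF sub bdry]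
          v(1) viscosity_supersolution_imp_prox_super[OF super bdry] order_trans[OF u(2) v(2)] z])
  then show "?u z = f z" "?v z = f z" using envelope_bounds[OF lb z] by auto
qed

lemma f_boundary:
  assumes z: "(x, t) \<in> parabolic_boundary \<Gamma> T"
  shows "f (x, t) = f0 x"
proof -
  have zc: "(x, t) \<in> cylinder T" using z T by (auto simp: parabolic_boundary_def cylinder_def)
  have "usc_envelope (cylinder T) f (x, t) \<le> f0 x" "lsc_envelope (cylinder T) f (x, t) \<ge> f0 x"
    using sol z unfolding viscosity_solution_def viscosity_subsolution_def viscosity_supersolution_def by auto
  then show ?thesis unfolding envelopes_eq[OF zc] by simp
qed

lemma f_cont: "continuous_on (cylinder T) f"
proof -
  have "continuous_on (cylinder T) (usc_envelope (cylinder T) f)"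
  proof (rule usc_lsc_imp_continuous_on)
    show "usc_on (cylinder T) (usc_envelope (cylinder T) f)"
      using sol unfolding viscosity_solution_def viscosity_subsolution_def by simp
    have "lsc_on (cylinder T) (lsc_envelope (cylinder T) f)"
      using sol unfolding viscosity_solution_def viscosity_supersolution_def by simp
    then have "lsc_on (cylinder T) (\<lambda>z. f (id z))"
      unfolding lsc_on_def using envelopes_eq(2)
      by (auto simp: eventually_at_filter elim!: eventually_mono)
    then show "lsc_on (cylinder T) (usc_envelope (cylinder T) f)"
      unfolding lsc_on_def using envelopes_eq(1)
      by (auto simp: eventually_at_filter elim!: eventually_mono)
  qed
  then show ?thesis by (rule continuous_on_eq) (rule envelopes_eq(1))
qed

lemma f_prox_sub: "prox_sub \<Gamma> P T f"
  by (rule prox_sub_cong[OF viscosity_subsolution_imp_prox_sub[where ?f0.0=f0, OF _ bdry] envelopes_eq(1)])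
    (use sol in \<open>simp add: viscosity_solution_def\<close>)

lemma f_prox_super: "prox_super \<Gamma> P T f"
  by (rule prox_super_cong[OF viscosity_supersolution_imp_prox_super[where ?f0.0=f0, OF _ bdry] envelopes_eq(2)])
    (use sol in \<open>simp add: viscosity_solution_def\<close>)

text \<open>The continuity of \<open>f\<^sub>0\<close> up to the boundary comes from that of \<open>f\<close>; no comparison of the topology
  with \<^const>\<open>rdist\<close> at boundary points is needed.\<close>

lemma f0_cont: "continuous_on UNIV f0"
proof -
  have "continuous_on UNIV (\<lambda>x::'m. f (x, 0))"
    by (rule continuous_on_compose2[OF f_cont]) (use T in \<open>auto simp: cylinder_def intro!: continuous_intros\<close>)
  then show ?thesis by (rule continuous_on_eq) (simp add: f_boundary parabolic_boundary_def)
qed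

section \<open>Lipschitz bound in time\<close>

lemma barrier_cont: "continuous_on S (\<lambda>z::'m\<times>real. f0 (fst z) + k * snd z)"
  by (intro continuous_intros continuous_on_compose2[OF f0_cont]) auto

text \<open>Both barriers equal \<open>f0\<close> at time 0, and on \<open>\<Gamma>\<close> they lie
  on the right sides of \<open>f0\<close> by the signs of their slopes \<open>B\<close> and
  \<open>- L\<close>.\<close>

lemma initial_bound:
  assumes t: "0 \<le> t" "t < T"
  shows "\<bar>f (x, t) - f0 x\<bar> \<le> max L B * t"
proof -
  have z: "(x, t) \<in> cylinder T" using t by (simp add: cylinder_def)
  have "f (x, t) \<le> f0 (fst (x, t)) + B * snd (x, t)"
    by (rule comparison[OF bdry closed cpt P_cont continuous_on_imp_usc_on[OF f_cont] f_prox_sub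
          continuous_on_imp_lsc_on[OF barrier_cont] barrier_prox_super[OF P_le_B] _ z])
      (auto simp: f_boundary B_nonneg parabolic_boundary_def)
  moreover have "f0 (fst (x, t)) - L * snd (x, t) \<le> f (x, t)"
    by (rule comparison[OF bdry closed cpt P_cont _ barrier_prox_sub[OF bdry closed P_nonneg L_nonneg f0_Lip]
          continuous_on_imp_lsc_on[OF f_cont] f_prox_super _ z])
      (use continuous_on_imp_usc_on[OF barrier_cont[of _ "- L"]] in
        \<open>auto simp: f_boundary L_nonneg parabolic_boundary_def\<close>)
  moreover have "L * t \<le> max L B * t" "B * t \<le> max L B * t" using t by (auto intro!: mult_right_mono)
  ultimately show ?thesis by simp
qed

text \<open>Solution and translate are compared on the shorter cylinder \<open>[0, T - h[\<close>.
  On \<open>\<Gamma>\<close> both equal \<open>f0\<close>; at time 0 they differ by at most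
  \<open>max L B * h\<close>, by the bound against the initial datum.\<close>

lemma time_Lip_aux:
  assumes h: "0 \<le> h" and t: "0 \<le> t" "t + h < T"
  shows "\<bar>f (x, t + h) - f (x, t)\<bar> \<le> max L B * h"
proof -
  let ?k = "max L B * h"
  have k: "?k \<ge> 0" using L_nonneg h by simp
  have z: "(x, t) \<in> cylinder (T - h)" using t by (simp add: cylinder_def)
  have T': "T - h \<le> T" using h by simp
  have c1: "continuous_on (cylinder (T - h)) f"
    by (rule continuous_on_subset[OF f_cont]) (use h in \<open>auto simp: cylinder_def\<close>)
  have c2: "continuous_on (cylinder (T - h)) (\<lambda>z. f (fst z, snd z + h) + k)" for k
    by (intro continuous_intros continuous_on_compose2[OF f_cont]) (use h in \<open>auto simp: cylinder_def\<close>)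
  have bd: "f (y, s + h) - ?k \<le> f (y, s) \<and> f (y, s) \<le> f (y, s + h) + ?k"
    if "(y, s) \<in> parabolic_boundary \<Gamma> (T - h)" for y s
  proof (cases "s = 0")
    case True
    then have "f (y, s) = f0 y" by (simp add: f_boundary parabolic_boundary_def)
    moreover have "\<bar>f (y, h) - f0 y\<bar> \<le> ?k" using initial_bound[of h y] h t by simp
    ultimately show ?thesis using True by (auto simp: abs_le_iff)
  next
    case False
    then have "f (y, s) = f0 y" "f (y, s + h) = f0 y"
      using that h by (auto simp: parabolic_boundary_def intro!: f_boundary)
    then show ?thesis using k by simp
  qed
  have "(\<lambda>z. f (fst z, snd z + h) - ?k) (x, t) \<le> f (x, t)"
    by (rule comparison[OF bdry closed cpt P_cont _ prox_sub_shift[OF f_prox_sub h]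
          continuous_on_imp_lsc_on[OF c1] prox_super_antimono[OF f_prox_super T'] _ z])
      (use continuous_on_imp_usc_on[OF c2[of "- ?k"]] bd in auto)
  moreover have "f (x, t) \<le> (\<lambda>z. f (fst z, snd z + h) + ?k) (x, t)"
    by (rule comparison[OF bdry closed cpt P_cont continuous_on_imp_usc_on[OF c1]
          prox_sub_antimono[OF f_prox_sub T'] _ prox_super_shift[OF f_prox_super h] _ z])
      (use continuous_on_imp_lsc_on[OF c2] bd in auto)
  ultimately show ?thesis by simp
qed

lemma time_Lip:
  assumes "t \<in> {0..<T}" "s \<in> {0..<T}"
  shows "\<bar>f (x, t) - f (x, s)\<bar> \<le> max L B * \<bar>t - s\<bar>"
proof (cases "s \<le> t")
  case True
  then show ?thesis using time_Lip_aux[of "t - s" s x] assms by simp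
next
  case False
  then show ?thesis using time_Lip_aux[of "s - t" t x] assms by (simp add: abs_minus_commute)
qed

section \<open>Lipschitz bound in space\<close>

abbreviation K :: real where "K \<equiv> B + max L B"

text \<open>The time component of a superjet of \<open>f\<close> is at least \<open>- max L B\<close>, as \<open>f\<close> is Lipschitz in time.\<close>

lemma jet_dual_norm_le:
  assumes c: "c \<in> charts R" and z: "z \<in> ball zh r" "cball (fst zh) r \<subseteq> chart_image c"
    and \<Gamma>: "chart_inv c (fst z) \<notin> \<Gamma>" and t: "\<And>z'. z' \<in> cball zh r \<Longrightarrow> 0 < snd z' \<and> snd z' < T"
    and le: "\<And>z'. z' \<in> cball zh r \<Longrightarrow> f (chart_inv c (fst z'), snd z')
        \<le> f (chart_inv c (fst z), snd z) + p \<bullet> (z' - z) + N * (norm (z' - z))\<^sup>2"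
  shows "dual_norm (metric R c (chart_inv c (fst z))) (fst p) \<le> K"
proof -
  have zc: "z \<in> cball zh r" using z by simp
  have im: "fst z \<in> chart_image c" using z(2) zc dist_fst_le[of zh z] by auto
  have tz: "0 < snd z" "snd z < T" using t[OF zc] by auto
  have 1: "snd p + dual_norm (metric R c (chart_inv c (fst z))) (fst p) \<le> P (chart_inv c (fst z))"
    by (rule prox_sub_chart[OF f_prox_sub c z(1) im \<Gamma> tz le])
  have "((\<lambda>h. z + h *\<^sub>R (0, 1)) \<longlongrightarrow> z + 0 *\<^sub>R (0, 1)) (at_right (0::real))" by (intro tendsto_intros)
  then have "((\<lambda>h. z + h *\<^sub>R (0, 1)) \<longlongrightarrow> z) (at_right (0::real))" by (simp only: scaleR_zero_left add_0_right)
  then have "\<forall>\<^sub>F h in at_right (0::real). z + h *\<^sub>R (0, 1) \<in> ball zh r"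
    using z(1) by (rule topological_tendstoD[OF _ open_ball])
  moreover have "\<forall>\<^sub>F h in at_right (0::real). h > 0" by (simp add: eventually_at_right_less)
  \<comment> \<open>The touching inequality is read at the same point a time \<open>h\<close> later,
    when \<open>f\<close> has dropped by at most \<open>max L B * h\<close>.\<close>
  ultimately have "\<forall>\<^sub>F h in at_right 0. - max L B \<le> snd p + N * h"
  proof eventually_elim
    case (elim h)
    let ?z = "z + h *\<^sub>R (0, 1)"
    have zb: "?z \<in> cball zh r" using elim by simp
    have s: "fst ?z = fst z" "snd ?z = snd z + h" by simp_all
    have "f (chart_inv c (fst z), snd z + h) \<le> f (chart_inv c (fst z), snd z) + h * snd p + N * h\<^sup>2"
      using le[OF zb] unfolding s by (simp add: inner_prod_def mult.commute[of h])
    moreover have "\<bar>f (chart_inv c (fst z), snd z + h) - f (chart_inv c (fst z), snd z)\<bar> \<le> max L B * \<bar>snd z + h - snd z\<bar>"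
      by (rule time_Lip) (use t[OF zb] tz in auto)
    ultimately have "h * (- max L B) \<le> h * (snd p + N * h)"
      using elim by (simp add: algebra_simps power2_eq_square)
    then show ?case by (rule mult_left_le_imp_le) (use elim in blast)
  qed
  moreover have "((\<lambda>h. snd p + N * h) \<longlongrightarrow> snd p + N * 0) (at_right 0)" by (intro tendsto_intros)
  ultimately have "- max L B \<le> snd p + N * 0"
    by (intro tendsto_lowerbound) auto
  then show ?thesis using 1 P_le_B[OF \<Gamma>] by simp
qed

lemma K_nonneg: "K \<ge> 0" using L_nonneg B_nonneg by simp

text \<open>If \<open>f (\<gamma> \<tau>, t\<^sub>0) - \<kappa> \<tau>\<close> with \<open>\<kappa>' = K \<bar>\<gamma>'\<bar> + \<eta>\<close> had a maximum point other than \<open>a\<close>, then doubling it to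
  \<open>f z - \<kappa> \<tau> - k \<bar>z - (\<gamma> \<tau>, t\<^sub>0)\<bar>\<^sup>2\<close> would give a superjet \<open>p\<close> of \<open>f\<close> of norm at most \<open>K\<close> (up to \<open>o(1)\<close>)
  with \<open>p(\<gamma>') \<ge> \<kappa>'\<close>.\<close>

lemma curve_increment_le:
  assumes \<gamma>: "C1_curve R 1 \<gamma>" and ab: "0 \<le> a" "a < b" "b \<le> 1"
    and off: "\<And>\<tau>. \<tau> \<in> {a..b} \<Longrightarrow> \<gamma> \<tau> \<notin> \<Gamma>" and t0: "0 < t0" "t0 < T"
  shows "f (\<gamma> b, t0) - f (\<gamma> a, t0) \<le> K * integral {a..b} (speed \<gamma>)"
proof (rule ccontr)
  assume "\<not> ?thesis"
  then have neg: "f (\<gamma> b, t0) - f (\<gamma> a, t0) > K * integral {a..b} (speed \<gamma>)" by simp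
  \<comment> \<open>Half of the supposed excess per unit of parameter: \<open>?G\<close> is still
    larger at \<open>b\<close> than at \<open>a\<close> after \<open>\<eta> * (\<tau> - a)\<close>
    has been subtracted.\<close>
  define \<eta> where "\<eta> = (f (\<gamma> b, t0) - f (\<gamma> a, t0) - K * integral {a..b} (speed \<gamma>)) / (2 * (b - a))"
  have \<eta>: "\<eta> > 0" using neg ab by (simp add: \<eta>_def)
  have \<eta>ab: "\<eta> * (b - a) = (f (\<gamma> b, t0) - f (\<gamma> a, t0) - K * integral {a..b} (speed \<gamma>)) / 2"
    using ab by (simp add: \<eta>_def field_simps)
  have g: "continuous_on {0..1} \<gamma>" using \<gamma> unfolding C1_curve_def by simp
  have gab: "continuous_on {a..b} \<gamma>" by (rule continuous_on_subset[OF g]) (use ab in auto)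
  have sp: "continuous_on {a..b} (speed \<gamma>)" by (rule continuous_on_subset[OF speed_continuous[OF \<gamma>]]) (use ab in auto)
  define \<kappa> where "\<kappa> \<tau> = K * integral {a..\<tau>} (speed \<gamma>) + \<eta> * (\<tau> - a)" for \<tau>
  have \<kappa>D: "(\<kappa> has_real_derivative K * speed \<gamma> \<tau> + \<eta>) (at \<tau> within {a..b})" if "\<tau> \<in> {a..b}" for \<tau>
    unfolding \<kappa>_def
    by (auto intro!: derivative_eq_intros integral_has_real_derivative[OF sp that])
  then have \<kappa>c: "continuous_on {a..b} \<kappa>" by (rule DERIV_continuous_on)
  have fc: "continuous_on {a..b} (\<lambda>\<tau>. f (\<gamma> \<tau>, t0))"
    by (rule continuous_on_compose2[OF f_cont]) (use t0 in \<open>auto intro!: continuous_intros gab simp: cylinder_def\<close>)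
  let ?G = "\<lambda>\<tau>. f (\<gamma> \<tau>, t0) - \<kappa> \<tau>"
  obtain \<tau>h where \<tau>h: "\<tau>h \<in> {a..b}" "\<And>\<tau>. \<tau> \<in> {a..b} \<Longrightarrow> ?G \<tau> \<le> ?G \<tau>h"
    using continuous_attains_sup[of "{a..b}" ?G, OF _ _ continuous_on_diff[OF fc \<kappa>c]] ab
    by (auto simp del: atLeastAtMost_iff)
  have "?G a < ?G b"
    using \<eta>ab neg by (simp add: \<kappa>_def)
  then have "\<tau>h \<noteq> a" using \<tau>h(2)[of b] ab by auto
  \<comment> \<open>This provides the left neighbourhood of \<open>\<tau>h\<close> on which the
    one-sided derivative is taken.\<close>
  then have \<tau>a: "a < \<tau>h" using \<tau>h by simp
  define xh where "xh = \<gamma> \<tau>h"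
  have xh: "xh \<notin> \<Gamma>" using off[OF \<tau>h(1)] by (simp add: xh_def)
  let ?c = "chart_at R xh"
  note c = chart_at[of xh]
  obtain r m \<Lambda> where r: "r > 0" "r \<le> min (t0 / 2) ((T - t0) / 2)" and \<Lambda>: "\<Lambda> > 0"
    and rI: "cball (chart_map ?c xh) r \<subseteq> interior (chart_image ?c)"
    and rG: "\<And>q. q \<in> cball (chart_map ?c xh) r \<Longrightarrow> chart_inv ?c q \<notin> \<Gamma>"
    and b3: "\<And>q q' v. q \<in> cball (chart_map ?c xh) r \<Longrightarrow> q' \<in> cball (chart_map ?c xh) r \<Longrightarrow>
       sqrt (metric R ?c (chart_inv ?c q') v v)
         \<le> (1 + \<Lambda> * norm (q - q')) * sqrt (metric R ?c (chart_inv ?c q) v v)"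
    by (rule interior_chart_ball[OF bdry closed xh c, of "min (t0 / 2) ((T - t0) / 2)"])
      (use t0 that in auto)
  have im: "q \<in> chart_image ?c" if "q \<in> cball (chart_map ?c xh) r" for q
    using that rI interior_subset by blast
  define Zh where "Zh = (chart_map ?c xh, t0)"
  have fB: "fst z \<in> cball (chart_map ?c xh) r" and tB: "0 < snd z \<and> snd z < T" if "z \<in> cball Zh r" for z
    using that dist_fst_le[of Zh z] dist_snd_le[of Zh z] r t0 by (auto simp: Zh_def dist_real_def)
  let ?e = "\<lambda>z::'e\<times>real. (chart_inv ?c (fst z), snd z)"
  have conte: "continuous_on (cball Zh r) ?e"
    by (intro continuous_intros continuous_on_compose2[OF continuous_on_chart_inv[OF c(1)]])
      (use im fB in \<open>auto simp del: mem_cball\<close>)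
  have eC: "?e ` cball Zh r \<subseteq> cylinder T" using tB by (force simp: cylinder_def)
  \<comment> \<open>A window of parameters on which the curve stays in the chart ball. It extends by
    the full length \<open>d\<close> to the left and is cut at \<open>b\<close> on the
    right.\<close>
  obtain d where d: "d > 0" "a \<le> \<tau>h - d"
    and dY: "\<And>\<tau>. \<tau> \<in> {\<tau>h - d..min b (\<tau>h + d)} \<Longrightarrow>
      \<gamma> \<tau> \<in> chart_dom ?c \<and> chart_map ?c (\<gamma> \<tau>) \<in> cball (chart_map ?c xh) r"
  proof -
    have oU: "open (chart_dom ?c \<inter> chart_map ?c -` ball (chart_map ?c xh) r)"
      using continuous_on_chart[OF c(1)] chart_open[OF c(1)] by (simp add: continuous_on_open_vimage Int_commute)
    have tend: "(\<gamma> \<longlongrightarrow> \<gamma> \<tau>h) (at \<tau>h within {a..b})" using gab \<tau>h(1) unfolding continuous_on_def by blast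
    have "\<forall>\<^sub>F \<tau> in at \<tau>h within {a..b}. \<gamma> \<tau> \<in> chart_dom ?c \<inter> chart_map ?c -` ball (chart_map ?c xh) r"
      by (rule topological_tendstoD[OF tend oU]) (use c r in \<open>auto simp: xh_def\<close>)
    then obtain d0 where d0: "d0 > 0" "\<And>\<tau>. \<tau> \<in> {a..b} \<Longrightarrow> \<tau> \<noteq> \<tau>h \<Longrightarrow> dist \<tau> \<tau>h < d0 \<Longrightarrow>
        \<gamma> \<tau> \<in> chart_dom ?c \<inter> chart_map ?c -` ball (chart_map ?c xh) r"
      unfolding eventually_at by blast
    define d where "d = min (d0 / 2) (\<tau>h - a)"
    show thesis
    proof (rule that[of d])
      show "d > 0" "a \<le> \<tau>h - d" using d0(1) \<tau>a by (auto simp: d_def)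
      fix \<tau> assume \<tau>: "\<tau> \<in> {\<tau>h - d..min b (\<tau>h + d)}"
      then have "dist \<tau> \<tau>h < d0" "\<tau> \<in> {a..b}" using d0(1) by (auto simp: d_def dist_real_def)
      then show "\<gamma> \<tau> \<in> chart_dom ?c \<and> chart_map ?c (\<gamma> \<tau>) \<in> cball (chart_map ?c xh) r"
        using d0(2)[of \<tau>] c r by (cases "\<tau> = \<tau>h") (auto simp: xh_def)
    qed
  qed
  define Y where "Y = {\<tau>h - d..min b (\<tau>h + d)}"
  have Yab: "Y \<subseteq> {a..b}" and Y01: "Y \<subseteq> {0..1}" using d ab by (auto simp: Y_def)
  have \<tau>Y: "\<tau>h \<in> Y" using d \<tau>h by (auto simp: Y_def)
  let ?\<zeta> = "\<lambda>\<tau>. (chart_map ?c (\<gamma> \<tau>), t0)"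
  have \<zeta>c: "continuous_on Y ?\<zeta>"
    by (intro continuous_intros continuous_on_compose2[OF continuous_on_chart[OF c(1)] continuous_on_subset[OF g Y01]])
      (use dY in \<open>auto simp: Y_def\<close>)
  \<comment> \<open>The square makes \<open>\<tau>h\<close> a strict maximum point; its derivative
    at \<open>y n\<close> vanishes in the limit.\<close>
  let ?B = "\<lambda>\<tau>. \<kappa> \<tau> + (\<tau> - \<tau>h)\<^sup>2"
  have Bl: "lsc_on Y ?B"
    by (intro continuous_on_imp_lsc_on continuous_intros continuous_on_subset[OF \<kappa>c Yab])
  have Au: "usc_on (cball Zh r) (\<lambda>z. f (?e z))"
    by (rule usc_on_compose[OF continuous_on_imp_usc_on[OF f_cont] conte eC])
  have e\<zeta>: "?e (?\<zeta> \<tau>) = (\<gamma> \<tau>, t0)" if "\<tau> \<in> Y" for \<tau>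
    using chart_inv_map[OF c(1)] dY[of \<tau>] that by (simp add: Y_def)
  have \<zeta>h: "?\<zeta> \<tau>h = Zh" by (simp add: Zh_def xh_def)
  have strict: "f (?e (?\<zeta> \<tau>)) - ?B \<tau> < f (?e (?\<zeta> \<tau>h)) - ?B \<tau>h" if \<tau>: "\<tau> \<in> Y" "\<tau> \<noteq> \<tau>h" for \<tau>
  proof -
    have "(\<tau> - \<tau>h)\<^sup>2 > 0" using \<tau> by simp
    moreover have "?G \<tau> \<le> ?G \<tau>h" using \<tau> Yab by (intro \<tau>h(2)) blast
    moreover have "(\<tau>h - \<tau>h)\<^sup>2 = 0" by simp
    ultimately show ?thesis unfolding e\<zeta>[OF \<tau>(1)] e\<zeta>[OF \<tau>Y] by linarith
  qed
  have cY: "compact Y" by (simp add: Y_def)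
  have Zh: "?\<zeta> \<tau>h \<in> cball Zh r" using r by (simp add: \<zeta>h)
  obtain z y k where zX: "\<And>n::nat. z n \<in> cball Zh r" and yY: "\<And>n. y n \<in> Y" and k: "\<And>n. k n > (0::real)"
    and mx: "\<And>n z' y'. z' \<in> cball Zh r \<Longrightarrow> y' \<in> Y \<Longrightarrow>
        f (?e z') - ?B y' - k n * (norm (z' - ?\<zeta> y'))\<^sup>2 \<le> f (?e (z n)) - ?B (y n) - k n * (norm (z n - ?\<zeta> (y n)))\<^sup>2"
    and zl: "z \<longlonglongrightarrow> ?\<zeta> \<tau>h" and yl: "y \<longlonglongrightarrow> \<tau>h"
    by (rule penalization[OF compact_cball cY Au Bl \<zeta>c \<tau>Y Zh strict]) (use that in blast)+
  obtain S where S: "\<And>\<tau>. \<tau> \<in> {a..b} \<Longrightarrow> speed \<gamma> \<tau> \<le> S"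
    using continuous_attains_sup[OF compact_Icc _ sp] ab by (auto simp del: atLeastAtMost_iff)
  have S0: "S \<ge> 0" using S[OF \<tau>h(1)] speed_nonneg[of \<gamma> \<tau>h] by simp
  \<comment> \<open>The gradient bound holds at \<open>z n\<close>, the derivative of the curve is
    taken at \<open>y n\<close>. As the dual norm at \<open>z n\<close> is already bounded by
    \<open>K\<close>, moving between the two points costs only a multiple of
    \<open>norm (z n - ?\<zeta> (y n))\<close>.\<close>
  have le: "\<eta> \<le> \<Lambda> * K * S * norm (z n - ?\<zeta> (y n)) + 2 * \<bar>y n - \<tau>h\<bar>"
    if zb: "z n \<in> ball Zh r" and yb: "\<tau>h - d < y n" for n
  proof -
    let ?p = "(2 * k n) *\<^sub>R (z n - ?\<zeta> (y n))"
    let ?q = "chart_map ?c (\<gamma> (y n))"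
    let ?v = "coord_velocity ?c 1 \<gamma> (y n)"
    note yn = yY[of n]
    have ydom: "\<gamma> (y n) \<in> chart_dom ?c" "?q \<in> cball (chart_map ?c xh) r" using dY yn by (auto simp: Y_def)
    have fz: "fst (z n) \<in> cball (chart_map ?c xh) r" by (rule fB[OF zX])
    have d1: "dual_norm (metric R ?c (chart_inv ?c (fst (z n)))) (fst ?p) \<le> K"
    proof (rule jet_dual_norm_le[OF c(1) zb _ rG[OF fz] tB, where N = "k n"])
      show "cball (fst Zh) r \<subseteq> chart_image ?c" using im by (auto simp: Zh_def)
      fix z' assume z': "z' \<in> cball Zh r"
      have 1: "f (?e z') - k n * (norm (z' - ?\<zeta> (y n)))\<^sup>2 \<le> f (?e (z n)) - k n * (norm (z n - ?\<zeta> (y n)))\<^sup>2"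
        using mx[OF z' yn, of n] by simp
      have e1: "(norm (z' - w))\<^sup>2 = (norm (z n - w))\<^sup>2 + 2 * ((z n - w) \<bullet> (z' - z n)) + (norm (z' - z n))\<^sup>2" for w
        by (simp add: power2_norm_eq_inner inner_diff_left inner_diff_right inner_commute algebra_simps)
      have e2: "((2 * k n) *\<^sub>R (z n - ?\<zeta> (y n))) \<bullet> (z' - z n) = 2 * k n * ((z n - ?\<zeta> (y n)) \<bullet> (z' - z n))"
        by (rule inner_scaleR_left)
      show "f (?e z') \<le> f (?e (z n)) + ?p \<bullet> (z' - z n) + k n * (norm (z' - z n))\<^sup>2"
        using 1 unfolding e1[of "?\<zeta> (y n)"] e2 by (simp only: algebra_simps)
    qed
    have ig: "inner_form (metric R ?c (chart_inv ?c q))" if "q \<in> cball (chart_map ?c xh) r" for q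
      by (rule metric_inner_form[OF c(1) chart_inv_dom[OF im[OF that]]])
    have d2: "dual_norm (metric R ?c (chart_inv ?c ?q)) (fst ?p)
        \<le> (1 + \<Lambda> * norm (?q - fst (z n))) * dual_norm (metric R ?c (chart_inv ?c (fst (z n)))) (fst ?p)"
      by (rule dual_norm_mono[OF ig[OF ydom(2)] ig[OF fz] _ b3[OF ydom(2) fz]]) (use \<Lambda> in simp)
    have d3: "0 \<le> 1 + \<Lambda> * norm (?q - fst (z n))" using \<Lambda> by simp
    have dn: "dual_norm (metric R ?c (\<gamma> (y n))) (fst ?p) \<le> (1 + \<Lambda> * norm (?q - fst (z n))) * K"
      using order_trans[OF d2 mult_left_mono[OF d1 d3]] unfolding chart_inv_map[OF c(1) ydom(1)] .
    have y01: "y n \<in> {0..1}" using yn Y01 by blast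
    have "fst ?p \<bullet> ?v \<le> dual_norm (metric R ?c (\<gamma> (y n))) (fst ?p) * speed \<gamma> (y n)"
      unfolding speed_eq[OF \<gamma> c(1) y01 ydom(1)]
      by (rule inner_le_dual_norm[OF metric_inner_form[OF c(1) ydom(1)]])
    also have "\<dots> \<le> ((1 + \<Lambda> * norm (?q - fst (z n))) * K) * speed \<gamma> (y n)"
      by (rule mult_right_mono[OF dn speed_nonneg])
    also have "\<dots> = K * speed \<gamma> (y n) + \<Lambda> * K * speed \<gamma> (y n) * norm (?q - fst (z n))"
      by (simp only: algebra_simps)
    also have "\<Lambda> * K * speed \<gamma> (y n) * norm (?q - fst (z n)) \<le> \<Lambda> * K * S * norm (z n - ?\<zeta> (y n))"
    proof (intro mult_mono mult_left_mono)
      show "speed \<gamma> (y n) \<le> S" using S yn Yab by blast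
      show "norm (?q - fst (z n)) \<le> norm (z n - ?\<zeta> (y n))"
        using dist_fst_le[of "z n" "?\<zeta> (y n)"] by (simp add: dist_norm norm_minus_commute)
    qed (use K_nonneg \<Lambda> S0 in \<open>auto simp: speed_nonneg\<close>)
    finally have up: "fst ?p \<bullet> ?v \<le> K * speed \<gamma> (y n) + \<Lambda> * K * S * norm (z n - ?\<zeta> (y n))" by simp
    let ?Y = "{\<tau>h - d..y n}"
    have YY: "?Y \<subseteq> Y" using yn by (auto simp: Y_def)
    \<comment> \<open>For fixed \<open>z n\<close> this function of \<open>\<tau>\<close> is minimal
      at \<open>y n\<close>. Its derivative contains the pairing of the penalty covector with the
      velocity.\<close>
    have "((\<lambda>\<tau>. ?B \<tau> + k n * (norm (z n - ?\<zeta> \<tau>))\<^sup>2) has_real_derivative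
        (K * speed \<gamma> (y n) + \<eta>) + 2 * (y n - \<tau>h) - fst ?p \<bullet> ?v) (at (y n) within ?Y)"
    proof -
      have D1: "(\<kappa> has_real_derivative K * speed \<gamma> (y n) + \<eta>) (at (y n) within ?Y)"
        by (rule DERIV_subset[OF \<kappa>D order_trans[OF YY Yab]]) (use yn Yab in blast)
      have D2: "((\<lambda>\<tau>. (\<tau> - \<tau>h)\<^sup>2) has_real_derivative 2 * (y n - \<tau>h)) (at (y n) within ?Y)"
        by (auto intro!: derivative_eq_intros)
      have v: "((\<lambda>\<tau>. chart_map ?c (\<gamma> \<tau>)) has_derivative (\<lambda>h. h *\<^sub>R ?v)) (at (y n) within ?Y)"
        using has_vector_derivative_within_subset[OF C1_curve_velocity[OF \<gamma> c(1) y01 ydom(1)]] YY Y01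
        unfolding has_vector_derivative_def o_def by blast
      have D3: "((\<lambda>\<tau>. (norm (z n - ?\<zeta> \<tau>))\<^sup>2) has_real_derivative - 2 * ((fst (z n) - ?q) \<bullet> ?v)) (at (y n) within ?Y)"
      proof -
        have sq: "(norm (z n - ?\<zeta> \<tau>))\<^sup>2 = (fst (z n) - chart_map ?c (\<gamma> \<tau>)) \<bullet> (fst (z n) - chart_map ?c (\<gamma> \<tau>)) + (snd (z n) - t0)\<^sup>2" for \<tau>
          unfolding power2_norm_eq_inner by (simp add: inner_prod_def power2_eq_square)
        show ?thesis
          unfolding sq has_field_derivative_def
          by (auto intro!: derivative_eq_intros v simp: inner_commute algebra_simps fun_eq_iff)
      qed
      from DERIV_add[OF DERIV_add[OF D1 D2] DERIV_cmult[OF D3, of "k n"]]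
      show ?thesis by (rule DERIV_cong) simp
    qed
    then have "(K * speed \<gamma> (y n) + \<eta>) + 2 * (y n - \<tau>h) - fst ?p \<bullet> ?v \<le> 0"
    proof (rule left_derivative_nonpos_at_min[OF _ yb])
      fix s assume "s \<in> ?Y"
      then show "?B (y n) + k n * (norm (z n - ?\<zeta> (y n)))\<^sup>2 \<le> ?B s + k n * (norm (z n - ?\<zeta> s))\<^sup>2"
        using mx[OF zX[of n], of s n] YY by auto
    qed
    moreover have "- (y n - \<tau>h) \<le> \<bar>y n - \<tau>h\<bar>" by simp
    \<comment> \<open>Real variables stand for the large terms, which leaves a plain linear
      estimate.\<close>
    moreover have "\<eta> \<le> Z + 2 * E" if "A + \<eta> + 2 * D - W \<le> 0" "- D \<le> E" "W \<le> A + Z" for A D E W Z :: real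
      using that by linarith
    ultimately show ?thesis using up by blast
  qed
  have "\<forall>\<^sub>F n in sequentially. z n \<in> ball Zh r"
    using zl unfolding \<zeta>h by (rule topological_tendstoD) (use r in auto)
  moreover have "\<forall>\<^sub>F n in sequentially. \<tau>h - d < y n"
    using order_tendstoD(1)[OF yl, of "\<tau>h - d"] d by simp
  ultimately have ev: "\<forall>\<^sub>F n in sequentially. \<eta> \<le> \<Lambda> * K * S * norm (z n - ?\<zeta> (y n)) + 2 * \<bar>y n - \<tau>h\<bar>"
    by eventually_elim (rule le)
  have \<zeta>l: "(\<lambda>n. ?\<zeta> (y n)) \<longlonglongrightarrow> ?\<zeta> \<tau>h"
    by (rule continuous_on_tendsto_compose[OF \<zeta>c yl \<tau>Y]) (simp add: yY)
  have "(\<lambda>n. \<Lambda> * K * S * norm (z n - ?\<zeta> (y n)) + 2 * \<bar>y n - \<tau>h\<bar>)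
      \<longlonglongrightarrow> \<Lambda> * K * S * norm (?\<zeta> \<tau>h - ?\<zeta> \<tau>h) + 2 * \<bar>\<tau>h - \<tau>h\<bar>"
    by (intro tendsto_add tendsto_mult tendsto_norm tendsto_diff tendsto_rabs tendsto_const zl \<zeta>l yl)
  from tendsto_lowerbound[OF this ev] show False using \<eta> by simp
qed

text \<open>Ends on \<open>\<Gamma>\<close> are approached along the curve from parameters where the
  previous estimate applies. Continuity of \<open>f\<close> gives the limit, and shortening the
  interval only decreases the length.\<close>

lemma curve_increment_le_interior:
  assumes \<gamma>: "C1_curve R 1 \<gamma>" and ab: "0 \<le> a" "a \<le> b" "b \<le> 1"
    and off: "\<And>\<tau>. a < \<tau> \<Longrightarrow> \<tau> < b \<Longrightarrow> \<gamma> \<tau> \<notin> \<Gamma>" and t0: "0 < t0" "t0 < T"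
  shows "f (\<gamma> b, t0) - f (\<gamma> a, t0) \<le> K * integral {a..b} (speed \<gamma>)"
proof (cases "a = b")
  case True
  then show ?thesis by simp
next
  case False
  \<comment> \<open>The denominator is at least 3, so that \<open>e n < (b - a) / 2\<close> and the
    shortened interval is nondegenerate.\<close>
  define e where "e n = (b - a) / real (n + 3)" for n
  have ba: "b - a > 0" using False ab by simp
  have e: "0 < e n" "e n < (b - a) / 2" for n
  proof -
    show "0 < e n" using ba by (simp add: e_def)
    show "e n < (b - a) / 2" unfolding e_def by (rule divide_strict_left_mono[OF _ ba]) auto
  qed
  have el: "e \<longlonglongrightarrow> 0"
    unfolding e_def using LIMSEQ_ignore_initial_segment[OF lim_const_over_n[of "b - a"], of 3] by simp
  have g: "continuous_on {a..b} \<gamma>"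
    using \<gamma> ab unfolding C1_curve_def by (auto elim: continuous_on_subset)
  have fc: "continuous_on {a..b} (\<lambda>\<tau>. f (\<gamma> \<tau>, t0))"
    by (rule continuous_on_compose2[OF f_cont]) (use t0 in \<open>auto intro!: continuous_intros g simp: cylinder_def\<close>)
  have sp: "continuous_on {a..b} (speed \<gamma>)"
    by (rule continuous_on_subset[OF speed_continuous[OF \<gamma>]]) (use ab in auto)
  have le: "f (\<gamma> (b - e n), t0) - f (\<gamma> (a + e n), t0) \<le> K * integral {a..b} (speed \<gamma>)" for n
  proof -
    have "f (\<gamma> (b - e n), t0) - f (\<gamma> (a + e n), t0) \<le> K * integral {a + e n..b - e n} (speed \<gamma>)"
    proof (rule curve_increment_le[OF \<gamma> _ _ _ _ t0])
      show "\<gamma> \<tau> \<notin> \<Gamma>" if "\<tau> \<in> {a + e n..b - e n}" for \<tau> using off[of \<tau>] that e(1)[of n] by simp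
    qed (use e[of n] ab in auto)
    also have "\<dots> \<le> K * integral {a..b} (speed \<gamma>)"
      by (intro mult_left_mono[OF _ K_nonneg] integral_subset_le integrable_continuous_interval
          continuous_on_subset[OF sp] sp) (use e(1)[of n] in \<open>auto simp: speed_nonneg\<close>)
    finally show ?thesis .
  qed
  have "(\<lambda>n. b - e n) \<longlonglongrightarrow> b - 0" "(\<lambda>n. a + e n) \<longlonglongrightarrow> a + 0" by (intro tendsto_intros el)+
  then have 1: "(\<lambda>n. b - e n) \<longlonglongrightarrow> b" "(\<lambda>n. a + e n) \<longlonglongrightarrow> a" by simp_all
  have in_ab: "b - e n \<in> {a..b}" "a + e n \<in> {a..b}" for n using e[of n] by auto
  have "(\<lambda>n. f (\<gamma> (b - e n), t0) - f (\<gamma> (a + e n), t0)) \<longlonglongrightarrow> f (\<gamma> b, t0) - f (\<gamma> a, t0)"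
    by (intro tendsto_diff continuous_on_tendsto_compose[OF fc 1(1)] continuous_on_tendsto_compose[OF fc 1(2)])
      (use in_ab ab in auto)
  then show ?thesis by (rule tendsto_upperbound) (use le in auto)
qed

lemma L_le_K: "L \<le> K"
  using B_nonneg by simp

text \<open>The part of the curve between its first and its last visit to \<open>\<Gamma>\<close> is bridged by the boundary
  datum.\<close>

lemma curve_increment_le_total:
  assumes \<gamma>: "C1_curve R 1 \<gamma>" and t0: "0 < t0" "t0 < T"
  shows "f (\<gamma> 1, t0) - f (\<gamma> 0, t0) \<le> K * integral {0..1} (speed \<gamma>)"
proof -
  define S where "S = {\<tau>\<in>{0..1}. \<gamma> \<tau> \<in> \<Gamma>}"
  have g: "continuous_on {0..1} \<gamma>" using \<gamma> unfolding C1_curve_def by simp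
  have "closed ({0..1} \<inter> \<gamma> -` \<Gamma>)"
    by (rule continuous_closed_preimage[OF g _ closed]) simp
  then have cl: "closed S" by (simp add: S_def Int_def)
  show ?thesis
  proof (cases "S = {}")
    case True
    then show ?thesis by (intro curve_increment_le_interior[OF \<gamma> _ _ _ _ t0]) (auto simp: S_def)
  next
    case False
    have bb: "bdd_below S" "bdd_above S" by (auto simp: S_def intro!: bdd_belowI[of _ 0] bdd_aboveI[of _ 1])
    define a b where "a = Inf S" and "b = Sup S"
    have aS: "a \<in> S" unfolding a_def by (rule closed_contains_Inf[OF False bb(1) cl])
    have bS: "b \<in> S" unfolding b_def by (rule closed_contains_Sup[OF False bb(2) cl])
    have lo: "a \<le> \<tau>" and hi: "\<tau> \<le> b" if "\<tau> \<in> S" for \<tau>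
      unfolding a_def b_def by (rule cInf_lower[OF that bb(1)]) (rule cSup_upper[OF that bb(2)])
    have ab: "0 \<le> a" "a \<le> b" "b \<le> 1" using aS bS lo[OF bS] by (auto simp: S_def)
    let ?I = "\<lambda>a b. integral {a..b} (speed \<gamma>)"
    have 1: "f (\<gamma> a, t0) - f (\<gamma> 0, t0) \<le> K * ?I 0 a"
    proof (rule curve_increment_le_interior[OF \<gamma> _ _ _ _ t0])
      show "\<gamma> \<tau> \<notin> \<Gamma>" if "0 < \<tau>" "\<tau> < a" for \<tau> using lo[of \<tau>] that ab by (auto simp: S_def)
    qed (use ab in auto)
    have 3: "f (\<gamma> 1, t0) - f (\<gamma> b, t0) \<le> K * ?I b 1"
    proof (rule curve_increment_le_interior[OF \<gamma> _ _ _ _ t0])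
      show "\<gamma> \<tau> \<notin> \<Gamma>" if "b < \<tau>" "\<tau> < 1" for \<tau> using hi[of \<tau>] that ab by (auto simp: S_def)
    qed (use ab in auto)
    have "f (\<gamma> a, t0) = f0 (\<gamma> a)" "f (\<gamma> b, t0) = f0 (\<gamma> b)"
      using aS bS t0 by (auto simp: S_def parabolic_boundary_def intro!: f_boundary)
    \<comment> \<open>Both ends of the middle piece lie on \<open>\<Gamma>\<close>, so its
      excursions off \<open>\<Gamma>\<close> do not matter: \<open>f0\<close> sees only the distance
      of the ends, which the length of the piece dominates.\<close>
    then have "f (\<gamma> b, t0) - f (\<gamma> a, t0) \<le> L * rdist R (\<gamma> a) (\<gamma> b)"
      using f0_Lip[of "\<gamma> a" "\<gamma> b"] by simp
    also have "\<dots> \<le> K * ?I a b"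
      by (intro mult_mono L_le_K rdist_restrict_le[OF \<gamma> ab] K_nonneg rdist_nonneg)
    finally have 2: "f (\<gamma> b, t0) - f (\<gamma> a, t0) \<le> K * ?I a b" .
    have int: "speed \<gamma> integrable_on {0..1}"
      by (rule integrable_continuous_interval[OF speed_continuous[OF \<gamma>]])
    have "?I 0 a + ?I a 1 = ?I 0 1" using ab int by (intro Henstock_Kurzweil_Integration.integral_combine) auto
    moreover have "?I a b + ?I b 1 = ?I a 1"
      using ab by (intro Henstock_Kurzweil_Integration.integral_combine integrable_subinterval_real[OF int]) auto
    ultimately have "K * ?I 0 1 = K * ?I 0 a + K * ?I a b + K * ?I b 1" by (simp flip: distrib_left)
    then show ?thesis using 1 2 3 by linarith
  qed
qed

text \<open>The bound along curves is divided by \<open>K\<close> before the infimum of lengths is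
  taken, hence the separate case \<open>K = 0\<close>. At \<open>t = 0\<close>, where no jets are
  tested, the bound is that of \<open>f0\<close>.\<close>

lemma space_Lip:
  assumes t: "t \<in> {0..<T}"
  shows "\<bar>f (x, t) - f (y, t)\<bar> \<le> K * rdist R x y"
proof -
  have le: "f (y, t) - f (x, t) \<le> K * rdist R x y" if t0: "0 < t" for x y
  proof (cases "K = 0")
    case True
    obtain \<gamma> where "C1_curve R 1 \<gamma>" "\<gamma> 0 = x" "\<gamma> 1 = y" using conn by blast
    then show ?thesis using curve_increment_le_total[of \<gamma> t] t t0 True by simp
  next
    case False
    then have K: "K > 0" using K_nonneg by linarith
    have "(f (y, t) - f (x, t)) / K \<le> rdist R x y"
    proof (rule rdist_geI)
      fix \<gamma> assume "C1_curve R 1 \<gamma>" "\<gamma> 0 = x" "\<gamma> 1 = y"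
      then show "(f (y, t) - f (x, t)) / K \<le> integral {0..1} (speed \<gamma>)"
        using curve_increment_le_total[of \<gamma> t] t t0 K by (simp add: pos_divide_le_eq mult.commute)
    qed
    then show ?thesis using K by (simp add: pos_divide_le_eq mult.commute)
  qed
  show ?thesis
  proof (cases "t = 0")
    case True
    have "\<bar>f (x, t) - f (y, t)\<bar> \<le> L * rdist R x y"
      using f0_Lip[of x y] True by (simp add: f_boundary parabolic_boundary_def)
    also have "\<dots> \<le> K * rdist R x y" by (rule mult_right_mono[OF L_le_K rdist_nonneg])
    finally show ?thesis .
  next
    case False
    then show ?thesis using le[of x y] le[of y x] t rdist_sym[of x y] by (auto simp: abs_le_iff)
  qed
qed

text \<open>\<open>Lim\<close> names a limit only if one exists. The Lipschitz bound in time gives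
  uniform continuity on \<open>[0, T[\<close>, hence an extension to \<open>T\<close>.\<close>

lemma final_limit: "((\<lambda>s. f (x, s)) \<longlongrightarrow> Lim (at_left T) (\<lambda>s. f (x, s))) (at_left T)"
proof -
  let ?C = "max L B"
  have C: "?C \<ge> 0" using L_nonneg by simp
  have "uniformly_continuous_on {0..<T} (\<lambda>s. f (x, s))"
    unfolding uniformly_continuous_on_def
  proof (intro allI impI)
    fix e :: real assume e: "e > 0"
    show "\<exists>d>0. \<forall>s\<in>{0..<T}. \<forall>s'\<in>{0..<T}. dist s' s < d \<longrightarrow> dist (f (x, s')) (f (x, s)) < e"
    \<comment> \<open>The summand 1 guards against \<open>?C = 0\<close>.\<close>
    proof (intro exI[of _ "e / (?C + 1)"] conjI ballI impI)
      show "e / (?C + 1) > 0" using e C by simp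
      fix s s' assume s: "s \<in> {0..<T}" "s' \<in> {0..<T}" "dist s' s < e / (?C + 1)"
      have "dist (f (x, s')) (f (x, s)) \<le> ?C * \<bar>s' - s\<bar>"
        using time_Lip[OF s(2,1), of x] by (simp add: dist_real_def)
      also have "\<dots> \<le> (?C + 1) * \<bar>s' - s\<bar>" by (intro mult_right_mono) auto
      also have "\<dots> < e" using s(3) C by (simp add: dist_real_def pos_less_divide_eq mult.commute)
      finally show "dist (f (x, s')) (f (x, s)) < e" .
    qed
  qed
  moreover have "T \<in> closure {0..<T}" using T by (simp add: closure_atLeastLessThan)
  ultimately obtain l where "((\<lambda>s. f (x, s)) \<longlongrightarrow> l) (at T within {0..<T})"
    by (rule uniformly_continuous_on_extension_at_closure) 
  moreover have "at T within {0..<T} = at_left T"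
    by (rule at_within_nhd[of T "{0<..}"]) (use T in auto)
  ultimately have "((\<lambda>s. f (x, s)) \<longlongrightarrow> l) (at_left T)" by simp
  then show ?thesis using tendsto_Lim[of "at_left T" "\<lambda>s. f (x, s)" l] by simp
qed

lemma final_time_space_Lip:
  assumes t: "t \<in> {0..T}"
  shows "\<bar>final_time_extension T f x t - final_time_extension T f y t\<bar> \<le> K * rdist R x y"
proof (cases "t < T")
  case True
  then show ?thesis using space_Lip[of t x y] t by (simp add: final_time_extension_def)
next
  case False
  let ?l = "\<lambda>x. Lim (at_left T) (\<lambda>s. f (x, s))"
  have "((\<lambda>s. \<bar>f (x, s) - f (y, s)\<bar>) \<longlongrightarrow> \<bar>?l x - ?l y\<bar>) (at_left T)"
    by (intro tendsto_intros final_limit)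
  then have "\<bar>?l x - ?l y\<bar> \<le> K * rdist R x y"
  proof (rule tendsto_upperbound)
    have "\<forall>\<^sub>F s in at_left T. s \<in> {0<..<T}" using T by (rule eventually_at_leftI[rotated]) simp
    then show "\<forall>\<^sub>F s in at_left T. \<bar>f (x, s) - f (y, s)\<bar> \<le> K * rdist R x y"
      by eventually_elim (rule space_Lip, simp)
  qed simp
  then show ?thesis using False by (simp add: final_time_extension_def)
qed

end

theorem theorem3p8:
  fixes R :: "('m::{t2_space,second_countable_topology}, 'e::euclidean_space) rmanifold"
    and \<Gamma> :: "'m set"
    and P f\<^sub>0 :: "'m \<Rightarrow> real"
    and d' :: "'m \<Rightarrow> 'm \<Rightarrow> real"
    and f :: "'m \<times> real \<Rightarrow> real"
    and T \<epsilon> \<xi> C\<^sub>M a\<^sub>0 d\<^sub>0 \<delta> :: real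
  assumes "T > 0"
    and "riemannian_manifold R"
    and "compact (UNIV :: 'm set)"
    and "geodesically_strongly_convex R"
    and "\<Gamma> \<noteq> {}" and "closed \<Gamma>" and "mboundary R \<subseteq> \<Gamma>"
    and "P \<in> Lip (rdist R) (- \<Gamma>)" and "\<forall>x\<in>- \<Gamma>. P x \<ge> 0"
    and "f\<^sub>0 \<in> Lip (rdist R) UNIV"
    and "Metric_space UNIV d'"
    and "\<epsilon> > 0" and "\<xi> > 0"
    and "\<forall>x y. \<bar>d' x y - rdist R x y\<bar> \<le> C\<^sub>M * \<epsilon> powr (1 + \<xi>)"
    and "a\<^sub>0 > 0" and "d\<^sub>0 > 0"
    and "\<forall>x\<in>{x. dist_to_set d' \<Gamma> x < a\<^sub>0} - \<Gamma>.
           C1_near R (dist_to_set d' \<Gamma>) x \<and>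
           rnorm R x (grad R (dist_to_set d' \<Gamma>) x) \<ge> d\<^sub>0"
    and "\<delta> > 0"
    and "\<forall>x. Cut R x \<inter> {y. rdist R x y \<le> \<delta>} = {}"
    and "\<exists>\<psi>\<^sub>b\<in>Lip (rdist R) UNIV. (\<forall>x\<in>\<Gamma>. \<psi>\<^sub>b x = f\<^sub>0 x) \<and>
           viscosity_subsolution R \<Gamma> P f\<^sub>0 T (\<lambda>(x, t). \<psi>\<^sub>b x)"
    and "viscosity_solution R \<Gamma> P f\<^sub>0 T f"
  shows "(\<forall>x. (\<lambda>t. f (x, t)) \<in> Lip dist {0..<T} \<and>
              lip_const dist {0..<T} (\<lambda>t. f (x, t))
                \<le> lip_const (rdist R) UNIV f\<^sub>0 + sup_norm (- \<Gamma>) P)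
       \<and> (\<forall>x y. rdist R x y \<le> \<delta> \<longrightarrow>
              (\<forall>t\<in>{0..T}. \<bar>final_time_extension T f x t - final_time_extension T f y t\<bar>
                 \<le> (lip_const (rdist R) UNIV f\<^sub>0 + 2 * sup_norm (- \<Gamma>) P) * rdist R x y))"
proof -
  interpret riem_manifold R by unfold_locales fact
  interpret eikonal R \<Gamma> P f\<^sub>0 T f
  proof
    \<comment> \<open>A minimizing geodesic is in particular a C1 curve; equal end points are joined
      by a constant curve.\<close>
    show "\<exists>\<gamma>. C1_curve R 1 \<gamma> \<and> \<gamma> 0 = x \<and> \<gamma> 1 = y" for x y
    proof (cases "x = y")
      case True
      then show ?thesis using C1_curve_const by blast
    next
      case False
      then show ?thesis
        using assms(4) unfolding geodesically_strongly_convex_def minimizing_geodesic_def geodesic_def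
        by blast
    qed
    show "P x \<ge> 0" if "x \<notin> \<Gamma>" for x using assms(9) that by blast
  qed fact+
  \<comment> \<open>The sharper constants \<open>max L B\<close> and \<open>B + max L B\<close> are
    weakened to those of the statement.\<close>
  have max: "max L B \<le> L + B" "K \<le> L + 2 * B" using L_nonneg B_nonneg by auto
  have C: "0 \<le> max L B" using L_nonneg by simp
  show ?thesis
  proof (intro conjI allI impI ballI)
    fix x
    have lip: "\<forall>t\<in>{0..<T}. \<forall>s\<in>{0..<T}. \<bar>f (x, t) - f (x, s)\<bar> \<le> max L B * dist t s"
      using time_Lip by (simp add: dist_real_def)
    show "(\<lambda>t. f (x, t)) \<in> Lip dist {0..<T}" using lip C unfolding Lip_def by blast
    have "lip_const dist {0..<T} (\<lambda>t. f (x, t)) \<le> max L B"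
      by (rule lip_const_le[OF C]) (use lip in blast)
    from order_trans[OF this max(1)] show "lip_const dist {0..<T} (\<lambda>t. f (x, t)) \<le> L + B" .
  next
    fix x y t assume "t \<in> {0..T}"
    then have "\<bar>final_time_extension T f x t - final_time_extension T f y t\<bar> \<le> K * rdist R x y"
      by (rule final_time_space_Lip)
    also have "\<dots> \<le> (L + 2 * B) * rdist R x y" by (rule mult_right_mono[OF max(2) rdist_nonneg])
    finally show "\<bar>final_time_extension T f x t - final_time_extension T f y t\<bar> \<le> (L + 2 * B) * rdist R x y" .
  qed
qed

end
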